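(* Let $n\ge1$. Let $U\subseteq\mathrm{Hol}(\mathbb B^n,\mathbb C^n)$ be an open set containing $\mathcal S_n^0$ and let $\Phi:U\to\mathbb C$ be a continuous functional. Let $F\in\mathcal S_n^0$ be an extremal function for $\Phi$, i.e. $\mathrm{Re}\,\Phi(f)\le\mathrm{Re}\,\Phi(F)$ for every $f\in\mathcal S_n^0$, and suppose that $\Phi$ is complex differentiable at $F$ with complex derivative $L$ at $F$. Suppose that $G(z,t)$ is a Herglotz vector field in the class $\mathcal M_n$ such that $F=f^G$. For each $t\ge0$ let $L_t$ be the continuous linear functional on $\mathrm{Hol}(\mathbb B^n,\mathbb C^n)$ defined by $$L_t(h):=L\left(d(F)_z\cdot\left[d(\varphi^G_t)_z\right]^{-1}\cdot h\left(\varphi^G_t\right)\right),\qquad h\in\mathrm{Hol}(\mathbb B^n,\mathbb C^n).$$ Then for a.e. $t\ge0$, $$\mathrm{Re}\,L_t(h)\le\mathrm{Re}\,L_t(G(\cdot,t))\quad\text{for all } h\in\mathcal M_n.$$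
   Context: $\mathbb B^n=\{z\in\mathbb C^n:\|z\|<1\}$ is the Euclidean unit ball, $\mathrm{Hol}(\mathbb B^n,\mathbb C^n)$ is the Fréchet space of holomorphic maps $\mathbb B^n\to\mathbb C^n$ with the compact-open topology, $\langle\cdot,\cdot\rangle$ is the standard Euclidean (Hermitian) inner product of $\mathbb C^n$, $\mathbb R^+=(0,\infty)$, and $d(f)_z$ (also $df_z$) is the complex derivative (Jacobian) of $f$ at $z$. An expression such as $d(F)_z\cdot[d(\varphi_t)_z]^{-1}\cdot h(\varphi_t)$ as argument of a functional denotes the map $z\mapsto d(F)_z\,[d(\varphi_t)_z]^{-1}\,h(\varphi_t(z))$. $\mathcal M_n=\{h\in\mathrm{Hol}(\mathbb B^n,\mathbb C^n): h(0)=0,\ dh_0=-\mathrm{id},\ \mathrm{Re}\,\langle h(z),z\rangle\le 0 \text{ for all } z\in\mathbb B^n\}$. A Herglotz vector field in the class $\mathcal M_n$ is a mapping $G:\mathbb B^n\times\mathbb R^+\to\mathbb C^n$ such that $G(z,\cdot)$ is measurable on $\mathbb R^+$ for every $z\in\mathbb B^n$ and $G(\cdot,t)\in\mathcal M_n$ for a.e. $t\in\mathbb R^+$. For such $G$, $\varphi^G_t$ denotes the unique (locally absolutely continuous in $t$) solution of $\dot\varphi_t(z)=G(\varphi_t(z),t)$ for a.e. $t\ge 0$, $\varphi_0(z)=z\in\mathbb B^n$; each $\varphi_t^G$ is a univalent holomorphic self-map of $\mathbb B^n$. The limit $f^G:=\lim_{t\to\infty}e^t\varphi^G_t$ exists locally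 uniformly in $\mathbb B^n$, and $\mathcal S_n^0:=\{f^G : G \text{ a Herglotz vector field in the class } \mathcal M_n\}$. Complex derivative: let $U\subseteq\mathrm{Hol}(\mathbb B^n,\mathbb C^n)$ be open and $\Phi:U\to\mathbb C$ continuous. $\Phi$ is differentiable at $f\in U$ along $h\in\mathrm{Hol}(\mathbb B^n,\mathbb C^n)$ if $\Lambda(f;h):=\lim_{\mathbb C\ni\delta\to0}\frac{\Phi(f+\delta h)-\Phi(f)}{\delta}$ exists. $\Phi$ is complex differentiable at $F\in U$ if there is an open neighborhood $V\subseteq U$ of $F$ such that $\Phi$ is differentiable at every $f\in V$ along every $h\in\mathrm{Hol}(\mathbb B^n,\mathbb C^n)$ and $\Lambda:V\times\mathrm{Hol}(\mathbb B^n,\mathbb C^n)\to\mathbb C$ is continuous; then $L:=\Lambda(F;\cdot)$, a continuous linear functional, is called the complex derivative of $\Phi$ at $F$. *)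

theory Defs
  imports "HOL-Analysis.Analysis"
begin

text \<open>
  A map on the open unit ball is represented by its extension by zero to the whole of
  \<open>complex ^ 'n\<close>.  With this convention distinct elements of \<open>hol\<close> are distinct maps on the ball,
  and \<open>hol\<close> is closed under the pointwise vector space operations.
\<close>

definition on_ball :: "(complex ^ 'n \<Rightarrow> complex ^ 'n) \<Rightarrow> complex ^ 'n \<Rightarrow> complex ^ 'n" where
  "on_ball f = (\<lambda>z. if z \<in> ball 0 1 then f z else 0)"

text \<open>Complex differentiability: the real Frechet derivative is given by a complex matrix.\<close>

definition hol :: "(complex ^ 'n \<Rightarrow> complex ^ 'n) set" where
  "hol = {f. (\<forall>z \<in> ball 0 1. \<exists>A :: complex ^ 'n ^ 'n. (f has_derivative (\<lambda>v. A *v v)) (at z)) \<and>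
             (\<forall>z. z \<notin> ball 0 1 \<longrightarrow> f z = 0)}"

definition hol_topology :: "(complex ^ 'n \<Rightarrow> complex ^ 'n) topology" where
  "hol_topology = topology_generated_by
     {{f \<in> hol. f ` K \<subseteq> W} | K W. compact K \<and> K \<subseteq> ball 0 1 \<and> open W}"

text \<open>
  The complex counterpart of \<^const>\<open>jacobian\<close>, which is restricted to real matrices.
\<close>

definition cjacobian :: "(complex ^ 'n \<Rightarrow> complex ^ 'n) \<Rightarrow> complex ^ 'n \<Rightarrow> complex ^ 'n ^ 'n" where
  "cjacobian f z = matrix (frechet_derivative f (at z))"

definition hermitian :: "complex ^ 'n \<Rightarrow> complex ^ 'n \<Rightarrow> complex" where
  "hermitian x y = (\<Sum>i\<in>UNIV. x $ i * cnj (y $ i))"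

definition class_M :: "(complex ^ 'n \<Rightarrow> complex ^ 'n) set" where
  "class_M = {h \<in> hol. h 0 = 0 \<and> cjacobian h 0 = - mat 1 \<and>
                       (\<forall>z \<in> ball 0 1. Re (hermitian (h z) z) \<le> 0)}"

text \<open>
  Only the values of \<open>G z t\<close> for \<open>z\<close> in the ball and \<open>t > 0\<close> are relevant.
\<close>

definition herglotz_field :: "(complex ^ 'n \<Rightarrow> real \<Rightarrow> complex ^ 'n) \<Rightarrow> bool" where
  "herglotz_field G \<longleftrightarrow>
     (\<forall>z \<in> ball 0 1. (\<lambda>t. G z t) \<in> borel_measurable (lebesgue_on {0<..})) \<and>
     (AE t in lebesgue_on {0<..}. on_ball (\<lambda>z. G z t) \<in> class_M)"

definition abs_cont_on_interval :: "real \<Rightarrow> real \<Rightarrow> (real \<Rightarrow> 'a :: real_normed_vector) \<Rightarrow> bool" where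
  "abs_cont_on_interval c d u \<longleftrightarrow>
     (\<forall>\<epsilon>>0. \<exists>\<delta>>0. \<forall>D :: (real \<times> real) set.
        finite D \<and> (\<forall>(a, b) \<in> D. c \<le> a \<and> a \<le> b \<and> b \<le> d) \<and>
        disjoint_family_on (\<lambda>(a, b). {a<..<b}) D \<and> (\<Sum>(a, b)\<in>D. b - a) < \<delta> \<longrightarrow>
        (\<Sum>(a, b)\<in>D. norm (u b - u a)) < \<epsilon>)"

definition trajectory ::
  "(complex ^ 'n \<Rightarrow> real \<Rightarrow> complex ^ 'n) \<Rightarrow> complex ^ 'n \<Rightarrow> (real \<Rightarrow> complex ^ 'n) \<Rightarrow> bool" where
  "trajectory G z u \<longleftrightarrow>
     u 0 = z \<and> (\<forall>t\<ge>0. u t \<in> ball 0 1) \<and>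
     (\<forall>T\<ge>0. abs_cont_on_interval 0 T u) \<and>
     (AE t in lebesgue_on {0..}. (u has_vector_derivative G (u t) t) (at t within {0..}))"

text \<open>
  Trajectories are unique only on \<open>[0, \<infinity>)\<close>, since \<open>trajectory\<close> does not constrain negative times;
  hence the description selects the value at time \<open>t\<close> and not the curve.
\<close>

definition flow :: "(complex ^ 'n \<Rightarrow> real \<Rightarrow> complex ^ 'n) \<Rightarrow> real \<Rightarrow> complex ^ 'n \<Rightarrow> complex ^ 'n" where
  "flow G t z = (THE w. \<exists>u. trajectory G z u \<and> u t = w)"

text \<open>Convergence in \<open>hol_topology\<close> is locally uniform convergence in the ball.\<close>

definition loewner_limit :: "(complex ^ 'n \<Rightarrow> real \<Rightarrow> complex ^ 'n) \<Rightarrow> complex ^ 'n \<Rightarrow> complex ^ 'n" where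
  "loewner_limit G =
     (THE f. limitin hol_topology (\<lambda>t. on_ball (\<lambda>z. exp t *\<^sub>R flow G t z)) f at_top)"

definition class_S0 :: "(complex ^ 'n \<Rightarrow> complex ^ 'n) set" where
  "class_S0 = {loewner_limit G | G. herglotz_field G}"

definition has_directional_derivative ::
  "((complex ^ 'n \<Rightarrow> complex ^ 'n) \<Rightarrow> complex) \<Rightarrow> (complex ^ 'n \<Rightarrow> complex ^ 'n) \<Rightarrow>
   (complex ^ 'n \<Rightarrow> complex ^ 'n) \<Rightarrow> complex \<Rightarrow> bool" where
  "has_directional_derivative \<Phi> f h l \<longleftrightarrow>
     ((\<lambda>\<delta>. (\<Phi> (\<lambda>z. f z + \<delta> *s h z) - \<Phi> f) / \<delta>) \<longlongrightarrow> l) (at 0)"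

text \<open>The functional \<open>L\<close> is determined on \<open>hol\<close> only.\<close>

definition has_complex_derivative ::
  "(complex ^ 'n \<Rightarrow> complex ^ 'n) set \<Rightarrow> ((complex ^ 'n \<Rightarrow> complex ^ 'n) \<Rightarrow> complex) \<Rightarrow>
   (complex ^ 'n \<Rightarrow> complex ^ 'n) \<Rightarrow> ((complex ^ 'n \<Rightarrow> complex ^ 'n) \<Rightarrow> complex) \<Rightarrow> bool" where
  "has_complex_derivative U \<Phi> F L \<longleftrightarrow>
     (\<exists>V \<Lambda>. openin hol_topology V \<and> F \<in> V \<and> V \<subseteq> U \<and>
        (\<forall>f\<in>V. \<forall>h\<in>hol. has_directional_derivative \<Phi> f h (\<Lambda> f h)) \<and>
        continuous_map (prod_topology (subtopology hol_topology V) hol_topology) euclidean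
          (\<lambda>(f, h). \<Lambda> f h) \<and>
        (\<forall>h\<in>hol. L h = \<Lambda> F h))"

definition transported_functional ::
  "((complex ^ 'n \<Rightarrow> complex ^ 'n) \<Rightarrow> complex) \<Rightarrow> (complex ^ 'n \<Rightarrow> complex ^ 'n) \<Rightarrow>
   (complex ^ 'n \<Rightarrow> real \<Rightarrow> complex ^ 'n) \<Rightarrow> real \<Rightarrow> (complex ^ 'n \<Rightarrow> complex ^ 'n) \<Rightarrow> complex" where
  "transported_functional L F G t h =
     L (on_ball (\<lambda>z. cjacobian F z *v (matrix_inv (cjacobian (flow G t) z) *v h (flow G t z))))"

end

theory Submission
  imports Defs "HOL-Complex_Analysis.Complex_Analysis"
begin

text \<open>
  The inequality comes from a spike variation. Replace \<open>G\<close> by a map \<open>h\<close> of the class on the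
  time interval \<open>(t - \<epsilon>, t]\<close> and keep it elsewhere. Since \<open>f\<^sup>G = exp t *\<^sub>R f \<circ> \<phi>\<^sub>t\<close>, where \<open>f\<close> belongs
  to the field shifted by \<open>t\<close> and so does not see the spike, the new limit map is
  \<open>F + \<epsilon> dF [d\<phi>\<^sub>t]\<^sup>-\<^sup>1 (h (\<phi>\<^sub>t) - G (\<phi>\<^sub>t, t)) + o(\<epsilon>)\<close>, locally uniformly, provided that \<open>t\<close> is a Lebesgue
  point of \<open>G z\<close> for all \<open>z\<close> in a countable dense set; the maps of the class are locally uniformly
  Lipschitz, so this exceptional null set of times serves all \<open>z\<close> and all \<open>h\<close>. Extremality of
  \<open>F\<close> and the mean value theorem for \<open>\<Phi>\<close> then give the inequality.

  Existence of the limit maps rests on bounds for the class: \<open>\<langle>h z, z\<rangle>\<close> is controlled by the Schwarz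
  lemma on complex lines, and the full norm of \<open>h\<close> by the maximum principle.
\<close>

section \<open>Lebesgue differentiation and absolutely continuous functions\<close>

text \<open>The map inside \<open>transported_functional\<close> is the chain rule in disguise.
  Differentiating \<open>F = exp t *\<^sub>R f \<circ> \<phi>\<^sub>t\<close> shows that
  \<open>dF\<close> times the inverse of \<open>d\<phi>\<^sub>t\<close> is \<open>exp t\<close>
  times the derivative of \<open>f\<close> at \<open>\<phi>\<^sub>t\<close>. A spike ending at
  \<open>t\<close> displaces the point \<open>\<phi>\<^sub>t z\<close>, and the fixed map
  \<open>f\<close> carries this displacement to the limit map. Fields are only measurable in time,
  so trajectories satisfy their equation off a null set. Existence, uniqueness and differentiability
  in the initial value therefore rest on integral equations and on Gronwall inequalities for
  Lipschitz curves that are differentiable almost everywhere. Since \<open>flow\<close> and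
  \<open>loewner_limit\<close> are definite descriptions, existence and uniqueness must precede
  every other statement on them. The functional \<open>\<Lambda>\<close> is not assumed to be linear
  in its second argument. Splitting its value at a difference of two maps is again a matter of
  difference quotients of \<open>\<Phi>\<close>, with base points and directions that both
  vary.\<close>

lemma has_vector_derivative_atD:
  fixes u :: "real \<Rightarrow> 'a::real_normed_vector"
  assumes "(u has_vector_derivative D) (at t)" "0 < \<eta>"
  obtains d where "d > 0" "\<And>y. \<bar>y - t\<bar> < d \<Longrightarrow> norm (u y - u t - (y - t) *\<^sub>R D) \<le> \<eta> * \<bar>y - t\<bar>"
  using assms unfolding has_vector_derivative_def has_derivative_at_alt by force

lemma has_vector_derivative_atI:
  fixes u :: "real \<Rightarrow> 'a::real_normed_vector"
  assumes "\<And>\<eta>. 0 < \<eta> \<Longrightarrow>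
    \<exists>d>0. \<forall>y. \<bar>y - t\<bar> < d \<longrightarrow> norm (u y - u t - (y - t) *\<^sub>R D) \<le> \<eta> * \<bar>y - t\<bar>"
  shows "(u has_vector_derivative D) (at t)"
  using assms unfolding has_vector_derivative_def has_derivative_at_alt
  by (auto intro: bounded_linear_scaleR_left)

text \<open>Henstock's lemma bounds the total length of disjoint intervals on which a difference
  quotient is bad, and Vitali's theorem covers the bad set by such intervals.\<close>

lemma negligible_bad_difference_quotients:
  fixes f :: "real \<Rightarrow> 'a::euclidean_space"
  assumes f: "f integrable_on {a..b}" and \<eta>: "0 < \<eta>"
  defines "F \<equiv> \<lambda>t. integral {a..t} f"
  shows "negligible {x \<in> {a<..<b}. \<forall>d>0. \<exists>y. \<bar>y - x\<bar> < d \<and>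
    \<eta> * \<bar>y - x\<bar> < norm (F y - F x - (y - x) *\<^sub>R f x)}" (is "negligible ?E")
  unfolding negligible_outer_le
proof (intro allI impI)
  fix e :: real assume "e > 0"
  have "e * \<eta> > 0" using \<open>e > 0\<close> \<eta> by simp
  obtain \<gamma> where \<gamma>: "gauge \<gamma>"
    and hen: "\<And>p. \<lbrakk>p tagged_partial_division_of (cbox a b); \<gamma> fine p\<rbrakk> \<Longrightarrow>
             (\<Sum>(x,k)\<in>p. norm (measure lborel k *\<^sub>R f x - integral k f)) < e * \<eta>"
    using Henstock_lemma[of f a b "e * \<eta>"] f \<open>e * \<eta> > 0\<close> by auto
  \<comment> \<open>A pair \<open>(x, y)\<close> encodes the interval between a point
    \<open>x\<close> of the bad set and a point \<open>y\<close> at which the quotient is bad. It is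
    written as a ball with centre \<open>c\<close> and radius \<open>r\<close> because Vitali's
    theorem is applied to balls; the tag \<open>x\<close> is an endpoint, not the centre.\<close>
  define r where "r = (\<lambda>(x::real, y::real). \<bar>y - x\<bar> / 2)"
  define c where "c = (\<lambda>(x::real, y::real). (x + y) / 2)"
  define J where "J = (\<lambda>i. cball (c i) (r i))"
  define K where "K = {(x, y). x \<in> {a<..<b} \<and> y \<in> {a<..<b} \<and> x \<noteq> y \<and> J (x, y) \<subseteq> \<gamma> x \<and>
     \<eta> * \<bar>y - x\<bar> < norm (F y - F x - (y - x) *\<^sub>R f x)}"
  have J: "J (x, y) = {min x y..max x y}" for x y
    by (auto simp: J_def c_def r_def cball_eq_atLeastAtMost min_def max_def field_simps)
  have rpos: "0 < r i" if "i \<in> K" for i using that by (auto simp: K_def r_def)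
  have cover: "\<exists>i. i \<in> K \<and> x \<in> cball (c i) (r i) \<and> r i < d" if xE: "x \<in> ?E" and d: "0 < d" for x d
  proof -
    have xab: "x \<in> {a<..<b}" using xE by simp
    have "open (\<gamma> x \<inter> {a<..<b})" "x \<in> \<gamma> x \<inter> {a<..<b}"
      using \<gamma> xab by (auto simp: gauge_def)
    then obtain s where s: "s > 0" "ball x s \<subseteq> \<gamma> x \<inter> {a<..<b}"
      by (meson open_contains_ball)
    have "\<forall>d>0. \<exists>y. \<bar>y - x\<bar> < d \<and> \<eta> * \<bar>y - x\<bar> < norm (F y - F x - (y - x) *\<^sub>R f x)"
      using xE by simp
    moreover have "min s d > 0" using s d by simp
    ultimately obtain y where y: "\<bar>y - x\<bar> < min s d" "\<eta> * \<bar>y - x\<bar> < norm (F y - F x - (y - x) *\<^sub>R f x)"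
      by blast
    have "y \<noteq> x" using y by auto
    have sub: "J (x, y) \<subseteq> ball x s" unfolding J using y by (auto simp: dist_real_def)
    have "y \<in> ball x s" using y by (auto simp: dist_real_def)
    then have "(x, y) \<in> K" using sub s y xab \<open>y \<noteq> x\<close> unfolding K_def by blast
    moreover have "x \<in> cball (c (x,y)) (r (x,y))" using J[of x y] by (auto simp: J_def)
    moreover have "r (x, y) < d" using y abs_ge_zero[of "y - x"] by (simp add: r_def) linarith
    ultimately show ?thesis by blast
  qed
  obtain C where C: "countable C" "C \<subseteq> K"
     "pairwise (\<lambda>i j. disjnt (cball (c i) (r i)) (cball (c j) (r j))) C"
     "negligible (?E - (\<Union>i \<in> C. cball (c i) (r i)))"
    using Vitali_covering_theorem_cballs[where a=c and r=r and K=K and S="?E", OF rpos cover] by blast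
  \<comment> \<open>Disjointness and \<open>J (x, y) \<subseteq> \<gamma> x\<close> make any finite
    part of the cover a fine partial division. Each interval contributes at least
    \<open>\<eta>\<close> times its length to Henstock's sum, which is below
    \<open>e * \<eta>\<close>, so the lengths add up to at most \<open>e\<close>; this bound passes
    to the countable union.\<close>
  have bound: "measure lebesgue (\<Union>i\<in>I. J i) \<le> e" if I: "I \<subseteq> C" "finite I" for I
  proof -
    define p where "p = (\<lambda>(x, y). (x, J (x, y))) ` I"
    have disj: "J i \<inter> J j = {}" if "i \<in> I" "j \<in> I" "i \<noteq> j" for i j
      using C(3) I that by (auto simp: pairwise_def disjnt_def J_def)
    have inj: "inj_on (\<lambda>(x, y). (x, J (x, y))) I"
    proof (rule inj_onI)
      fix i j assume ij: "i \<in> I" "j \<in> I" "(\<lambda>(x, y). (x, J (x, y))) i = (\<lambda>(x, y). (x, J (x, y))) j"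
      then have "J i = J j" "J i \<noteq> {}" by (auto simp: J split: prod.splits)
      then show "i = j" using disj ij by blast
    qed
    have IK: "I \<subseteq> K" using I C by blast
    have pd: "p tagged_partial_division_of cbox a b"
      unfolding tagged_partial_division_of_def
    proof (intro conjI allI impI)
      show "finite p" using I by (simp add: p_def)
      fix x k assume "(x, k) \<in> p"
      then obtain y where xy: "(x, y) \<in> I" "k = J (x, y)" by (auto simp: p_def)
      have "(x, y) \<in> K" using xy(1) IK by blast
      then have "x \<in> {a<..<b}" "y \<in> {a<..<b}" by (simp_all add: K_def)
      then show "x \<in> k" "k \<subseteq> cbox a b" unfolding xy(2) J by auto
      show "\<exists>a b. k = cbox a b" unfolding xy(2) J box_real[symmetric] by blast
    next
      fix x1 K1 x2 K2 assume "(x1, K1) \<in> p \<and> (x2, K2) \<in> p \<and> (x1, K1) \<noteq> (x2, K2)"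
      then have K12: "(x1, K1) \<in> p" "(x2, K2) \<in> p" "(x1, K1) \<noteq> (x2, K2)" by auto
      obtain y1 where 1: "(x1, y1) \<in> I" "K1 = J (x1, y1)" using K12(1) by (auto simp: p_def)
      obtain y2 where 2: "(x2, y2) \<in> I" "K2 = J (x2, y2)" using K12(2) by (auto simp: p_def)
      have "(x1, y1) \<noteq> (x2, y2)" using K12(3) 1 2 by auto
      then have "K1 \<inter> K2 = {}" using disj[OF 1(1) 2(1)] 1 2 by simp
      then show "interior K1 \<inter> interior K2 = {}"
        by (meson disjoint_iff interior_subset subsetD)
    qed
    have "\<gamma> fine p" using IK by (auto simp: fine_def p_def K_def)
    then have less: "(\<Sum>(x,k)\<in>p. norm (measure lborel k *\<^sub>R f x - integral k f)) < e * \<eta>"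
      using hen pd by blast
    have "\<eta> * (\<Sum>i\<in>I. measure lebesgue (J i)) \<le> (\<Sum>i\<in>I. norm (measure lborel (J i) *\<^sub>R f (fst i) - integral (J i) f))"
      unfolding sum_distrib_left
    proof (rule sum_mono)
      fix i assume "i \<in> I"
      then obtain x y where i: "i = (x, y)" "(x, y) \<in> K" using IK by (cases i) auto
      have xy: "x \<in> {a<..<b}" "y \<in> {a<..<b}" "\<eta> * \<bar>y - x\<bar> < norm (F y - F x - (y - x) *\<^sub>R f x)"
        using i by (auto simp: K_def)
      have fi: "f integrable_on {a..t}" if "t \<le> b" for t
        using integrable_subinterval_real[OF f] that by auto
      have split: "F t = F s + integral {s..t} f" if "a \<le> s" "s \<le> t" "t \<le> b" for s t
        using Henstock_Kurzweil_Integration.integral_combine[OF that(1,2) fi[OF that(3)]] by (simp add: F_def)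
      have "norm (measure lborel (J (x,y)) *\<^sub>R f x - integral (J (x,y)) f) = norm (F y - F x - (y - x) *\<^sub>R f x)"
      proof (cases "x \<le> y")
        case True
        then show ?thesis using split[of x y] xy by (simp add: J norm_minus_commute)
      next
        case False
        then have "measure lborel (J (x,y)) *\<^sub>R f x - integral (J (x,y)) f = F y - F x - (y - x) *\<^sub>R f x"
          using split[of y x] xy by (simp add: J algebra_simps)
        then show ?thesis by simp
      qed
      moreover have "measure lebesgue (J (x, y)) = \<bar>y - x\<bar>" by (simp add: J) (simp add: min_def max_def)
      ultimately show "\<eta> * measure lebesgue (J i) \<le> norm (measure lborel (J i) *\<^sub>R f (fst i) - integral (J i) f)"
        using xy i by simp
    qed
    also have "\<dots> = (\<Sum>(x,k)\<in>p. norm (measure lborel k *\<^sub>R f x - integral k f))"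
      unfolding p_def by (subst sum.reindex[OF inj]) (auto intro!: sum.cong)
    finally have "\<eta> * (\<Sum>i\<in>I. measure lebesgue (J i)) \<le> \<eta> * e" using less by (simp add: mult.commute)
    then have "(\<Sum>i\<in>I. measure lebesgue (J i)) \<le> e" using \<eta> by simp
    moreover have "measure lebesgue (\<Union>i\<in>I. J i) \<le> (\<Sum>i\<in>I. measure lebesgue (J i))"
      by (rule measure_UNION_le) (use I in \<open>auto simp: J_def\<close>)
    ultimately show ?thesis by linarith
  qed
  have JU: "(\<Union>i\<in>C. J i) \<in> lmeasurable" "measure lebesgue (\<Union>i\<in>C. J i) \<le> e"
    using fmeasurable_UN_bound[of C J lebesgue e] measure_UN_bound[of C J lebesgue e] C(1) bound
    by (auto simp: J_def)
  let ?R = "?E - (\<Union>i \<in> C. J i)"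
  have R: "negligible ?R" using C(4) by (simp add: J_def)
  show "\<exists>T. ?E \<subseteq> T \<and> T \<in> lmeasurable \<and> measure lebesgue T \<le> e"
  proof (intro exI[of _ "(\<Union>i\<in>C. J i) \<union> ?R"] conjI)
    show "(\<Union>i\<in>C. J i) \<union> ?R \<in> lmeasurable"
      using JU R negligible_imp_measurable by blast
    have "measure lebesgue ((\<Union>i\<in>C. J i) \<union> ?R) \<le> measure lebesgue (\<Union>i\<in>C. J i) + measure lebesgue ?R"
      using JU R negligible_imp_measurable by (intro measure_Un_le) auto
    also have "\<dots> \<le> e" using JU R negligible_imp_measure0 by fastforce
    finally show "measure lebesgue ((\<Union>i\<in>C. J i) \<union> ?R) \<le> e" .
  qed auto
qed

text \<open>If the derivative fails to be \<open>f t\<close>, then some tolerance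
  \<open>1 / Suc n\<close> is exceeded by quotients arbitrarily close to \<open>t\<close>. The
  exceptional set is thus a countable union of negligible sets of the preceding kind.\<close>

theorem integral_has_vector_derivative_AE:
  fixes f :: "real \<Rightarrow> 'a::euclidean_space"
  assumes f: "f integrable_on {a..b}"
  obtains N where "negligible N"
    "\<And>t. t \<in> {a<..<b} - N \<Longrightarrow> ((\<lambda>t. integral {a..t} f) has_vector_derivative f t) (at t)"
proof -
  define F where "F = (\<lambda>t. integral {a..t} f)"
  define N where "N = (\<Union>n::nat. {x \<in> {a<..<b}. \<forall>d>0. \<exists>y. \<bar>y - x\<bar> < d \<and>
    (1 / Suc n) * \<bar>y - x\<bar> < norm (F y - F x - (y - x) *\<^sub>R f x)})"
  have "negligible N"
    unfolding N_def F_def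
    by (intro negligible_Union_nat negligible_bad_difference_quotients f) auto
  moreover have "(F has_vector_derivative f t) (at t)" if t: "t \<in> {a<..<b} - N" for t
  proof (rule has_vector_derivative_atI)
    fix \<eta> :: real assume "\<eta> > 0"
    then obtain n where n: "1 / real (Suc n) < \<eta>" using nat_approx_posE by blast
    obtain d where d: "d > 0" "\<And>y. \<bar>y - t\<bar> < d \<Longrightarrow> \<not> (1 / Suc n) * \<bar>y - t\<bar> < norm (F y - F t - (y - t) *\<^sub>R f t)"
      using t unfolding N_def by blast
    have "norm (F y - F t - (y - t) *\<^sub>R f t) \<le> \<eta> * \<bar>y - t\<bar>" if "\<bar>y - t\<bar> < d" for y
      using d(2)[OF that] mult_right_mono[of "1 / Suc n" \<eta> "\<bar>y - t\<bar>"] n by linarith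
    with d show "\<exists>d>0. \<forall>y. \<bar>y - t\<bar> < d \<longrightarrow> norm (F y - F t - (y - t) *\<^sub>R f t) \<le> \<eta> * \<bar>y - t\<bar>" by blast
  qed
  ultimately show thesis using that unfolding F_def by blast
qed

text \<open>Along a tagged division the increments of \<open>u\<close> telescope to
  \<open>u b - u a\<close>. On intervals tagged off the null set, the derivative makes each error
  small relative to the length. Intervals tagged in the null set lie in an open set of measure below
  the \<open>\<delta>\<close> of absolute continuity, so their increments are small in
  total.\<close>

theorem fundamental_theorem_of_calculus_abs_cont:
  fixes u :: "real \<Rightarrow> 'a::euclidean_space"
  assumes ac: "abs_cont_on_interval a b u" and ab: "a \<le> b" and N: "negligible N"
    and deriv: "\<And>t. t \<in> {a<..<b} - N \<Longrightarrow> (u has_vector_derivative f t) (at t)"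
  shows "(f has_integral u b - u a) {a..b}"
proof -
  \<comment> \<open>The endpoints join the null set because \<open>deriv\<close> speaks of interior
    points only. As \<open>g\<close> vanishes on \<open>M\<close>, a tag in \<open>M\<close> adds
    nothing but its increment of \<open>u\<close> to the error.\<close>
  define M where "M = N \<union> {a, b}"
  have M: "negligible M" using N by (simp add: M_def)
  define g where "g = (\<lambda>t. if t \<in> M then 0 else f t)"
  have "(g has_integral u b - u a) {a..b}"
    unfolding has_integral_real
  proof (intro allI impI)
    fix e :: real assume e: "e > 0"
    obtain \<delta> where \<delta>: "\<delta> > 0" and ac': "\<And>D. finite D \<Longrightarrow> (\<And>c d. (c, d) \<in> D \<Longrightarrow> a \<le> c \<and> c \<le> d \<and> d \<le> b) \<Longrightarrow>
        disjoint_family_on (\<lambda>(a, b). {a<..<b}) D \<Longrightarrow> (\<Sum>(a, b)\<in>D. b - a) < \<delta> \<Longrightarrow>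
        (\<Sum>(a, b)\<in>D. norm (u b - u a)) < e / 2"
      using ac e unfolding abs_cont_on_interval_def
      by (metis (no_types, lifting) case_prodI2 half_gt_zero)
    obtain W where W: "open W" "M \<subseteq> W" "W - M \<in> lmeasurable" "emeasure lebesgue (W - M) < ennreal \<delta>"
      using sets_lebesgue_outer_open[OF negligible_imp_sets[OF M] \<delta>] by blast
    have Wm: "W \<in> lmeasurable" "measure lebesgue W < \<delta>"
    proof -
      have WM: "W = (W - M) \<union> M" using W by blast
      show "W \<in> lmeasurable"
        using W(3) negligible_imp_measurable[OF M] by (subst WM) (rule fmeasurable.Un)
      have "measure lebesgue W \<le> measure lebesgue (W - M) + measure lebesgue M"
        using W(3) negligible_imp_measurable[OF M] by (subst WM) (intro measure_Un_le, auto)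
      also have "\<dots> = measure lebesgue (W - M)" using negligible_imp_measure0[OF M] by simp
      also have "\<dots> < \<delta>" using W(3,4) \<delta>
        by (simp add: emeasure_eq_measure2 ennreal_less_iff)
      finally show "measure lebesgue W < \<delta>" .
    qed
    \<comment> \<open>The summand 1 keeps the denominator positive when
      \<open>a = b\<close>.\<close>
    define \<eta> where "\<eta> = e / (2 * (b - a + 1))"
    have \<eta>: "\<eta> > 0" "\<eta> * (b - a) < e / 2" using e ab by (auto simp: \<eta>_def field_simps)
    have "\<exists>d>0. \<forall>y. \<bar>y - t\<bar> < d \<longrightarrow> norm (u y - u t - (y - t) *\<^sub>R f t) \<le> \<eta> * \<bar>y - t\<bar>"
      if "t \<in> {a..b} - M" for t
      using has_vector_derivative_atD[OF deriv \<eta>(1), of t] that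
      unfolding M_def by (metis DiffE DiffI UnCI greaterThanLessThan_iff atLeastAtMost_iff
           insertCI less_eq_real_def)
    then obtain \<rho> where \<rho>: "\<And>t. t \<in> {a..b} - M \<Longrightarrow> \<rho> t > 0"
      "\<And>t y. t \<in> {a..b} - M \<Longrightarrow> \<bar>y - t\<bar> < \<rho> t \<Longrightarrow> norm (u y - u t - (y - t) *\<^sub>R f t) \<le> \<eta> * \<bar>y - t\<bar>"
      by metis
    define \<gamma> where "\<gamma> = (\<lambda>t. if t \<in> M then W else if t \<in> {a..b} then ball t (\<rho> t) else UNIV)"
    have gauge: "gauge \<gamma>" unfolding gauge_def \<gamma>_def using W \<rho>(1) by auto
    have small: "norm ((\<Sum>(x,k)\<in>p. measure lborel k *\<^sub>R g x) - (u b - u a)) < e"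
      if p: "p tagged_division_of {a..b}" "\<gamma> fine p" for p
    proof -
      note pD = tagged_division_ofD[OF p(1)]
      have fine: "k \<subseteq> \<gamma> x" if "(x, k) \<in> p" for x k using p(2) that by (auto simp: fine_def)
      have kint: "\<exists>c d. k = {c..d} \<and> c \<le> x \<and> x \<le> d \<and> a \<le> c \<and> d \<le> b" if "(x, k) \<in> p" for x k
        using pD(2,3,4)[OF that] by (auto simp: subset_iff)
      define q where "q = {(x, k) \<in> p. x \<in> M}"
      have qp: "q \<subseteq> p" by (auto simp: q_def)
      have fin: "finite p" "finite q" using pD(1) qp finite_subset by auto
      have qpart: "q tagged_partial_division_of {a..b}"
        using p(1) qp by (meson tagged_division_of_def tagged_partial_division_subset)
      have "(\<Sum>(x,k)\<in>p. measure lborel k *\<^sub>R g x) - (u b - u a)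
          = (\<Sum>(x,k)\<in>p. measure lborel k *\<^sub>R g x - (u (Sup k) - u (Inf k)))"
        using additive_tagged_division_1[OF ab p(1), of u] by (simp add: sum_subtractf split_def)
      also have "norm \<dots> \<le> (\<Sum>(x,k)\<in>p. norm (measure lborel k *\<^sub>R g x - (u (Sup k) - u (Inf k))))"
        by (rule order_trans[OF norm_sum]) (simp add: split_def)
      also have "\<dots> = (\<Sum>(x,k)\<in>p - q. norm (measure lborel k *\<^sub>R g x - (u (Sup k) - u (Inf k))))
          + (\<Sum>(x,k)\<in>q. norm (measure lborel k *\<^sub>R g x - (u (Sup k) - u (Inf k))))"
        by (rule sum.subset_diff) (use qp fin in auto)
      also have "(\<Sum>(x,k)\<in>p - q. norm (measure lborel k *\<^sub>R g x - (u (Sup k) - u (Inf k)))) < e / 2"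
      proof -
        have "(\<Sum>(x,k)\<in>p - q. norm (measure lborel k *\<^sub>R g x - (u (Sup k) - u (Inf k)))) \<le> (\<Sum>(x,k)\<in>p - q. \<eta> * measure lborel k)"
        proof (rule sum_mono, clarify)
          fix x k assume xk: "(x, k) \<in> p" "(x, k) \<notin> q"
          then have xM: "x \<notin> M" by (auto simp: q_def)
          obtain c d where k: "k = {c..d}" "c \<le> x" "x \<le> d" "a \<le> c" "d \<le> b" using kint[OF xk(1)] by blast
          have "k \<subseteq> ball x (\<rho> x)" using fine[OF xk(1)] xM k by (auto simp: \<gamma>_def split: if_splits)
          then have "\<bar>c - x\<bar> < \<rho> x" "\<bar>d - x\<bar> < \<rho> x"
            using k subsetD[of k "ball x (\<rho> x)" c] subsetD[of k "ball x (\<rho> x)" d] by (auto simp: dist_real_def)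
          then have "norm (u c - u x - (c - x) *\<^sub>R f x) \<le> \<eta> * \<bar>c - x\<bar>" "norm (u d - u x - (d - x) *\<^sub>R f x) \<le> \<eta> * \<bar>d - x\<bar>"
            using \<rho>(2)[of x c] \<rho>(2)[of x d] xM k by simp_all
          moreover have "measure lborel k *\<^sub>R g x - (u (Sup k) - u (Inf k)) =
             (u c - u x - (c - x) *\<^sub>R f x) - (u d - u x - (d - x) *\<^sub>R f x)"
            using k xM by (simp add: g_def algebra_simps)
          ultimately have "norm (measure lborel k *\<^sub>R g x - (u (Sup k) - u (Inf k))) \<le> \<eta> * \<bar>c - x\<bar> + \<eta> * \<bar>d - x\<bar>"
            using norm_triangle_ineq4[of "u c - u x - (c - x) *\<^sub>R f x" "u d - u x - (d - x) *\<^sub>R f x"] by simp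
          then show "norm (measure lborel k *\<^sub>R g x - (u (Sup k) - u (Inf k))) \<le> \<eta> * measure lborel k"
            using k by (simp add: algebra_simps)
        qed
        also have "\<dots> \<le> (\<Sum>(x,k)\<in>p. \<eta> * measure lborel k)"
          by (rule sum_mono2) (use fin \<eta>(1) in auto)
        also have "\<dots> = \<eta> * (b - a)"
          using additive_content_tagged_division[of p a b] p(1) ab by (simp add: sum_distrib_left[symmetric] split_def)
        finally show ?thesis using \<eta> by linarith
      qed
      also have "(\<Sum>(x,k)\<in>q. norm (measure lborel k *\<^sub>R g x - (u (Sup k) - u (Inf k)))) \<le> e / 2"
      proof -
        have kq: "k = {Inf k..Sup k}" "a \<le> Inf k" "Inf k \<le> Sup k" "Sup k \<le> b" "k \<noteq> {}"
          "measure lebesgue k = Sup k - Inf k" "k \<in> sets lebesgue" if kin: "k \<in> snd ` q" for k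
        proof -
          obtain x where "(x, k) \<in> q" using kin by auto
          then obtain c d where "k = {c..d}" "c \<le> d" "a \<le> c" "d \<le> b" using kint qp by (meson order_trans subsetD)
          then show "k = {Inf k..Sup k}" "a \<le> Inf k" "Inf k \<le> Sup k" "Sup k \<le> b" "k \<noteq> {}"
            "measure lebesgue k = Sup k - Inf k" "k \<in> sets lebesgue" by simp_all
        qed
        have inj: "inj_on (\<lambda>k. (Inf k, Sup k)) (snd ` q)"
          by (rule inj_onI) (metis kq(1) Pair_inject)
        have "(\<Sum>(x,k)\<in>q. norm (measure lborel k *\<^sub>R g x - (u (Sup k) - u (Inf k))))
            = (\<Sum>(x,k)\<in>q. norm (u (Sup k) - u (Inf k)))"
          by (rule sum.cong) (auto simp: q_def g_def norm_minus_commute)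
        \<comment> \<open>Summing over intervals instead of tagged intervals is legitimate because
          an interval with two different tags has empty interior; it is a single point and its
          increment is 0. The case distinction gives the value 0 to the empty interval, where
          \<open>Sup\<close> and \<open>Inf\<close> carry no meaning.\<close>
        also have "\<dots> = (\<Sum>(x,k)\<in>q. if k = {} then 0 else norm (u (Sup k) - u (Inf k)))"
          by (rule sum.cong) (auto simp: q_def dest: pD(2))
        also have "\<dots> = (\<Sum>k\<in>snd ` q. if k = {} then 0 else norm (u (Sup k) - u (Inf k)))"
          by (rule sum.over_tagged_division_lemma[OF tagged_partial_division_of_Union_self[OF qpart]])
             (auto simp: box_eq_empty less_eq_real_def split: if_splits)
        also have "\<dots> = (\<Sum>k\<in>snd ` q. norm (u (Sup k) - u (Inf k)))"
          by (rule sum.cong) (simp_all add: kq(5))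
        also have "\<dots> = (\<Sum>(c,d)\<in>(\<lambda>k. (Inf k, Sup k)) ` snd ` q. norm (u d - u c))"
          by (subst sum.reindex[OF inj]) auto
        also have "\<dots> < e / 2"
        proof (rule ac')
          show "finite ((\<lambda>k. (Inf k, Sup k)) ` snd ` q)" using fin by simp
          fix c d assume "(c, d) \<in> (\<lambda>k. (Inf k, Sup k)) ` snd ` q"
          then obtain k where "k \<in> snd ` q" "c = Inf k" "d = Sup k" by blast
          then show "a \<le> c \<and> c \<le> d \<and> d \<le> b" using kq(2-4) by blast
        next
          show "disjoint_family_on (\<lambda>(a, b). {a<..<b}) ((\<lambda>k. (Inf k, Sup k)) ` snd ` q)"
            unfolding disjoint_family_on_def
          proof (intro ballI impI)
            fix m n assume mn: "m \<in> (\<lambda>k. (Inf k, Sup k)) ` snd ` q" "n \<in> (\<lambda>k. (Inf k, Sup k)) ` snd ` q" "m \<noteq> n"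
            from mn(1) obtain x k where xy1: "(x, k) \<in> p" "m = (Inf k, Sup k)" using qp by auto
            from mn(2) obtain y l where xy2: "(y, l) \<in> p" "n = (Inf l, Sup l)" using qp by auto
            note xy = xy1 xy2
            have "k \<noteq> l" using mn xy by auto
            then have "interior k \<inter> interior l = {}" using pD(5)[OF xy(1,3)] by blast
            then show "(case m of (a, b) \<Rightarrow> {a<..<b}) \<inter> (case n of (a, b) \<Rightarrow> {a<..<b}) = {}"
              using kint[OF xy(1)] kint[OF xy(3)] xy(2,4) by (elim exE conjE) simp
          qed
          have "(\<Sum>(c,d)\<in>(\<lambda>k. (Inf k, Sup k)) ` snd ` q. d - c) = (\<Sum>k\<in>snd ` q. Sup k - Inf k)"
            by (subst sum.reindex[OF inj]) auto
          also have "\<dots> = (\<Sum>k\<in>snd ` q. measure lebesgue k)"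
            by (rule sum.cong) (simp_all add: kq(6))
          also have "\<dots> = measure lebesgue (\<Union>(snd ` q))"
            by (rule content_division[OF partial_division_of_tagged_division[OF qpart]])
          also have "\<dots> \<le> measure lebesgue W"
          proof (rule measure_mono_fmeasurable[OF _ _ Wm(1)])
            have "k \<subseteq> W" if kin: "k \<in> snd ` q" for k
            proof -
              obtain x where "(x, k) \<in> q" using kin by auto
              then have "(x, k) \<in> p" "x \<in> M" by (simp_all add: q_def)
              then show ?thesis using fine[of x k] by (simp add: \<gamma>_def)
            qed
            then show "\<Union>(snd ` q) \<subseteq> W" by (rule Union_least)
            show "\<Union>(snd ` q) \<in> sets lebesgue"
              using fin kq(7) by (intro sets.finite_Union) (simp, blast)
          qed
          also have "\<dots> < \<delta>" by (rule Wm)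
          finally show "(\<Sum>(c,d)\<in>(\<lambda>k. (Inf k, Sup k)) ` snd ` q. d - c) < \<delta>" .
        qed
        finally show ?thesis by simp
      qed
      finally show ?thesis by simp
    qed
    show "\<exists>\<gamma>. gauge \<gamma> \<and> (\<forall>\<D>. \<D> tagged_division_of {a..b} \<and> \<gamma> fine \<D> \<longrightarrow>
        norm ((\<Sum>(x,k)\<in>\<D>. measure lborel k *\<^sub>R g x) - (u b - u a)) < e)" 
      using gauge small by (intro exI[of _ \<gamma>] conjI allI impI) simp_all
  qed
  then show ?thesis
    by (rule has_integral_spike[OF M, rotated]) (auto simp: g_def)
qed

lemma lipschitz_imp_abs_cont:
  fixes u :: "real \<Rightarrow> 'a::real_normed_vector"
  assumes "L-lipschitz_on {a..b} u"
  shows "abs_cont_on_interval a b u"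
  unfolding abs_cont_on_interval_def
proof (intro allI impI)
  fix e :: real assume e: "e > 0"
  have L: "L \<ge> 0" using assms lipschitz_on_nonneg by blast
  show "\<exists>\<delta>>0. \<forall>D. finite D \<and> (\<forall>(c, d)\<in>D. a \<le> c \<and> c \<le> d \<and> d \<le> b) \<and>
      disjoint_family_on (\<lambda>(a, b). {a<..<b}) D \<and> (\<Sum>(a, b)\<in>D. b - a) < \<delta> \<longrightarrow>
      (\<Sum>(a, b)\<in>D. norm (u b - u a)) < e"
  proof (intro exI[of _ "e / (L + 1)"] conjI allI impI)
    show "e / (L + 1) > 0" using e L by simp
    fix D :: "(real \<times> real) set"
    assume D: "finite D \<and> (\<forall>(c, d)\<in>D. a \<le> c \<and> c \<le> d \<and> d \<le> b) \<and>
      disjoint_family_on (\<lambda>(a, b). {a<..<b}) D \<and> (\<Sum>(a, b)\<in>D. b - a) < e / (L + 1)"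
    have "(\<Sum>(c, d)\<in>D. norm (u d - u c)) \<le> (\<Sum>(c, d)\<in>D. L * (d - c))"
    proof (rule sum_mono, clarify)
      fix c d assume "(c, d) \<in> D"
      then have "a \<le> c" "c \<le> d" "d \<le> b" using D by auto
      then show "norm (u d - u c) \<le> L * (d - c)"
        using lipschitz_onD[OF assms, of d c] by (simp add: dist_norm)
    qed
    also have "\<dots> = L * (\<Sum>(c, d)\<in>D. d - c)" by (simp add: sum_distrib_left split_def)
    also have "\<dots> \<le> L * (e / (L + 1))" using D L by (intro mult_left_mono) auto
    also have "\<dots> < e" using e L by (simp add: field_simps)
    finally show "(\<Sum>(c, d)\<in>D. norm (u d - u c)) < e" .
  qed
qed

section \<open>Gronwall inequalities for differential inequalities that hold almost
  everywhere\<close>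

lemma nonincreasing_if_AE_derivative_nonpos:
  fixes y :: "real \<Rightarrow> real"
  assumes lip: "L-lipschitz_on {a..b} y" and ab: "a \<le> b" and N: "negligible N"
    and deriv: "\<And>t. t \<in> {a<..<b} - N \<Longrightarrow> \<exists>D. (y has_vector_derivative D) (at t) \<and> D \<le> 0"
  shows "y b \<le> y a"
proof -
  obtain f where f: "\<And>t. t \<in> {a<..<b} - N \<Longrightarrow> (y has_vector_derivative f t) (at t) \<and> f t \<le> 0"
    using deriv by metis
  have int: "(f has_integral y b - y a) {a..b}"
    using fundamental_theorem_of_calculus_abs_cont[OF lipschitz_imp_abs_cont[OF lip] ab N] f by blast
  have "((\<lambda>t. if t \<in> N \<union> {a, b} then 0 else f t) has_integral y b - y a) {a..b}"
    by (rule has_integral_spike[OF _ _ int, of "N \<union> {a,b}"]) (use N in auto)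
  from has_integral_neg[OF this] have "0 \<le> - (y b - y a)"
    by (rule has_integral_nonneg) (use f in force)
  then show ?thesis by simp
qed

text \<open>With the integrating factor \<open>g\<close>, the function
  \<open>g \<tau> * y \<tau> - b * \<tau>\<close> has derivative at most
  \<open>g \<tau> * b - b\<close>. This is nonpositive if \<open>a\<close> and \<open>b\<close> are
  nonnegative, since then \<open>g \<tau> \<le> 1\<close>, and it is 0 if \<open>b = 0\<close>. The
  second alternative admits negative \<open>a\<close>, as decay estimates require.\<close>

lemma AE_gronwall:
  fixes y :: "real \<Rightarrow> real"
  assumes lip: "L-lipschitz_on {s..t} y" and st: "s \<le> t" and N: "negligible N"
    and deriv: "\<And>\<tau>. \<tau> \<in> {s<..<t} - N \<Longrightarrow> \<exists>D. (y has_vector_derivative D) (at \<tau>) \<and> D \<le> a * y \<tau> + b"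
    and ab: "0 \<le> a \<and> 0 \<le> b \<or> b = 0"
  shows "y t \<le> exp (a * (t - s)) * (y s + b * (t - s))"
proof -
  define g where "g = (\<lambda>\<tau>. exp (- (a * (\<tau> - s))))"
  have gd: "(g has_vector_derivative - a * g \<tau>) (at \<tau>)" for \<tau>
    unfolding g_def has_real_derivative_iff_has_vector_derivative[symmetric]
    by (auto intro!: derivative_eq_intros)
  have "\<exists>M. M-lipschitz_on {s..t} (\<lambda>\<tau>. g \<tau> * y \<tau> - b * \<tau>)"
  proof -
    have cg: "continuous_on {s..t} g" unfolding g_def by (intro continuous_intros)
    obtain A where A: "\<And>\<tau>. \<tau> \<in> {s..t} \<Longrightarrow> norm (g \<tau>) \<le> A" "A > 0"
      using compact_imp_bounded[OF compact_continuous_image[OF cg compact_Icc]] unfolding bounded_pos by blast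
    have cy: "continuous_on {s..t} y" using lip lipschitz_on_continuous_on by blast
    obtain B where B: "\<And>\<tau>. \<tau> \<in> {s..t} \<Longrightarrow> norm (y \<tau>) \<le> B" "B > 0"
      using compact_imp_bounded[OF compact_continuous_image[OF cy compact_Icc]] unfolding bounded_pos by blast
    have Lg: "(\<bar>a\<bar> * A)-lipschitz_on {s..t} g"
    proof (rule bounded_derivative_imp_lipschitz)
      show "(g has_derivative (\<lambda>h. h * (- a * g \<tau>))) (at \<tau> within {s..t})" if "\<tau> \<in> {s..t}" for \<tau>
        using gd[of \<tau>] has_derivative_at_withinI unfolding has_vector_derivative_def by auto
      show "onorm (\<lambda>h. h * (- a * g \<tau>)) \<le> \<bar>a\<bar> * A" if "\<tau> \<in> {s..t}" for \<tau>
      proof (rule onorm_le)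
        fix h
        have "norm (h * (- a * g \<tau>)) = \<bar>a\<bar> * \<bar>g \<tau>\<bar> * \<bar>h\<bar>" by (simp add: abs_mult)
        also have "\<dots> \<le> \<bar>a\<bar> * A * \<bar>h\<bar>" using A(1)[OF that] by (intro mult_right_mono mult_left_mono) auto
        finally show "norm (h * (- a * g \<tau>)) \<le> \<bar>a\<bar> * A * norm h" by simp
      qed
    qed (use A in auto)
    have L0: "L \<ge> 0" using lip lipschitz_on_nonneg by blast
    show ?thesis
    proof (intro exI lipschitz_onI)
      show "0 \<le> \<bar>a\<bar> * A * B + A * L + \<bar>b\<bar>" using A B L0 by simp
      fix p q assume pq: "p \<in> {s..t}" "q \<in> {s..t}"
      have "\<bar>(g p * y p - b * p) - (g q * y q - b * q)\<bar> = \<bar>(g p - g q) * y p + g q * (y p - y q) - b * (p - q)\<bar>"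
        by (simp add: algebra_simps)
      also have "\<dots> \<le> \<bar>g p - g q\<bar> * \<bar>y p\<bar> + \<bar>g q\<bar> * \<bar>y p - y q\<bar> + \<bar>b\<bar> * \<bar>p - q\<bar>"
        by (simp add: abs_mult[symmetric])
      also have "\<dots> \<le> (\<bar>a\<bar> * A * \<bar>p - q\<bar>) * B + A * (L * \<bar>p - q\<bar>) + \<bar>b\<bar> * \<bar>p - q\<bar>"
        using lipschitz_onD[OF Lg pq] lipschitz_onD[OF lip pq] A B pq L0
        by (intro add_mono mult_mono) (auto simp: dist_real_def)
      finally show "dist (g p * y p - b * p) (g q * y q - b * q) \<le> (\<bar>a\<bar> * A * B + A * L + \<bar>b\<bar>) * dist p q"
        by (simp add: dist_real_def algebra_simps)
    qed
  qed
  then obtain M where M: "M-lipschitz_on {s..t} (\<lambda>\<tau>. g \<tau> * y \<tau> - b * \<tau>)" by blast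
  have "g t * y t - b * t \<le> g s * y s - b * s"
  proof (rule nonincreasing_if_AE_derivative_nonpos[OF M st N])
    fix \<tau> assume \<tau>: "\<tau> \<in> {s<..<t} - N"
    obtain D where D: "(y has_vector_derivative D) (at \<tau>)" "D \<le> a * y \<tau> + b" using deriv[OF \<tau>] by blast
    have "((\<lambda>\<tau>. g \<tau> * y \<tau> - b * \<tau>) has_vector_derivative (g \<tau> * D + (- a * g \<tau>) * y \<tau> - b)) (at \<tau>)"
      by (auto intro!: derivative_eq_intros D(1) gd)
    moreover have "g \<tau> * D + (- a * g \<tau>) * y \<tau> - b \<le> 0"
    proof -
      have gp: "g \<tau> > 0" by (simp add: g_def)
      have "g \<tau> * D + (- a * g \<tau>) * y \<tau> \<le> g \<tau> * b" using mult_left_mono[OF D(2), of "g \<tau>"] gp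
        by (simp add: algebra_simps)
      also have "\<dots> \<le> b"
      proof (cases "b = 0")
        case False
        then have "a \<ge> 0" "b \<ge> 0" using ab by auto
        then show ?thesis using \<tau> by (intro mult_left_le_one_le) (auto simp: g_def)
      qed simp
      finally show ?thesis by simp
    qed
    ultimately show "\<exists>D. ((\<lambda>\<tau>. g \<tau> * y \<tau> - b * \<tau>) has_vector_derivative D) (at \<tau>) \<and> D \<le> 0" by blast
  qed
  then have "g t * y t \<le> y s + b * (t - s)" by (simp add: g_def algebra_simps)
  then have "exp (a * (t - s)) * (g t * y t) \<le> exp (a * (t - s)) * (y s + b * (t - s))"
    by (intro mult_left_mono) auto
  then show ?thesis by (simp add: g_def mult.assoc[symmetric] exp_add[symmetric])
qed

lemma lipschitz_on_inner_self:
  fixes u :: "'b::metric_space \<Rightarrow> 'a::real_inner"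
  assumes "L-lipschitz_on S u" "\<And>t. t \<in> S \<Longrightarrow> norm (u t) \<le> M" "0 \<le> M"
  shows "(2 * M * L)-lipschitz_on S (\<lambda>t. u t \<bullet> u t)"
proof (rule lipschitz_onI)
  have L: "0 \<le> L" using assms(1) lipschitz_on_nonneg by blast
  then show "0 \<le> 2 * M * L" using assms by simp
  fix p q assume pq: "p \<in> S" "q \<in> S"
  have "u p \<bullet> u p - u q \<bullet> u q = (u p + u q) \<bullet> (u p - u q)"
    by (simp add: algebra_simps inner_commute)
  also have "\<bar>\<dots>\<bar> \<le> norm (u p + u q) * norm (u p - u q)" by (rule Cauchy_Schwarz_ineq2)
  also have "\<dots> \<le> (M + M) * (L * dist p q)"
    using lipschitz_onD[OF assms(1) pq] assms(2)[OF pq(1)] assms(2)[OF pq(2)] assms(3)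
    by (intro mult_mono) (auto simp: dist_norm intro: norm_triangle_le)
  finally show "dist (u p \<bullet> u p) (u q \<bullet> u q) \<le> 2 * M * L * dist p q"
    by (simp add: dist_real_def)
qed

lemma inner_self_lipschitz_on_interval:
  fixes u :: "real \<Rightarrow> 'a::real_inner"
  assumes "L-lipschitz_on {s..t} u"
  obtains M where "M-lipschitz_on {s..t} (\<lambda>t. u t \<bullet> u t)"
proof -
  have "bounded (u ` {s..t})"
    by (intro compact_imp_bounded compact_continuous_image lipschitz_on_continuous_on[OF assms] compact_Icc)
  then obtain M where "M > 0" "\<And>\<tau>. \<tau> \<in> {s..t} \<Longrightarrow> norm (u \<tau>) \<le> M" unfolding bounded_pos by blast
  then show thesis using lipschitz_on_inner_self[OF assms, of M] that by simp
qed

lemma has_vector_derivative_inner_self: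
  fixes u :: "real \<Rightarrow> 'a::real_inner"
  assumes "(u has_vector_derivative D) (at t)"
  shows "((\<lambda>t. u t \<bullet> u t) has_vector_derivative 2 * (u t \<bullet> D)) (at t)"
proof -
  from assms have "(u has_derivative (\<lambda>x. x *\<^sub>R D)) (at t)" by (simp add: has_vector_derivative_def)
  from has_derivative_inner[OF this this]
  show ?thesis by (simp add: has_vector_derivative_def inner_commute algebra_simps)
qed

text \<open>The squared norm is used because the norm itself need not be differentiable where
  \<open>u\<close> vanishes.\<close>

lemma AE_gronwall_norm:
  fixes u :: "real \<Rightarrow> 'a::euclidean_space"
  assumes lip: "L-lipschitz_on {s..t} u" and st: "s \<le> t" and N: "negligible N"
    and deriv: "\<And>\<tau>. \<tau> \<in> {s<..<t} - N \<Longrightarrow>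
      \<exists>D. (u has_vector_derivative D) (at \<tau>) \<and> 2 * (u \<tau> \<bullet> D) \<le> a * (norm (u \<tau>))\<^sup>2 + b"
    and ab: "0 \<le> a \<and> 0 \<le> b \<or> b = 0"
  shows "(norm (u t))\<^sup>2 \<le> exp (a * (t - s)) * ((norm (u s))\<^sup>2 + b * (t - s))"
proof -
  obtain M where "M-lipschitz_on {s..t} (\<lambda>t. u t \<bullet> u t)" using inner_self_lipschitz_on_interval[OF lip] .
  from AE_gronwall[OF this st N _ ab] show ?thesis
    using deriv has_vector_derivative_inner_self unfolding power2_norm_eq_inner by blast
qed

text \<open>Gronwall's inequality for minus the squared norm, with \<open>b = 0\<close> so that
  \<open>c\<close> may have either sign. It keeps distinct solutions apart and thereby yields
  injectivity of the derivative of the flow.\<close>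

lemma AE_gronwall_norm_lower:
  fixes u :: "real \<Rightarrow> 'a::euclidean_space"
  assumes lip: "L-lipschitz_on {s..t} u" and st: "s \<le> t" and N: "negligible N"
    and deriv: "\<And>\<tau>. \<tau> \<in> {s<..<t} - N \<Longrightarrow>
      \<exists>D. (u has_vector_derivative D) (at \<tau>) \<and> c * (norm (u \<tau>))\<^sup>2 \<le> 2 * (u \<tau> \<bullet> D)"
  shows "exp (c * (t - s)) * (norm (u s))\<^sup>2 \<le> (norm (u t))\<^sup>2"
proof -
  obtain M where M: "M-lipschitz_on {s..t} (\<lambda>t. u t \<bullet> u t)" using inner_self_lipschitz_on_interval[OF lip] .
  have "- (u t \<bullet> u t) \<le> exp (c * (t - s)) * (- (u s \<bullet> u s) + 0 * (t - s))"
  proof (rule AE_gronwall[OF _ st N])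
    show "M-lipschitz_on {s..t} (\<lambda>t. - (u t \<bullet> u t))" using M by simp
    fix \<tau> assume "\<tau> \<in> {s<..<t} - N"
    then obtain D where "(u has_vector_derivative D) (at \<tau>)" "c * (norm (u \<tau>))\<^sup>2 \<le> 2 * (u \<tau> \<bullet> D)"
      using deriv by blast
    then show "\<exists>D. ((\<lambda>t. - (u t \<bullet> u t)) has_vector_derivative D) (at \<tau>) \<and> D \<le> c * - (u \<tau> \<bullet> u \<tau>) + 0"
      by (intro exI[of _ "- (2 * (u \<tau> \<bullet> D))"] conjI has_vector_derivative_minus has_vector_derivative_inner_self)
         (simp_all add: power2_norm_eq_inner)
  qed simp
  then show ?thesis by (simp add: power2_norm_eq_inner)
qed

lemma lipschitz_on_intervalI:
  fixes u :: "real \<Rightarrow> 'a::real_normed_vector"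
  assumes "0 \<le> K" "\<And>p q. a \<le> p \<Longrightarrow> p \<le> q \<Longrightarrow> q \<le> b \<Longrightarrow> norm (u q - u p) \<le> K * (q - p)"
  shows "K-lipschitz_on {a..b} u"
proof (rule lipschitz_onI)
  fix p q assume pq: "p \<in> {a..b}" "q \<in> {a..b}"
  show "dist (u p) (u q) \<le> K * dist p q"
    using assms(2)[of p q] assms(2)[of q p] pq
    by (cases "p \<le> q") (auto simp: dist_norm norm_minus_commute)
qed (rule assms)

text \<open>Curves given on the half-line are continued to negative times by their value at 0, so
  that bounded continuous functions and measurability on the whole real line can be used.\<close>

lemma continuous_on_max_0:
  fixes f :: "real \<Rightarrow> 'a::topological_space"
  assumes "\<And>T. continuous_on {0..T} f"
  shows "continuous_on UNIV (\<lambda>t. f (max 0 t))"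
  unfolding continuous_on_eq_continuous_at[OF open_UNIV]
proof
  fix t :: real
  have "continuous_on {..<\<bar>t\<bar> + 1} (\<lambda>t. f (max 0 t))"
    by (rule continuous_on_compose2[OF assms[of "\<bar>t\<bar> + 1"]]) (auto intro!: continuous_intros)
  then show "isCont (\<lambda>t. f (max 0 t)) t" by (rule continuous_on_interior) (simp add: interior_open)
qed

lemma abs_cont_on_interval_subset:
  assumes "abs_cont_on_interval a b u" "a \<le> c" "d \<le> b"
  shows "abs_cont_on_interval c d u"
  unfolding abs_cont_on_interval_def
proof (intro allI impI)
  fix e :: real assume "0 < e"
  then obtain \<delta> where \<delta>: "\<delta> > 0" "\<And>D. finite D \<and> (\<forall>(x, y)\<in>D. a \<le> x \<and> x \<le> y \<and> y \<le> b) \<and>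
      disjoint_family_on (\<lambda>(a, b). {a<..<b}) D \<and> (\<Sum>(a, b)\<in>D. b - a) < \<delta> \<Longrightarrow>
      (\<Sum>(a, b)\<in>D. norm (u b - u a)) < e"
    using assms(1) unfolding abs_cont_on_interval_def by meson
  show "\<exists>\<delta>>0. \<forall>D. finite D \<and> (\<forall>(a, b)\<in>D. c \<le> a \<and> a \<le> b \<and> b \<le> d) \<and>
     disjoint_family_on (\<lambda>(a, b). {a<..<b}) D \<and> (\<Sum>(a, b)\<in>D. b - a) < \<delta> \<longrightarrow>
     (\<Sum>(a, b)\<in>D. norm (u b - u a)) < e"
  proof (intro exI[of _ \<delta>] conjI allI impI \<delta>(1), rule \<delta>(2), elim conjE, intro conjI)
    fix D :: "(real \<times> real) set" assume "\<forall>(x, y)\<in>D. c \<le> x \<and> x \<le> y \<and> y \<le> d"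
    then show "\<forall>(x, y)\<in>D. a \<le> x \<and> x \<le> y \<and> y \<le> b" using assms(2,3) by fastforce
  qed
qed

section \<open>Differential equations with measurable time dependence\<close>

text \<open>Along the step curve \<open>u (g n t)\<close> only countably many points occur, so
  measurability is inherited from single points. Continuity in space makes the substituted function
  a pointwise limit of such functions.\<close>

lemma borel_measurable_along_continuous:
  fixes X :: "'a::metric_space \<Rightarrow> real \<Rightarrow> 'b::metric_space"
  assumes X: "\<And>z. z \<in> S \<Longrightarrow> X z \<in> borel_measurable lebesgue"
    and cont: "\<And>t. continuous_on S (\<lambda>z. X z t)"
    and u: "continuous_on UNIV u" "\<And>t. u t \<in> S"
  shows "(\<lambda>t. X (u t) t) \<in> borel_measurable lebesgue"
proof -
  \<comment> \<open>\<open>g n t\<close> rounds \<open>t\<close> down to the grid of mesh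
    \<open>1 / Suc n\<close>.\<close>
  define g where "g = (\<lambda>(n::nat) t::real. real_of_int \<lfloor>real (Suc n) * t\<rfloor> / real (Suc n))"
  have meas: "(\<lambda>t. X (u (g n t)) t) \<in> borel_measurable lebesgue" for n
    unfolding g_def
  proof (rule measurable_compose_countable[where g="\<lambda>t. \<lfloor>real (Suc n) * t\<rfloor>"
        and f="\<lambda>i. X (u (real_of_int i / real (Suc n)))"])
    show "X (u (real_of_int i / real (Suc n))) \<in> borel_measurable lebesgue" for i
      using X u by blast
    have "(\<lambda>t::real. \<lfloor>real (Suc n) * t\<rfloor>) \<in> borel \<rightarrow>\<^sub>M count_space UNIV" by measurable
    then show "(\<lambda>t::real. \<lfloor>real (Suc n) * t\<rfloor>) \<in> lebesgue \<rightarrow>\<^sub>M count_space UNIV"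
      by (metis measurable_completion measurable_lborel2)
  qed
  have gt: "(\<lambda>n. g n t) \<longlonglongrightarrow> t" for t
  proof (rule LIMSEQ_I)
    fix e :: real assume "e > 0"
    then obtain N where N: "1 / real (Suc N) < e" using nat_approx_posE by blast
    have "norm (g n t - t) < e" if "n \<ge> N" for n
    proof -
      have "\<bar>real_of_int \<lfloor>real (Suc n) * t\<rfloor> - real (Suc n) * t\<bar> \<le> 1" by linarith
      moreover have "g n t - t = (real_of_int \<lfloor>real (Suc n) * t\<rfloor> - real (Suc n) * t) / real (Suc n)"
        unfolding g_def by (simp add: diff_divide_distrib)
      ultimately have "\<bar>g n t - t\<bar> \<le> 1 / real (Suc n)"
        by (simp add: divide_right_mono)
      also have "\<dots> \<le> 1 / real (Suc N)" using that by (intro divide_left_mono) auto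
      finally show ?thesis using N by simp
    qed
    then show "\<exists>no. \<forall>n\<ge>no. norm (g n t - t) < e" by blast
  qed
  show ?thesis
  proof (rule borel_measurable_LIMSEQ_metric[OF meas])
    fix t
    have "(\<lambda>n. u (g n t)) \<longlonglongrightarrow> u t"
      by (rule continuous_on_tendsto_compose[OF u(1) gt]) auto
    then show "(\<lambda>n. X (u (g n t)) t) \<longlonglongrightarrow> X (u t) t"
      by (rule continuous_on_tendsto_compose[OF cont[of t]]) (use u(2) in auto)
  qed
qed

lemma integrable_bounded_measurable_interval:
  fixes f :: "real \<Rightarrow> 'a::euclidean_space"
  assumes "f \<in> borel_measurable lebesgue" "\<And>t. t \<in> {a..b} \<Longrightarrow> norm (f t) \<le> B"
  shows "f integrable_on {a..b}"
  by (rule measurable_bounded_by_integrable_imp_integrable[where g="\<lambda>_. B"])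
     (use assms in \<open>auto intro: measurable_restrict_space1\<close>)

text \<open>\<open>K\<close> is strictly positive because it appears in the denominator of the
  primitive of Picard's weight. The bound at the origin turns the Lipschitz condition into linear
  growth.\<close>

definition lipschitz_field :: "real \<Rightarrow> real \<Rightarrow> ('a::euclidean_space \<Rightarrow> real \<Rightarrow> 'a) \<Rightarrow> bool" where
  "lipschitz_field K B X \<longleftrightarrow> 0 < K \<and> 0 \<le> B \<and> (\<forall>z. X z \<in> borel_measurable lebesgue) \<and>
     (\<forall>t z w. norm (X z t - X w t) \<le> K * norm (z - w)) \<and> (\<forall>t. norm (X 0 t) \<le> B)"

text \<open>Lipschitz continuity on bounded intervals takes the place of absolute continuity: the
  fields at hand are bounded along their trajectories on such intervals, and differences, bounded
  linear images and squared norms of Lipschitz curves stay Lipschitz there. The derivative is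
  two-sided and is therefore asked for at positive times only.\<close>

definition AE_solution :: "('a::euclidean_space \<Rightarrow> real \<Rightarrow> 'a) \<Rightarrow> (real \<Rightarrow> 'a) \<Rightarrow> bool" where
  "AE_solution X u \<longleftrightarrow> (\<forall>T. \<exists>L. L-lipschitz_on {0..T} u) \<and>
     (\<exists>N. negligible N \<and> (\<forall>t. 0 < t \<and> t \<notin> N \<longrightarrow> (u has_vector_derivative X (u t) t) (at t)))"

lemma lipschitz_field_bound:
  assumes "lipschitz_field K B X"
  shows "norm (X z t) \<le> B + K * norm z"
proof -
  have "norm (X z t - X 0 t) \<le> K * norm (z - 0)" "norm (X 0 t) \<le> B"
    using assms unfolding lipschitz_field_def by blast+
  then show ?thesis using norm_triangle_ineq2[of "X z t" "X 0 t"] by simp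
qed

lemma lipschitz_field_along:
  assumes "lipschitz_field K B X" "continuous_on UNIV u"
  shows "(\<lambda>t. X (u t) t) \<in> borel_measurable lebesgue"
proof (rule borel_measurable_along_continuous[where S=UNIV and X=X and u=u])
  show "X z \<in> borel_measurable lebesgue" for z using assms unfolding lipschitz_field_def by blast
  have "K-lipschitz_on UNIV (\<lambda>z. X z t)" for t
    using assms unfolding lipschitz_field_def by (auto intro!: lipschitz_onI simp: dist_norm)
  then show "continuous_on UNIV (\<lambda>z. X z t)" for t using lipschitz_on_continuous_on by blast
qed (use assms in auto)

lemma AE_solution_integral:
  fixes f :: "real \<Rightarrow> 'a::euclidean_space"
  assumes f: "f \<in> borel_measurable lebesgue" and bd: "\<And>T. \<exists>M. \<forall>t\<in>{0..T}. norm (f t) \<le> M"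
    and u: "\<And>t. 0 \<le> t \<Longrightarrow> u t = z + integral {0..t} f"
    and fX: "\<And>t. 0 \<le> t \<Longrightarrow> f t = X (u t) t"
  shows "AE_solution X u"
  unfolding AE_solution_def
proof (intro conjI allI)
  have fint: "f integrable_on {a..b}" if "0 \<le> a" for a b
  proof -
    obtain M where "\<forall>t\<in>{0..b}. norm (f t) \<le> M" using bd by blast
    with that show ?thesis by (intro integrable_bounded_measurable_interval[OF f, of _ _ M]) auto
  qed
  show "\<exists>L. L-lipschitz_on {0..T} u" for T
  proof -
    obtain M where M: "\<And>t. t \<in> {0..T} \<Longrightarrow> norm (f t) \<le> M" using bd[of T] by blast
    have *: "norm (u q - u p) \<le> max M 0 * (q - p)" if pq: "0 \<le> p" "p \<le> q" "q \<le> T" for p q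
    proof -
      have "u q - u p = integral {p..q} f"
        using Henstock_Kurzweil_Integration.integral_combine[OF pq(1,2) fint] u pq by (simp add: algebra_simps)
      also have "norm \<dots> \<le> integral {p..q} (\<lambda>_. max M 0)"
        by (rule Henstock_Kurzweil_Integration.integral_norm_bound_integral)
           (use M pq fint in \<open>force simp: le_max_iff_disj\<close>)+
      finally show ?thesis using pq by (simp add: mult.commute)
    qed
    have "(max M 0)-lipschitz_on {0..T} u" by (rule lipschitz_on_intervalI) (use * in auto)
    then show ?thesis by blast
  qed
  have "\<exists>N. negligible N \<and> (\<forall>t\<in>{0<..<real n} - N. ((\<lambda>t. integral {0..t} f) has_vector_derivative f t) (at t))" for n
    using integral_has_vector_derivative_AE[OF fint, of 0 "real n"] by (metis order_refl)
  then obtain N where N: "\<And>n. negligible (N n)"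
    "\<And>n t. t \<in> {0<..<real n} - N n \<Longrightarrow> ((\<lambda>t. integral {0..t} f) has_vector_derivative f t) (at t)" by metis
  show "\<exists>N. negligible N \<and> (\<forall>t. 0 < t \<and> t \<notin> N \<longrightarrow> (u has_vector_derivative X (u t) t) (at t))"
  proof (intro exI[of _ "\<Union>n. N n"] conjI allI impI)
    show "negligible (\<Union>n. N n)" by (intro negligible_Union_nat N)
    fix t assume t: "0 < t \<and> t \<notin> (\<Union>n. N n)"
    obtain n where "t < real n" using reals_Archimedean2 by blast
    then have "((\<lambda>t. integral {0..t} f) has_vector_derivative f t) (at t)" using N(2)[of t n] t by auto
    then have "((\<lambda>t. z + integral {0..t} f) has_vector_derivative f t) (at t)"
      by (auto intro!: derivative_eq_intros)
    then have "(u has_vector_derivative f t) (at t)"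
      by (rule has_vector_derivative_transform_within_open[where S="{0<..}"]) (use t u in auto)
    then show "(u has_vector_derivative X (u t) t) (at t)" using fX t by simp
  qed
qed

lemma AE_solution_lipschitzE:
  assumes "AE_solution X u"
  obtains L where "L-lipschitz_on {0..T} u"
  using assms unfolding AE_solution_def by blast

lemma AE_solution_derivativeE:
  assumes "AE_solution X u"
  obtains N where "negligible N"
    "\<And>t. 0 < t \<Longrightarrow> t \<notin> N \<Longrightarrow> (u has_vector_derivative X (u t) t) (at t)"
  using assms unfolding AE_solution_def by blast

text \<open>Picard's operator is a contraction for the supremum norm with weight \<open>exp (- 2 K t)\<close>;
  a solution is written as \<open>exp (2 K t) y t\<close> with \<open>y\<close> bounded.\<close>

theorem lipschitz_field_solution:
  fixes X :: "'a::euclidean_space \<Rightarrow> real \<Rightarrow> 'a"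
  assumes X: "lipschitz_field K B X"
  obtains u where "u 0 = z" "AE_solution X u" "continuous_on UNIV u"
proof -
  have K: "0 < K" "0 \<le> B" and lipX: "\<And>t z w. norm (X z t - X w t) \<le> K * norm (z - w)"
    using X unfolding lipschitz_field_def by blast+
  define E where "E = (\<lambda>t. exp (2 * K * t))"
  have E0: "E t > 0" for t by (simp add: E_def)
  have contE: "continuous_on S E" for S unfolding E_def by (intro continuous_intros)
  have intE: "((\<lambda>s. A * E s) has_integral A / (2 * K) * (E t - 1)) {0..t}" if "0 \<le> t" for A t
  proof -
    have "((\<lambda>s. A * E s) has_integral A / (2 * K) * E t - A / (2 * K) * E 0) {0..t}"
    proof (rule fundamental_theorem_of_calculus[OF that])
      fix s assume "s \<in> {0..t}"
      show "((\<lambda>s. A / (2 * K) * E s) has_vector_derivative A * E s) (at s within {0..t})"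
        unfolding E_def has_real_derivative_iff_has_vector_derivative[symmetric]
        using K by (auto intro!: derivative_eq_intros)
    qed
    then show ?thesis by (simp add: E_def right_diff_distrib)
  qed
  define f where "f = (\<lambda>(y :: real \<Rightarrow>\<^sub>C 'a) s. X (E s *\<^sub>R y s) s)"
  have meas: "f y \<in> borel_measurable lebesgue" for y
    unfolding f_def
    by (rule lipschitz_field_along[OF X]) (intro continuous_intros contE continuous_on_apply_bcontfun)
  have fbd: "norm (f y s) \<le> B + K * (E s * norm y)" for y s
  proof -
    have "norm (f y s) \<le> B + K * norm (E s *\<^sub>R y s)" unfolding f_def by (rule lipschitz_field_bound[OF X])
    also have "\<dots> \<le> B + K * (E s * norm y)"
      using K E0[of s] Bounded_Continuous_Function.norm_bounded[of y s] by (simp add: mult_left_mono)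
    finally show ?thesis .
  qed
  have fbd': "norm (f y s) \<le> B + K * (E T * norm y)" if "s \<in> {0..T}" for y s T
  proof -
    have "E s \<le> E T" using that K by (simp add: E_def)
    then have "K * (E s * norm y) \<le> K * (E T * norm y)" using K by (intro mult_left_mono mult_right_mono) auto
    then show ?thesis using fbd[of y s] by linarith
  qed
  have fint: "f y integrable_on {0..t}" for y t
    by (rule integrable_bounded_measurable_interval[OF meas fbd'])
  \<comment> \<open>Picard's operator, which adds to \<open>z\<close> the integral of the field
    along \<open>u\<close>, expressed for \<open>y = u / E\<close>. Through \<open>max 0 t\<close>
    the function \<open>P y\<close> is constant on negative times.\<close>
  define P where "P = (\<lambda>y t. (1 / E (max 0 t)) *\<^sub>R (z + integral {0..max 0 t} (f y)))"
  have Pcont: "continuous_on UNIV (P y)" for y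
  proof -
    have "continuous_on UNIV (\<lambda>t. integral {0..max 0 t} (f y))"
      by (rule continuous_on_max_0) (rule indefinite_integral_continuous_1[OF fint])
    moreover have "continuous_on UNIV (\<lambda>t. E (max 0 t))" unfolding E_def by (intro continuous_intros)
    ultimately show ?thesis unfolding P_def
      by (intro continuous_intros) (use E0 in \<open>auto simp: less_imp_neq[symmetric]\<close>)
  qed
  have Pbd: "norm (P y t) \<le> norm z + B / (2 * K) + norm y / 2" for y t
  proof -
    define s where "s = max 0 t"
    have s: "0 \<le> s" by (simp add: s_def)
    have gi: "((\<lambda>s. B + (K * norm y) * E s) has_integral (B * s + (K * norm y) / (2 * K) * (E s - 1))) {0..s}"
      using has_integral_add[OF has_integral_const_real[of B 0 s] intE[OF s, of "K * norm y"]] s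
      by (simp add: mult.commute)
    have "norm (integral {0..s} (f y)) \<le> integral {0..s} (\<lambda>s. B + (K * norm y) * E s)"
      by (rule Henstock_Kurzweil_Integration.integral_norm_bound_integral[OF fint])
         (use gi fbd in \<open>auto simp: algebra_simps\<close>)
    also have "\<dots> = B * s + norm y / 2 * (E s - 1)" using integral_unique[OF gi] K by simp
    finally have 1: "norm (integral {0..s} (f y)) \<le> B * s + norm y / 2 * (E s - 1)" .
    have Es: "1 + 2 * K * s \<le> E s" unfolding E_def by (rule exp_ge_add_one_self)
    have E1: "1 \<le> E s" using Es K s by (smt (verit) mult_nonneg_nonneg)
    have "B * s \<le> B / (2 * K) * E s"
    proof -
      have "B * s = B / (2 * K) * (2 * K * s)" using K by simp
      also have "\<dots> \<le> B / (2 * K) * E s" using Es K by (intro mult_left_mono) auto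
      finally show ?thesis .
    qed
    moreover have "norm z \<le> norm z * E s" using E1 by (simp add: mult_le_cancel_left1)
    moreover have "norm y / 2 * (E s - 1) \<le> norm y / 2 * E s" by (intro mult_left_mono) auto
    ultimately have "norm (z + integral {0..s} (f y)) \<le> (norm z + B / (2 * K) + norm y / 2) * E s"
      using 1 norm_triangle_ineq[of z "integral {0..s} (f y)"] by (simp add: distrib_right)
    moreover have "norm (P y t) = norm (z + integral {0..s} (f y)) / E s"
      unfolding P_def s_def[symmetric] norm_scaleR using E0[of s] by simp
    ultimately show ?thesis using E0[of s] by (simp add: pos_divide_le_eq)
  qed
  define Q where "Q = (\<lambda>y. Bcontfun (P y))"
  have Q: "apply_bcontfun (Q y) = P y" for y
    unfolding Q_def by (rule Bcontfun_inverse, rule bcontfun_normI[OF Pcont Pbd])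
  \<comment> \<open>The Lipschitz constant \<open>K\<close> meets the factor
    \<open>1 / (2 * K)\<close> that arises from integrating \<open>exp (2 * K * s)\<close>; the 2 in
    the weight is what makes the contraction constant 1/2.\<close>
  have "dist (Q y1) (Q y2) \<le> 1/2 * dist y1 y2" for y1 y2
  proof (rule dist_bound)
    fix t :: real
    define s where "s = max 0 t"
    have s: "0 \<le> s" by (simp add: s_def)
    have "P y1 t - P y2 t = (1 / E s) *\<^sub>R integral {0..s} (\<lambda>\<tau>. f y1 \<tau> - f y2 \<tau>)"
      unfolding P_def s_def[symmetric]
      by (simp add: Henstock_Kurzweil_Integration.integral_diff[OF fint fint] scaleR_diff_right scaleR_add_right)
    also have "norm \<dots> = (1 / E s) * norm (integral {0..s} (\<lambda>\<tau>. f y1 \<tau> - f y2 \<tau>))"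
      using E0[of s] by simp
    finally have eq: "norm (P y1 t - P y2 t) = (1 / E s) * norm (integral {0..s} (\<lambda>\<tau>. f y1 \<tau> - f y2 \<tau>))" .
    have "norm (integral {0..s} (\<lambda>\<tau>. f y1 \<tau> - f y2 \<tau>)) \<le> integral {0..s} (\<lambda>\<tau>. (K * dist y1 y2) * E \<tau>)"
    proof (rule Henstock_Kurzweil_Integration.integral_norm_bound_integral)
      fix \<tau>
      have "norm (f y1 \<tau> - f y2 \<tau>) \<le> K * norm (E \<tau> *\<^sub>R (y1 \<tau> - y2 \<tau>))"
        unfolding f_def using lipX[of "E \<tau> *\<^sub>R y1 \<tau>" \<tau> "E \<tau> *\<^sub>R y2 \<tau>"] by (simp add: scaleR_diff_right)
      also have "\<dots> = K * (E \<tau> * dist (y1 \<tau>) (y2 \<tau>))" using E0[of \<tau>] by (simp add: dist_norm)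
      also have "\<dots> \<le> K * (E \<tau> * dist y1 y2)"
        using K E0[of \<tau>] dist_bounded[where f=y1 and g=y2] by (intro mult_left_mono) auto
      finally show "norm (f y1 \<tau> - f y2 \<tau>) \<le> (K * dist y1 y2) * E \<tau>" by (simp add: mult.commute mult.left_commute)
    qed (use fint intE[OF s] in \<open>auto intro!: integrable_diff\<close>)
    also have "integral {0..s} (\<lambda>\<tau>. (K * dist y1 y2) * E \<tau>) = dist y1 y2 / 2 * (E s - 1)"
      using integral_unique[OF intE[OF s, of "K * dist y1 y2"]] K by simp
    also have "dist y1 y2 / 2 * (E s - 1) \<le> dist y1 y2 / 2 * E s" by (intro mult_left_mono) auto
    finally have "norm (P y1 t - P y2 t) \<le> (1 / E s) * (dist y1 y2 / 2 * E s)"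
      unfolding eq using E0[of s] by (intro mult_left_mono) auto
    then show "dist (Q y1 t) (Q y2 t) \<le> 1/2 * dist y1 y2" using E0[of s] by (simp add: Q dist_norm)
  qed
  then obtain y where y: "Q y = y" using banach_fix_type[of "1/2" Q] by auto
  define u where "u = (\<lambda>t. E (max 0 t) *\<^sub>R y t)"
  have u_eq: "u t = z + integral {0..t} (f y)" if "0 \<le> t" for t
  proof -
    have "y t = P y t" using Q[of y] y by simp
    then show ?thesis using that E0[of t] by (simp add: u_def P_def)
  qed
  show thesis
  proof (rule that[of u])
    show "u 0 = z" using u_eq[of 0] by simp
    show "continuous_on UNIV u" unfolding u_def E_def
      by (intro continuous_intros continuous_on_apply_bcontfun)
    show "AE_solution X u"
    proof (rule AE_solution_integral[OF meas _ u_eq])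
      show "\<exists>M. \<forall>t\<in>{0..T}. norm (f y t) \<le> M" for T using fbd' by blast
      show "f y t = X (u t) t" if "0 \<le> t" for t using that by (simp add: f_def u_def)
    qed
  qed
qed

section \<open>Holomorphic maps of the ball\<close>

text \<open>By Cauchy-Schwarz the bound on the difference of velocities controls the derivative of
  the squared distance from both sides, and both Gronwall inequalities apply. Only velocities along
  the two curves enter, so \<open>u\<close> and \<open>v\<close> may belong to different
  fields.\<close>

lemma AE_compare:
  fixes u v :: "real \<Rightarrow> 'a::euclidean_space"
  assumes lip: "L1-lipschitz_on {0..t} u" "L2-lipschitz_on {0..t} v" and t: "0 \<le> t" and K: "0 \<le> K"
    and N: "negligible N"
    and deriv: "\<And>\<tau>. \<tau> \<in> {0<..<t} - N \<Longrightarrow> \<exists>D E. (u has_vector_derivative D) (at \<tau>) \<and>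
      (v has_vector_derivative E) (at \<tau>) \<and> norm (D - E) \<le> K * norm (u \<tau> - v \<tau>)"
  shows "norm (u t - v t) \<le> exp (K * t) * norm (u 0 - v 0)"
    and "exp (- (K * t)) * norm (u 0 - v 0) \<le> norm (u t - v t)"
proof -
  define D where "D = (\<lambda>t. u t - v t)"
  have lipD: "(L1 + L2)-lipschitz_on {0..t} D" unfolding D_def by (intro lipschitz_on_diff lip)
  have der: "\<exists>E. (D has_vector_derivative E) (at \<tau>) \<and> \<bar>2 * (D \<tau> \<bullet> E)\<bar> \<le> 2 * K * (norm (D \<tau>))\<^sup>2"
    if \<tau>: "\<tau> \<in> {0<..<t} - N" for \<tau>
  proof -
    obtain E1 E2 where E: "(u has_vector_derivative E1) (at \<tau>)" "(v has_vector_derivative E2) (at \<tau>)"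
      "norm (E1 - E2) \<le> K * norm (u \<tau> - v \<tau>)" using deriv[OF \<tau>] by blast
    have "\<bar>D \<tau> \<bullet> (E1 - E2)\<bar> \<le> norm (D \<tau>) * norm (E1 - E2)" by (rule Cauchy_Schwarz_ineq2)
    also have "\<dots> \<le> norm (D \<tau>) * (K * norm (D \<tau>))" using E(3) unfolding D_def by (intro mult_left_mono) auto
    finally have "\<bar>2 * (D \<tau> \<bullet> (E1 - E2))\<bar> \<le> 2 * K * (norm (D \<tau>))\<^sup>2" by (simp add: power2_eq_square mult_ac)
    moreover have "(D has_vector_derivative E1 - E2) (at \<tau>)"
      unfolding D_def by (intro has_vector_derivative_diff E)
    ultimately show ?thesis by blast
  qed
  have up': "\<exists>E. (D has_vector_derivative E) (at \<tau>) \<and> 2 * (D \<tau> \<bullet> E) \<le> 2 * K * (norm (D \<tau>))\<^sup>2 + 0"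
    if "\<tau> \<in> {0<..<t} - N" for \<tau>
    using der[OF that] by (metis abs_le_D1 add.right_neutral)
  have lo': "\<exists>E. (D has_vector_derivative E) (at \<tau>) \<and> - (2 * K) * (norm (D \<tau>))\<^sup>2 \<le> 2 * (D \<tau> \<bullet> E)"
    if \<tau>: "\<tau> \<in> {0<..<t} - N" for \<tau>
  proof -
    obtain E where E: "(D has_vector_derivative E) (at \<tau>)" "\<bar>2 * (D \<tau> \<bullet> E)\<bar> \<le> 2 * K * (norm (D \<tau>))\<^sup>2"
      using der[OF \<tau>] by blast
    then have "- (2 * K) * (norm (D \<tau>))\<^sup>2 \<le> 2 * (D \<tau> \<bullet> E)" using abs_le_D2[OF E(2)] by simp
    with E show ?thesis by blast
  qed
  have "(norm (D t))\<^sup>2 \<le> exp (2 * K * (t - 0)) * ((norm (D 0))\<^sup>2 + 0 * (t - 0))"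
    by (rule AE_gronwall_norm[OF lipD t N up']) simp_all
  then have "(norm (D t))\<^sup>2 \<le> (exp (K * t) * norm (D 0))\<^sup>2"
    by (simp add: power_mult_distrib exp_double[symmetric] mult.assoc[symmetric])
  then show "norm (u t - v t) \<le> exp (K * t) * norm (u 0 - v 0)"
    unfolding D_def by (rule power2_le_imp_le) simp
  have "exp (- (2 * K) * (t - 0)) * (norm (D 0))\<^sup>2 \<le> (norm (D t))\<^sup>2"
    by (rule AE_gronwall_norm_lower[OF lipD t N lo'])
  then have "(exp (- (K * t)) * norm (D 0))\<^sup>2 \<le> (norm (D t))\<^sup>2"
    by (simp add: power_mult_distrib exp_double[symmetric] mult.assoc[symmetric])
  then show "exp (- (K * t)) * norm (u 0 - v 0) \<le> norm (u t - v t)"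
    unfolding D_def by (rule power2_le_imp_le) simp
qed

lemma AE_solution_compare:
  fixes X :: "'a::euclidean_space \<Rightarrow> real \<Rightarrow> 'a"
  assumes X: "lipschitz_field K B X" and u: "AE_solution X u" and v: "AE_solution X v" and t: "0 \<le> t"
  shows "norm (u t - v t) \<le> exp (K * t) * norm (u 0 - v 0)"
    and "exp (- (K * t)) * norm (u 0 - v 0) \<le> norm (u t - v t)"
proof -
  have K: "0 \<le> K" and lipX: "\<And>t z w. norm (X z t - X w t) \<le> K * norm (z - w)"
    using X unfolding lipschitz_field_def by (auto intro: less_imp_le)
  obtain L1 L2 where L: "L1-lipschitz_on {0..t} u" "L2-lipschitz_on {0..t} v"
    using u v unfolding AE_solution_def by blast
  obtain N1 N2 where N: "negligible N1" "negligible N2"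
     "\<And>t. 0 < t \<Longrightarrow> t \<notin> N1 \<Longrightarrow> (u has_vector_derivative X (u t) t) (at t)"
     "\<And>t. 0 < t \<Longrightarrow> t \<notin> N2 \<Longrightarrow> (v has_vector_derivative X (v t) t) (at t)"
    using u v unfolding AE_solution_def by blast
  have neg: "negligible (N1 \<union> N2)" using N by simp
  have der: "\<exists>D E. (u has_vector_derivative D) (at \<tau>) \<and> (v has_vector_derivative E) (at \<tau>) \<and>
      norm (D - E) \<le> K * norm (u \<tau> - v \<tau>)" if "\<tau> \<in> {0<..<t} - (N1 \<union> N2)" for \<tau>
    using that by (intro exI[of _ "X (u \<tau>) \<tau>"] exI[of _ "X (v \<tau>) \<tau>"] conjI N(3,4) lipX) auto
  show "norm (u t - v t) \<le> exp (K * t) * norm (u 0 - v 0)"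
    "exp (- (K * t)) * norm (u 0 - v 0) \<le> norm (u t - v t)"
    using AE_compare[OF L t K neg der] by auto
qed

lemma AE_solution_unique:
  assumes "lipschitz_field K B X" "AE_solution X u" "AE_solution X v" "u 0 = v 0" "0 \<le> t"
  shows "u t = v t"
  using AE_solution_compare(1)[OF assms(1,2,3,5)] assms(4) by simp

section \<open>The Hermitian product and calculus of holomorphic maps\<close>

lemma norm_vector_scalar_mult: "norm (c *s (x :: complex ^ 'n)) = norm c * norm x"
  by (simp add: norm_vec_def norm_mult L2_set_right_distrib)

lemma hermitian_linear:
  "hermitian (x + y) c = hermitian x c + hermitian y c"
  "hermitian (x - y) c = hermitian x c - hermitian y c"
  "hermitian (\<zeta> *s x) c = \<zeta> * hermitian x c"
  "hermitian x (y + z) = hermitian x y + hermitian x z"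
  "hermitian x (\<zeta> *s y) = cnj \<zeta> * hermitian x y"
  "hermitian (- x) c = - hermitian x c"
  by (simp_all add: hermitian_def sum.distrib sum_subtractf sum_distrib_left algebra_simps sum_negf)

lemma Re_hermitian: "Re (hermitian x y) = x \<bullet> y"
  by (simp add: hermitian_def inner_vec_def inner_complex_def)

lemma hermitian_self: "hermitian x x = of_real ((norm x)\<^sup>2)"
proof -
  have "hermitian x x = of_real (\<Sum>i\<in>UNIV. (norm (x $ i))\<^sup>2)"
    by (simp add: hermitian_def complex_norm_square del: of_real_power)
  then show ?thesis by (simp add: norm_vec_def L2_set_def sum_nonneg)
qed

text \<open>Multiplying \<open>x\<close> by a unimodular number makes the product real and
  nonnegative, and the real Cauchy-Schwarz inequality applies to its real part.\<close>

lemma norm_hermitian_le: "norm (hermitian x y) \<le> norm x * norm y"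
proof (cases "hermitian x y = 0")
  case False
  define c where "c = cnj (sgn (hermitian x y))"
  have c: "norm c = 1" using False by (simp add: c_def norm_sgn)
  have "hermitian (c *s x) y = of_real (norm (hermitian x y))"
    unfolding hermitian_linear c_def using False
    by (simp add: sgn_eq field_simps complex_norm_square[symmetric] power2_eq_square mult.commute)
  then have "norm (hermitian x y) = (c *s x) \<bullet> y" by (metis Re_hermitian Re_complex_of_real)
  also have "\<dots> \<le> norm (c *s x) * norm y" by (rule norm_cauchy_schwarz)
  finally show ?thesis by (simp add: norm_vector_scalar_mult c)
qed simp

lemma bounded_linear_hermitian: "bounded_linear (\<lambda>x. hermitian x c)"
proof (rule bounded_linear_intro)
  show "hermitian (r *\<^sub>R x) c = r *\<^sub>R hermitian x c" for r x
    by (simp add: hermitian_def scaleR_sum_right)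
  show "norm (hermitian x c) \<le> norm x * norm c" for x by (rule norm_hermitian_le)
qed (rule hermitian_linear)

lemma bounded_linear_scale_vector: "bounded_linear (\<lambda>\<zeta>. \<zeta> *s (b :: complex ^ 'n))"
proof (rule bounded_linear_intro)
  show "norm (\<zeta> *s b) \<le> norm \<zeta> * norm b" for \<zeta> by (simp add: norm_vector_scalar_mult)
qed (simp_all add: vec_eq_iff algebra_simps)

lemma scale_of_real: "complex_of_real r *s (b :: complex ^ 'n) = r *\<^sub>R b"
  by (simp add: vec_eq_iff) (simp add: scaleR_conv_of_real)

text \<open>Differentiability is meant in the full space at each point of \<open>S\<close>. By
  uniqueness of the derivative, fixing the matrix as \<open>cjacobian f z\<close> loses no
  generality, and it saves choosing a matrix in every proof.\<close>

definition holo_on :: "(complex ^ 'n) set \<Rightarrow> (complex ^ 'n \<Rightarrow> complex ^ 'n) \<Rightarrow> bool" where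
  "holo_on S f \<longleftrightarrow> (\<forall>z\<in>S. (f has_derivative (\<lambda>v. cjacobian f z *v v)) (at z))"

lemma cjacobian_eq:
  assumes "(f has_derivative (\<lambda>v. A *v v)) (at z)"
  shows "cjacobian f z = A"
  unfolding cjacobian_def frechet_derivative_at[OF assms, symmetric] by simp

lemma holo_onI:
  assumes "\<And>z. z \<in> S \<Longrightarrow> \<exists>A. (f has_derivative (\<lambda>v. A *v v)) (at z)"
  shows "holo_on S f"
  using assms cjacobian_eq unfolding holo_on_def by metis

lemma holo_onD: "holo_on S f \<Longrightarrow> z \<in> S \<Longrightarrow> (f has_derivative (\<lambda>v. cjacobian f z *v v)) (at z)"
  by (simp add: holo_on_def)

lemma holo_on_subset: "holo_on S f \<Longrightarrow> T \<subseteq> S \<Longrightarrow> holo_on T f"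
  by (auto simp: holo_on_def)

lemma hol_iff: "f \<in> hol \<longleftrightarrow> holo_on (ball 0 1) f \<and> (\<forall>z. z \<notin> ball 0 1 \<longrightarrow> f z = 0)"
  unfolding hol_def holo_on_def using cjacobian_eq by blast

lemma holo_on_continuous: "holo_on S f \<Longrightarrow> continuous_on S f"
  using holo_onD has_derivative_continuous continuous_at_imp_continuous_on by metis

lemma holo_on_transform:
  assumes "holo_on S f" "open S" "\<And>z. z \<in> S \<Longrightarrow> g z = f z"
  shows "holo_on S g" and "z \<in> S \<Longrightarrow> cjacobian g z = cjacobian f z"
proof -
  have *: "(g has_derivative (\<lambda>v. cjacobian f z *v v)) (at z)" if "z \<in> S" for z
    using has_derivative_transform_within_open[OF holo_onD[OF assms(1) that] assms(2) that] assms(3) by metis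
  show "holo_on S g" by (rule holo_onI) (use * in blast)
  show "z \<in> S \<Longrightarrow> cjacobian g z = cjacobian f z" using cjacobian_eq[OF *] by blast
qed

lemma on_ball_hol: "holo_on (ball 0 1) f \<Longrightarrow> on_ball f \<in> hol"
  unfolding hol_iff by (auto simp: on_ball_def intro: holo_on_transform(1)[of "ball 0 1" f])

lemma clinearI:
  fixes h :: "complex ^ 'n \<Rightarrow> complex ^ 'm"
  assumes "\<And>x y. h (x + y) = h x + h y" "\<And>c x. h (c *s x) = c *s h x"
  shows "Vector_Spaces.linear (*s) (*s) h"
  using assms by unfold_locales (vector algebra_simps)+

lemma has_derivative_clinear_matrix:
  fixes f h :: "complex ^ 'n \<Rightarrow> complex ^ 'n"
  assumes "(f has_derivative h) (at z)" "\<And>x y. h (x + y) = h x + h y" "\<And>c x. h (c *s x) = c *s h x"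
  shows "(f has_derivative (\<lambda>v. matrix h *v v)) (at z)"
  using assms(1) matrix_works[OF clinearI[OF assms(2,3)]] by simp

lemma holo_on_compose:
  assumes "holo_on S f" "holo_on T g" "f ` S \<subseteq> T"
  shows "holo_on S (\<lambda>z. g (f z))"
    and "z \<in> S \<Longrightarrow> cjacobian (\<lambda>z. g (f z)) z = cjacobian g (f z) ** cjacobian f z"
proof -
  have *: "((\<lambda>z. g (f z)) has_derivative (\<lambda>v. (cjacobian g (f z) ** cjacobian f z) *v v)) (at z)" if "z \<in> S" for z
    using diff_chain_at[OF holo_onD[OF assms(1) that] holo_onD[OF assms(2), of "f z"]] assms(3) that
    by (auto simp: o_def matrix_vector_mul_assoc)
  show "holo_on S (\<lambda>z. g (f z))" by (rule holo_onI) (use * in blast)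
  show "z \<in> S \<Longrightarrow> cjacobian (\<lambda>z. g (f z)) z = cjacobian g (f z) ** cjacobian f z"
    using cjacobian_eq[OF *] by blast
qed

lemma holo_on_scale:
  fixes f :: "complex ^ 'n \<Rightarrow> complex ^ 'n"
  shows "holo_on S f \<Longrightarrow> holo_on S (\<lambda>z. c *s f z)"
proof (rule holo_onI)
  fix z assume "holo_on S f" "z \<in> S"
  have bl: "bounded_linear (\<lambda>x :: complex ^ 'n. c *s x)"
    by (rule bounded_linear_intro[where K="norm c"]) (simp_all add: vec_eq_iff algebra_simps norm_vector_scalar_mult)
  have d: "((\<lambda>z. c *s f z) has_derivative (\<lambda>v. c *s (cjacobian f z *v v))) (at z)"
    by (rule bounded_linear.has_derivative[OF bl holo_onD]) fact+
  have "((\<lambda>z. c *s f z) has_derivative (\<lambda>v. matrix (\<lambda>v. c *s (cjacobian f z *v v)) *v v)) (at z)"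
  proof (rule has_derivative_clinear_matrix[OF d])
    fix x y :: "complex ^ 'n" and a :: complex
    show "c *s (cjacobian f z *v (x + y)) = c *s (cjacobian f z *v x) + c *s (cjacobian f z *v y)"
      unfolding matrix_vector_right_distrib by (rule vector_add_ldistrib)
    show "c *s (cjacobian f z *v (a *s x)) = a *s (c *s (cjacobian f z *v x))"
      unfolding vector_scalar_commute vector_smult_assoc by (simp only: mult.commute)
  qed
  then show "\<exists>A. ((\<lambda>z. c *s f z) has_derivative (\<lambda>v. A *v v)) (at z)" by blast
qed

lemma holo_on_add:
  assumes "holo_on S f" "holo_on S g"
  shows "holo_on S (\<lambda>z. f z + g z)"
proof (rule holo_onI)
  fix z assume z: "z \<in> S"
  have "((\<lambda>z. f z + g z) has_derivative (\<lambda>v. (cjacobian f z + cjacobian g z) *v v)) (at z)"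
    using has_derivative_add[OF holo_onD[OF assms(1) z] holo_onD[OF assms(2) z]]
    by (simp add: matrix_vector_mult_add_rdistrib)
  then show "\<exists>A. ((\<lambda>z. f z + g z) has_derivative (\<lambda>v. A *v v)) (at z)" by blast
qed

lemma holo_on_diff: "holo_on S f \<Longrightarrow> holo_on S g \<Longrightarrow> holo_on S (\<lambda>z. f z - g z)"
  using holo_on_add[OF _ holo_on_scale[of S g "-1"], of f] by (simp add: vector_sneg_minus1[symmetric])

lemma holo_on_id: "holo_on S (\<lambda>z. z)"
  by (rule holo_onI, rule exI[of _ "mat 1"]) simp

section \<open>One-variable slices, Cauchy estimates and limits of holomorphic maps\<close>

text \<open>Restriction to a complex line and pairing with a fixed vector give scalar functions of
  one variable, to which Cauchy's inequality and the Schwarz lemma apply.\<close>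

lemma slice_has_field_derivative:
  assumes "holo_on S f" "a + \<zeta> *s b \<in> S"
  shows "((\<lambda>\<zeta>. hermitian (f (a + \<zeta> *s b)) c) has_field_derivative
    hermitian (cjacobian f (a + \<zeta> *s b) *v b) c) (at \<zeta>)"
proof -
  have "((\<lambda>\<zeta>. a + \<zeta> *s b) has_derivative (\<lambda>h. h *s b)) (at \<zeta>)"
    using bounded_linear_imp_has_derivative[OF bounded_linear_scale_vector, of b]
    by (auto intro!: derivative_eq_intros)
  from diff_chain_at[OF this holo_onD[OF assms]]
  have "((\<lambda>\<zeta>. f (a + \<zeta> *s b)) has_derivative (\<lambda>h. cjacobian f (a + \<zeta> *s b) *v (h *s b))) (at \<zeta>)"
    by (simp add: o_def)
  from bounded_linear.has_derivative[OF bounded_linear_hermitian this, of c]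
  show ?thesis
    unfolding has_field_derivative_def
    by (rule has_derivative_eq_rhs) (simp add: fun_eq_iff vector_scalar_commute hermitian_linear)
qed

lemma slice_holomorphic:
  assumes "holo_on S f" "\<And>\<zeta>. \<zeta> \<in> D \<Longrightarrow> a + \<zeta> *s b \<in> S"
  shows "(\<lambda>\<zeta>. hermitian (f (a + \<zeta> *s b)) c) holomorphic_on D"
  unfolding holomorphic_on_def field_differentiable_def
  using slice_has_field_derivative[OF assms(1)] assms(2) has_field_derivative_at_within by metis

text \<open>The slice in direction \<open>v\<close> is paired with \<open>c\<close>, the very vector
  to be estimated. Its derivative at 0 is then \<open>(norm c)\<^sup>2\<close>, and Cauchy's
  inequality on the disc of radius \<open>\<rho> / norm v\<close> gives the bound after division by
  \<open>norm c\<close>.\<close>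

lemma cauchy_estimate:
  fixes f :: "complex ^ 'n \<Rightarrow> complex ^ 'n"
  assumes f: "holo_on S f" "cball z \<rho> \<subseteq> S" and \<rho>: "0 < \<rho>" and M: "\<And>x. x \<in> cball z \<rho> \<Longrightarrow> norm (f x) \<le> M"
  shows "norm (cjacobian f z *v v) \<le> M / \<rho> * norm v"
proof (cases "v = 0 \<or> cjacobian f z *v v = 0")
  case True
  have "0 \<le> M" using M[of z] \<rho> by (meson centre_in_cball less_imp_le norm_ge_zero order_trans)
  with True show ?thesis using \<rho> by auto
next
  case False
  define c where "c = cjacobian f z *v v"
  define s where "s = \<rho> / norm v"
  have s: "s > 0" using False \<rho> by (simp add: s_def)
  have inb: "z + \<zeta> *s v \<in> cball z \<rho>" if "norm \<zeta> \<le> s" for \<zeta>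
    using that False by (simp add: dist_norm norm_vector_scalar_mult s_def field_simps)
  define g where "g = (\<lambda>\<zeta>. hermitian (f (z + \<zeta> *s v)) c)"
  have hol: "g holomorphic_on cball 0 s" unfolding g_def
    by (rule slice_holomorphic[OF f(1)]) (use inb f(2) in auto)
  have "norm ((deriv ^^ 1) g 0) \<le> fact 1 * (M * norm c) / s ^ 1"
  proof (rule Cauchy_inequality)
    show "g holomorphic_on ball 0 s" using hol holomorphic_on_subset ball_subset_cball by blast
    show "continuous_on (cball 0 s) g" using hol holomorphic_on_imp_continuous_on by blast
    show "norm (g x) \<le> M * norm c" if "norm (0 - x) = s" for x
    proof -
      have "norm (g x) \<le> norm (f (z + x *s v)) * norm c" unfolding g_def by (rule norm_hermitian_le)
      also have "\<dots> \<le> M * norm c" using that by (intro mult_right_mono M inb) auto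
      finally show ?thesis .
    qed
  qed fact
  moreover have "deriv g 0 = of_real ((norm c)\<^sup>2)"
    using slice_has_field_derivative[OF f(1), of z 0 v c] f(2) \<rho>
    unfolding g_def by (intro DERIV_imp_deriv) (auto simp: c_def hermitian_self subset_iff)
  ultimately have "(norm c)\<^sup>2 \<le> M * norm c / s" by (simp add: norm_power)
  moreover have "norm c > 0" using False by (simp add: c_def)
  ultimately have "norm c \<le> M / s"
    using mult_right_le_imp_le[of "norm c" "norm c" "M / s"] by (simp add: power2_eq_square)
  then show ?thesis using False by (simp add: c_def s_def field_simps)
qed

lemma cauchy_estimate_lipschitz:
  fixes f :: "complex ^ 'n \<Rightarrow> complex ^ 'n"
  assumes f: "holo_on (ball 0 R) f" and r: "r < r'" "r' < R" and M: "\<And>x. x \<in> cball 0 r' \<Longrightarrow> norm (f x) \<le> M"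
    and zw: "z \<in> cball 0 r" "w \<in> cball 0 r"
  shows "norm (f z - f w) \<le> M / (r' - r) * norm (z - w)"
proof (rule differentiable_bound[OF convex_cball _ _ zw])
  fix x :: "complex ^ 'n" assume x: "x \<in> cball 0 r"
  have sub: "cball x (r' - r) \<subseteq> cball 0 r'"
  proof
    fix y assume "y \<in> cball x (r' - r)"
    then show "y \<in> cball 0 r'" using x norm_triangle_ineq2[of y x] by (simp add: dist_norm norm_minus_commute)
  qed
  then have sub2: "cball x (r' - r) \<subseteq> ball 0 R" using r by auto
  have xR: "x \<in> ball 0 R" using x r by simp
  show "(f has_derivative (\<lambda>v. cjacobian f x *v v)) (at x within cball 0 r)"
    by (rule has_derivative_at_withinI[OF holo_onD[OF f xR]])
  have "norm (f y) \<le> M" if "y \<in> cball x (r' - r)" for y by (rule M) (use sub that in blast)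
  then have "norm (cjacobian f x *v v) \<le> M / (r' - r) * norm v" for v
    using r by (intro cauchy_estimate[OF f sub2]) simp_all
  then show "onorm (\<lambda>v. cjacobian f x *v v) \<le> M / (r' - r)" by (rule onorm_le)
qed

lemma cjacobian_bound:
  fixes f :: "complex ^ 'n \<Rightarrow> complex ^ 'n"
  assumes f: "holo_on (ball 0 R) f" and r: "r < r'" "r' < R" and M: "\<And>x. x \<in> cball 0 r' \<Longrightarrow> norm (f x) \<le> M"
    and z: "z \<in> cball 0 r"
  shows "norm (cjacobian f z *v v) \<le> M / (r' - r) * norm v"
proof (rule cauchy_estimate[OF f])
  have sub: "cball z (r' - r) \<subseteq> cball 0 r'"
  proof
    fix y assume "y \<in> cball z (r' - r)"
    then show "y \<in> cball 0 r'" using z norm_triangle_ineq2[of y z] by (simp add: dist_norm norm_minus_commute)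
  qed
  then show "cball z (r' - r) \<subseteq> ball 0 R" using r by auto
  show "norm (f x) \<le> M" if "x \<in> cball z (r' - r)" for x using M sub that by blast
qed (use r in auto)

text \<open>The Cauchy estimate for \<open>x \<mapsto> f (z + x) - f (w + x)\<close> shows that the derivative is Lipschitz;
  no second derivative is needed.\<close>

lemma cauchy_estimate_second_order:
  fixes f :: "complex ^ 'n \<Rightarrow> complex ^ 'n"
  assumes f: "holo_on (ball 0 R) f" and r: "r < r'" "r' < R" and M: "\<And>x. x \<in> cball 0 r' \<Longrightarrow> norm (f x) \<le> M"
    and zw: "z \<in> cball 0 r" "w \<in> cball 0 r"
  shows "norm (f w - f z - cjacobian f z *v (w - z)) \<le> 4 * M / (r' - r)\<^sup>2 * (norm (w - z))\<^sup>2"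
proof -
  \<comment> \<open>The gap between \<open>r\<close> and \<open>r'\<close> is halved: one half is
    spent on the Lipschitz bound for \<open>f\<close>, the other on the Cauchy estimate for the
    difference. Each costs a factor \<open>1 / \<rho>\<close>, whence the 4 in the constant.\<close>
  define \<rho> where "\<rho> = (r' - r) / 2"
  define r1 where "r1 = r + \<rho>"
  have \<rho>: "\<rho> > 0" "r1 < r'" "r < r1" "r' - r1 = \<rho>" using r by (simp_all add: \<rho>_def r1_def field_simps)
  have M0: "0 \<le> M" 
  proof -
    have "norm (f z) \<le> M" using M zw r by auto
    then show ?thesis using norm_ge_zero order_trans by blast
  qed
  have inr1: "x + y \<in> cball 0 r1" if "x \<in> cball 0 r" "y \<in> cball 0 \<rho>" for x y :: "complex ^ 'n"
    using that norm_triangle_ineq[of x y] by (simp add: r1_def)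
  have jac: "norm (cjacobian f x *v v - cjacobian f z *v v) \<le> M / \<rho> * norm (x - z) / \<rho> * norm v"
    if x: "x \<in> cball 0 r" for x v :: "complex ^ 'n"
  proof -
    define g where "g = (\<lambda>y. f (x + y) - f (z + y))"
    have der: "((\<lambda>y. f (p + y)) has_derivative (\<lambda>v. cjacobian f (p + y) *v v)) (at y)"
      if "p \<in> cball 0 r" "y \<in> ball 0 (R - r)" for p y
    proof -
      have "p + y \<in> ball 0 R" using that norm_triangle_ineq[of p y] by simp
      have "((\<lambda>y. p + y) has_derivative (\<lambda>v. v)) (at y)" by (auto intro!: derivative_eq_intros)
      from diff_chain_at[OF this holo_onD[OF f \<open>p + y \<in> ball 0 R\<close>]] show ?thesis by (simp add: o_def)
    qed
    have der_g: "(g has_derivative (\<lambda>v. (cjacobian f (x + y) - cjacobian f (z + y)) *v v)) (at y)"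
      if "y \<in> ball 0 (R - r)" for y
      using has_derivative_diff[OF der[OF x that] der[OF zw(1) that]]
      unfolding g_def by (simp add: matrix_vector_mult_diff_rdistrib)
    have hol: "holo_on (ball 0 (R - r)) g" by (rule holo_onI) (use der_g in blast)
    have "norm (cjacobian g 0 *v v) \<le> (M / \<rho> * norm (x - z)) / \<rho> * norm v"
    proof (rule cauchy_estimate[OF hol])
      show "cball 0 \<rho> \<subseteq> ball 0 (R - r)" using r \<rho> by (auto simp: r1_def)
      fix y :: "complex ^ 'n" assume "y \<in> cball 0 \<rho>"
      then have "norm (f (x + y) - f (z + y)) \<le> M / (r' - r1) * norm ((x + y) - (z + y))"
        by (intro cauchy_estimate_lipschitz[OF f \<rho>(2) r(2) M] inr1 x zw)
      then show "norm (g y) \<le> M / \<rho> * norm (x - z)" by (simp add: g_def \<rho>)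
    qed (rule \<rho>)
    moreover have "cjacobian g 0 = cjacobian f x - cjacobian f z"
      using cjacobian_eq[OF der_g[of 0]] r zw by auto
    ultimately show ?thesis by (simp add: matrix_vector_mult_diff_rdistrib)
  qed
  have seg: "closed_segment z w \<subseteq> cball 0 r" by (rule closed_segment_subset[OF zw convex_cball])
  have "norm ((f w - cjacobian f z *v w) - (f z - cjacobian f z *v z)) \<le> (M / \<rho> * norm (w - z) / \<rho>) * norm (w - z)"
  proof (rule differentiable_bound[where S="closed_segment z w" and f="\<lambda>x. f x - cjacobian f z *v x"
        and f'="\<lambda>x v. cjacobian f x *v v - cjacobian f z *v v"])
    fix x assume x: "x \<in> closed_segment z w"
    then have xr: "x \<in> cball 0 r" using seg by blast
    then have "x \<in> ball 0 R" using r by auto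
    then show "((\<lambda>x. f x - cjacobian f z *v x) has_derivative (\<lambda>v. cjacobian f x *v v - cjacobian f z *v v))
        (at x within closed_segment z w)"
      by (intro has_derivative_diff has_derivative_at_withinI[OF holo_onD[OF f]] 
          bounded_linear_imp_has_derivative matrix_vector_mul_bounded_linear)
    show "onorm (\<lambda>v. cjacobian f x *v v - cjacobian f z *v v) \<le> M / \<rho> * norm (w - z) / \<rho>"
    proof (rule onorm_le)
      fix v :: "complex ^ 'n"
      have "norm (x - z) \<le> norm (w - z)" using segment_bound(1)[OF x] by simp
      then have "M / \<rho> * norm (x - z) / \<rho> * norm v \<le> M / \<rho> * norm (w - z) / \<rho> * norm v"
        using M0 \<rho> by (intro mult_right_mono divide_right_mono mult_left_mono) auto
      with jac[OF xr, of v] show "norm (cjacobian f x *v v - cjacobian f z *v v) \<le> M / \<rho> * norm (w - z) / \<rho> * norm v"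
        by linarith
    qed
  qed auto
  moreover have "M / \<rho> * norm (w - z) / \<rho> * norm (w - z) = 4 * M / (r' - r)\<^sup>2 * (norm (w - z))\<^sup>2"
    using r by (simp add: \<rho>_def power2_eq_square field_simps)
  ultimately show ?thesis by (simp add: matrix_vector_mult_diff_distrib algebra_simps)
qed

lemma holo_on_bounded_cball:
  assumes "holo_on (ball 0 R) f" "r < R"
  obtains M where "M > 0" "\<And>x. x \<in> cball 0 r \<Longrightarrow> norm (f x) \<le> M"
proof -
  have "continuous_on (cball 0 r) f"
    by (rule continuous_on_subset[OF holo_on_continuous[OF assms(1)]]) (use assms(2) in auto)
  then have "bounded (f ` cball 0 r)" by (intro compact_imp_bounded compact_continuous_image compact_cball)
  then show thesis using that unfolding bounded_pos by auto
qed

text \<open>Weierstrass' theorem. Cauchy estimates for \<open>f m - f n\<close> on a larger ball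
  make the derivatives uniformly Cauchy on \<open>cball 0 r\<close>, so the sequence can be
  differentiated termwise; complex linearity passes to the limit of the derivatives.\<close>

lemma holo_on_uniform_limit:
  fixes f :: "nat \<Rightarrow> complex ^ 'n \<Rightarrow> complex ^ 'n"
  assumes f: "\<And>n. holo_on (ball 0 R) (f n)"
    and lim: "\<And>r. r < R \<Longrightarrow> uniform_limit (cball 0 r) f g sequentially"
  shows "holo_on (ball 0 R) g"
proof (rule holo_onI)
  fix z :: "complex ^ 'n" assume z: "z \<in> ball 0 R"
  obtain r where r: "norm z < r" "r < R" using z dense by auto
  obtain r' where r': "r < r'" "r' < R" using r dense by blast
  have diffb: "\<forall>\<^sub>F m in sequentially. \<forall>\<^sub>F n in sequentially. \<forall>x\<in>cball 0 r. \<forall>v.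
      norm (cjacobian (f m) x *v v - cjacobian (f n) x *v v) \<le> e * norm v" if "e > 0" for e
  proof -
    \<comment> \<open>Chosen so that \<open>2 * d / (r' - r) = e\<close>: both maps are within
      \<open>d\<close> of \<open>g\<close>, and the Cauchy estimate divides by the gap of the
      radii.\<close>
    define d where "d = e * (r' - r) / 2"
    have d: "d > 0" using that r' by (simp add: d_def)
    have ev: "\<forall>\<^sub>F n in sequentially. \<forall>x\<in>cball 0 r'. dist (f n x) (g x) < d"
      using lim[OF r'(2)] d unfolding uniform_limit_iff by blast
    show ?thesis
    proof (rule eventually_mono[OF ev])
      fix m assume m: "\<forall>x\<in>cball 0 r'. dist (f m x) (g x) < d"
      show "\<forall>\<^sub>F n in sequentially. \<forall>x\<in>cball 0 r. \<forall>v.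
        norm (cjacobian (f m) x *v v - cjacobian (f n) x *v v) \<le> e * norm v"
      proof (rule eventually_mono[OF ev], intro ballI allI)
        fix n x v assume n: "\<forall>x\<in>cball 0 r'. dist (f n x) (g x) < d" and x: "(x :: complex ^ 'n) \<in> cball 0 r"
        have hol: "holo_on (ball 0 R) (\<lambda>x. f m x - f n x)" by (intro holo_on_diff f)
        have xR: "x \<in> ball 0 R" using x r by auto
        have "cjacobian (\<lambda>x. f m x - f n x) x = cjacobian (f m) x - cjacobian (f n) x"
          using has_derivative_diff[OF holo_onD[OF f[of m] xR] holo_onD[OF f[of n] xR]]
          by (intro cjacobian_eq) (simp add: matrix_vector_mult_diff_rdistrib)
        moreover have "norm (cjacobian (\<lambda>x. f m x - f n x) x *v v) \<le> (2 * d) / (r' - r) * norm v"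
        proof (rule cjacobian_bound[OF hol r' _ x])
          fix y :: "complex ^ 'n" assume "y \<in> cball 0 r'"
          then have "dist (f m y) (g y) < d" "dist (f n y) (g y) < d" using m n by auto
          then show "norm (f m y - f n y) \<le> 2 * d" using dist_triangle_less_add[of "f m y" "g y" d "f n y" d]
            by (simp add: dist_norm)
        qed
        ultimately show "norm (cjacobian (f m) x *v v - cjacobian (f n) x *v v) \<le> e * norm v"
          using r' by (simp add: d_def matrix_vector_mult_diff_rdistrib)
      qed
    qed
  qed
  have "\<exists>h. \<forall>v. (\<lambda>n. cjacobian (f n) x *v v) \<longlonglongrightarrow> h v" if x: "x \<in> cball 0 r" for x
  proof -
    have "Cauchy (\<lambda>n. cjacobian (f n) x *v v)" for v
    proof (rule metric_CauchyI)
      fix e :: real assume e: "e > 0"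
      define e' where "e' = e / (2 * (norm v + 1))"
      have nv: "norm v + 1 > 0" by (simp add: add_nonneg_pos)
      have e': "e' > 0" "e' * norm v < e / 2" using e nv by (simp_all add: e'_def field_simps)
      have "\<forall>\<^sub>F m in sequentially. \<forall>\<^sub>F n in sequentially.
          norm (cjacobian (f m) x *v v - cjacobian (f n) x *v v) \<le> e' * norm v"
        by (rule eventually_mono[OF diffb[OF e'(1)]]) (erule eventually_mono, use x in blast)
      then obtain m where m: "\<forall>\<^sub>F n in sequentially. norm (cjacobian (f m) x *v v - cjacobian (f n) x *v v) \<le> e' * norm v"
        unfolding eventually_sequentially by blast
      then obtain N where N: "\<And>n. n \<ge> N \<Longrightarrow> norm (cjacobian (f m) x *v v - cjacobian (f n) x *v v) < e / 2"
        using e'(2) unfolding eventually_sequentially by (meson le_less_trans)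
      show "\<exists>M. \<forall>m\<ge>M. \<forall>n\<ge>M. dist (cjacobian (f m) x *v v) (cjacobian (f n) x *v v) < e"
      proof (intro exI[of _ N] allI impI)
        fix k l assume "N \<le> k" "N \<le> l"
        then show "dist (cjacobian (f k) x *v v) (cjacobian (f l) x *v v) < e"
          using dist_triangle_half_r[of "cjacobian (f m) x *v v" "cjacobian (f k) x *v v" e "cjacobian (f l) x *v v"] N
          by (simp add: dist_norm)
      qed
    qed
    then show ?thesis by (meson Cauchy_convergent convergent_def)
  qed
  then obtain h where h: "\<And>x v. x \<in> cball 0 r \<Longrightarrow> (\<lambda>n. cjacobian (f n) x *v v) \<longlonglongrightarrow> h x v" by metis
  have zr: "z \<in> ball 0 r" using r by simp
  have "\<exists>k. \<forall>x\<in>ball 0 r. (\<lambda>n. f n x) \<longlonglongrightarrow> k x \<and> (k has_derivative h x) (at x within ball 0 r)"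
  proof (rule has_derivative_sequence[OF convex_ball, where f=f and f'="\<lambda>n x v. cjacobian (f n) x *v v" and g'=h])
    show "(f n has_derivative (\<lambda>v. cjacobian (f n) x *v v)) (at x within ball 0 r)" if "x \<in> ball 0 r" for n x
      by (rule has_derivative_at_withinI[OF holo_onD[OF f]]) (use that r in auto)
    show "\<forall>\<^sub>F n in sequentially. \<forall>x\<in>ball 0 r. \<forall>v. norm (cjacobian (f n) x *v v - h x v) \<le> e * norm v"
      if "e > 0" for e
    proof (rule eventually_mono[OF diffb[OF that]], intro ballI allI)
      fix m x v assume m: "\<forall>\<^sub>F n in sequentially. \<forall>x\<in>cball 0 r. \<forall>v.
        norm (cjacobian (f m) x *v v - cjacobian (f n) x *v v) \<le> e * norm v" and x: "(x :: complex ^ 'n) \<in> ball 0 r"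
      have xc: "x \<in> cball 0 r" using x by simp
      have "(\<lambda>n. norm (cjacobian (f m) x *v v - cjacobian (f n) x *v v)) \<longlonglongrightarrow> norm (cjacobian (f m) x *v v - h x v)"
        by (intro tendsto_intros h xc)
      then show "norm (cjacobian (f m) x *v v - h x v) \<le> e * norm v"
        by (rule tendsto_upperbound) (use m xc in \<open>auto elim: eventually_mono\<close>)
    qed
    show "z \<in> ball 0 r" by (rule zr)
    show "(\<lambda>n. f n z) \<longlonglongrightarrow> g z"
      using tendsto_uniform_limitI[OF lim[OF r(2)]] zr by simp
  qed
  then obtain k where k: "\<And>x. x \<in> ball 0 r \<Longrightarrow> (\<lambda>n. f n x) \<longlonglongrightarrow> k x"
    "\<And>x. x \<in> ball 0 r \<Longrightarrow> (k has_derivative h x) (at x within ball 0 r)" by blast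
  have "k x = g x" if "x \<in> ball 0 r" for x
    using LIMSEQ_unique[OF k(1)[OF that]] tendsto_uniform_limitI[OF lim[OF r(2)], of x] that by auto
  moreover have "(k has_derivative h z) (at z)" using k(2)[OF zr] at_within_open[OF zr] by simp
  ultimately have gd: "(g has_derivative h z) (at z)"
    using has_derivative_transform_within_open[OF _ open_ball zr] by metis
  have zc: "z \<in> cball 0 r" using r by simp
  have "h z (x + y) = h z x + h z y" for x y
    using LIMSEQ_unique[OF h[OF zc, of "x + y"]] tendsto_add[OF h[OF zc, of x] h[OF zc, of y]]
    by (simp add: matrix_vector_right_distrib)
  moreover have "h z (c *s x) = c *s h z x" for c x
  proof (rule LIMSEQ_unique[OF h[OF zc, of "c *s x"]])
    show "(\<lambda>n. cjacobian (f n) z *v (c *s x)) \<longlonglongrightarrow> c *s h z x"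
      unfolding vector_scalar_commute
      by (rule vec_tendstoI) (auto intro!: tendsto_intros tendsto_vec_nth h[OF zc])
  qed
  ultimately show "\<exists>A. (g has_derivative (\<lambda>v. A *v v)) (at z)"
    using has_derivative_clinear_matrix[OF gd] by blast
qed

section \<open>Bounds for the Caratheodory class\<close>

lemma matrix_vector_mult_minus: "(- A) *v v = - (A *v v)" for A :: "complex ^ 'n ^ 'm"
  using matrix_vector_mult_diff_rdistrib[of 0 A v] by simp

lemma class_MD:
  assumes "h \<in> class_M"
  shows "holo_on (ball 0 1) h" "h 0 = 0" "cjacobian h 0 = - mat 1"
    "z \<in> ball 0 1 \<Longrightarrow> h z \<bullet> z \<le> 0" "h \<in> hol"
  using assms unfolding class_M_def hol_iff Re_hermitian by auto

text \<open>On the complex line through \<open>z\<close>, dividing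
  \<open>- \<langle>h(\<zeta> e), e\<rangle>\<close> by \<open>\<zeta>\<close> gives a Caratheodory
  function \<open>p\<close>: its real part is nonnegative and \<open>p 0 = 1\<close>. Its Cayley
  transform \<open>q\<close> vanishes at 0 and is bounded by 1, so
  \<open>|q \<zeta>| \<le> |\<zeta>|\<close> by the Schwarz lemma. Solving for \<open>p\<close>
  gives the classical bounds \<open>Re p \<ge> (1 - r) / (1 + r)\<close> and
  \<open>|p| \<le> (1 + r) / (1 - r)\<close>; the conclusions are these, multiplied by the square of
  \<open>r = norm z\<close> and cleared of denominators.\<close>

lemma class_M_hermitian_bounds:
  fixes h :: "complex ^ 'n \<Rightarrow> complex ^ 'n"
  assumes h: "h \<in> class_M" and z: "norm z < 1"
  shows "norm (hermitian (h z) z) * (1 - norm z) \<le> (norm z)\<^sup>2 * (1 + norm z)"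
    and "(h z \<bullet> z) * (1 + norm z) \<le> - (norm z)\<^sup>2 * (1 - norm z)"
proof -
  have "norm (hermitian (h z) z) * (1 - norm z) \<le> (norm z)\<^sup>2 * (1 + norm z) \<and>
     (h z \<bullet> z) * (1 + norm z) \<le> - (norm z)\<^sup>2 * (1 - norm z)"
  proof (cases "z = 0")
    case True then show ?thesis using class_MD(2)[OF h] by (simp add: hermitian_def)
  next
    case False
    define r where "r = norm z"
    have r: "0 < r" "r < 1" using False z by (simp_all add: r_def)
    define e where "e = (1 / complex_of_real r) *s z"
    have e: "norm e = 1" using r by (simp add: e_def norm_vector_scalar_mult norm_divide flip: r_def)
    have ez: "complex_of_real r *s e = z" using r by (simp add: e_def vector_smult_assoc)
    define g where "g = (\<lambda>\<zeta>. hermitian (h (0 + \<zeta> *s e)) e)"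
    have g: "g holomorphic_on ball 0 1" unfolding g_def
      by (rule slice_holomorphic[OF class_MD(1)[OF h]]) (simp add: norm_vector_scalar_mult e)
    have g0: "g 0 = 0" using class_MD(2)[OF h] by (simp add: g_def hermitian_def)
    have dg: "deriv g 0 = - 1"
    proof -
      have "(g has_field_derivative hermitian (cjacobian h (0 + 0 *s e) *v e) e) (at 0)"
        unfolding g_def by (rule slice_has_field_derivative[OF class_MD(1)[OF h]]) simp
      moreover have "cjacobian h (0 + 0 *s e) *v e = - e"
        using class_MD(3)[OF h] by (simp add: matrix_vector_mult_minus)
      ultimately show ?thesis by (simp add: DERIV_imp_deriv hermitian_linear hermitian_self e)
    qed
    \<comment> \<open>The singularity at 0 is removed by inserting the derivative of
      \<open>g\<close> there.\<close>
    define p where "p = (\<lambda>\<zeta>. - (if \<zeta> = 0 then deriv g 0 else (g \<zeta> - g 0) / (\<zeta> - 0)))"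
    have p: "p holomorphic_on ball 0 1" unfolding p_def
      by (intro holomorphic_on_minus pole_lemma g) simp
    have p0: "p 0 = 1" by (simp add: p_def dg)
    have pg: "g \<zeta> = - \<zeta> * p \<zeta>" for \<zeta> using g0 by (simp add: p_def)
    have Rep: "0 \<le> Re (p \<zeta>)" if "\<zeta> \<in> ball 0 1" for \<zeta>
    proof (cases "\<zeta> = 0")
      case False
      have "\<zeta> *s e \<in> ball 0 1" using that by (simp add: norm_vector_scalar_mult e)
      then have "Re (hermitian (h (\<zeta> *s e)) (\<zeta> *s e)) \<le> 0"
        unfolding Re_hermitian by (rule class_MD(4)[OF h])
      moreover have "hermitian (h (\<zeta> *s e)) (\<zeta> *s e) = cnj \<zeta> * g \<zeta>" by (simp add: g_def hermitian_linear)
      moreover have "cnj \<zeta> * g \<zeta> = - of_real ((norm \<zeta>)\<^sup>2) * p \<zeta>"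
        unfolding pg complex_norm_square by simp
      ultimately have "- ((norm \<zeta>)\<^sup>2 * Re (p \<zeta>)) \<le> 0" by (simp add: Re_complex_of_real del: of_real_power)
      moreover have "(norm \<zeta>)\<^sup>2 > 0" using False by simp
      ultimately show ?thesis by (simp add: zero_le_mult_iff)
    qed (simp add: p0)
    have p1: "p \<zeta> + 1 \<noteq> 0" if "\<zeta> \<in> ball 0 1" for \<zeta>
      using Rep[OF that] by (metis add.commute add_eq_0_iff minus_complex.simps(1) not_one_le_zero
          one_complex.simps(1) uminus_complex.simps(1) neg_0_le_iff_le)
    define q where "q = (\<lambda>\<zeta>. (p \<zeta> - 1) / (p \<zeta> + 1))"
    have q: "q holomorphic_on ball 0 1" unfolding q_def
      by (intro holomorphic_intros p) (use p1 in auto)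
    have q1: "norm (q \<zeta>) \<le> 1" if "\<zeta> \<in> ball 0 1" for \<zeta>
    proof -
      have "(norm (p \<zeta> - 1))\<^sup>2 \<le> (norm (p \<zeta> + 1))\<^sup>2"
        using Rep[OF that] unfolding cmod_power2 by (simp add: power2_eq_square algebra_simps)
      then have "norm (p \<zeta> - 1) \<le> norm (p \<zeta> + 1)" by (rule power2_le_imp_le) simp
      then show ?thesis using p1[OF that] by (simp add: q_def norm_divide divide_le_eq_1)
    qed
    \<comment> \<open>The Schwarz lemma asks for values strictly inside the unit disc, whereas only
      \<open>norm (q \<zeta>) \<le> 1\<close> is known. It is therefore applied to \<open>c\<close>
      times \<open>q\<close> with \<open>c < 1\<close>, and \<open>c\<close> tends to 1.\<close>
    have qr: "norm (q \<zeta>) \<le> norm \<zeta>" if \<zeta>: "\<zeta> \<in> ball 0 1" for \<zeta>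
    proof (rule field_le_mult_one_interval)
      fix c :: real assume c: "0 < c" "c < 1"
      have "norm (of_real c * q \<zeta>) \<le> norm \<zeta>"
      proof (rule Schwarz_Lemma(1))
        show "(\<lambda>\<zeta>. of_real c * q \<zeta>) holomorphic_on ball 0 1" by (intro holomorphic_intros q)
        show "of_real c * q 0 = 0" by (simp add: q_def p0)
        show "norm (of_real c * q x) < 1" if "norm x < 1" for x
        proof -
          have "c * norm (q x) \<le> c * 1" using q1[of x] that c by (intro mult_left_mono) auto
          moreover have "norm (of_real c * q x) = c * norm (q x)" using c by (simp add: norm_mult)
          ultimately show ?thesis using c by linarith
        qed
        show "norm \<zeta> < 1" using \<zeta> by simp
      qed
      then show "c * norm (q \<zeta>) \<le> norm \<zeta>" using c by (simp add: norm_mult)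
    qed
    define P where "P = p (of_real r)"
    have rb: "complex_of_real r \<in> ball 0 1" using r by simp
    have hz: "hermitian (h z) z = - of_real (r\<^sup>2) * P"
    proof -
      have "hermitian (h z) z = hermitian (h (of_real r *s e)) (of_real r *s e)" by (simp add: ez)
      also have "\<dots> = of_real r * g (of_real r)" by (simp add: g_def hermitian_linear)
      finally show ?thesis unfolding pg P_def by (simp add: power2_eq_square)
    qed
    have PP: "norm (P - 1) \<le> r * norm (P + 1)"
      using qr[OF rb] p1[OF rb] r by (simp add: q_def P_def norm_divide divide_le_eq)
    have "norm P \<le> norm (P - 1) + 1" "norm (P + 1) \<le> norm P + 1"
      using norm_triangle_ineq[of "P - 1" 1] norm_triangle_ineq[of P 1] by simp_all
    then have "norm P \<le> r * (norm P + 1) + 1" using PP r mult_left_mono[of "norm (P + 1)" "norm P + 1" r] by linarith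
    then have nP: "norm P * (1 - r) \<le> 1 + r" by (simp add: algebra_simps)
    have "(norm (P - 1))\<^sup>2 \<le> (r * norm (P + 1))\<^sup>2" using PP by (rule power_mono) simp
    then have "(Re P - 1)\<^sup>2 + (Im P)\<^sup>2 \<le> r\<^sup>2 * ((Re P + 1)\<^sup>2 + (Im P)\<^sup>2)"
      by (simp add: cmod_power2 power_mult_distrib)
    moreover have "r\<^sup>2 * (Im P)\<^sup>2 \<le> 1 * (Im P)\<^sup>2" using r by (intro mult_right_mono) (auto simp: power_le_one)
    ultimately have "(Re P - 1)\<^sup>2 \<le> r\<^sup>2 * (Re P + 1)\<^sup>2" by (simp add: distrib_left)
    then have "(1 - Re P)\<^sup>2 \<le> (r * (Re P + 1))\<^sup>2"
      unfolding power_mult_distrib by (simp only: power2_commute[of "Re P"])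
    then have "1 - Re P \<le> r * (Re P + 1)"
      by (rule power2_le_imp_le) (use r Rep[OF rb] in \<open>simp add: P_def\<close>)
    then have RP: "1 - r \<le> Re P * (1 + r)" by (simp add: algebra_simps)
    have "norm (hermitian (h z) z) * (1 - r) = r\<^sup>2 * (norm P * (1 - r))"
      unfolding hz by (simp add: norm_mult norm_power)
    also have "\<dots> \<le> r\<^sup>2 * (1 + r)" using nP by (intro mult_left_mono) auto
    finally have 1: "norm (hermitian (h z) z) * (1 - r) \<le> r\<^sup>2 * (1 + r)" .
    have "h z \<bullet> z = - (r\<^sup>2 * Re P)" unfolding Re_hermitian[symmetric] hz by (simp del: of_real_power)
    then have "(h z \<bullet> z) * (1 + r) = - (r\<^sup>2 * (Re P * (1 + r)))" by simp
    also have "\<dots> \<le> - (r\<^sup>2 * (1 - r))" using RP by (simp add: mult_left_mono)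
    finally show ?thesis using 1 by (simp add: r_def)
  qed
  then show "norm (hermitian (h z) z) * (1 - norm z) \<le> (norm z)\<^sup>2 * (1 + norm z)"
    "(h z \<bullet> z) * (1 + norm z) \<le> - (norm z)\<^sup>2 * (1 - norm z)" by auto
qed

text \<open>The function \<open>q \<zeta> = \<zeta> \<langle>h (a + \<zeta> b), a\<rangle> + \<langle>h (a + \<zeta> b), b\<rangle>\<close> is holomorphic,
  \<open>q 0 = \<langle>h a, b\<rangle>\<close>, and \<open>q \<zeta> = \<zeta> \<langle>h w, w\<rangle>\<close> with \<open>w = a + \<zeta> b\<close> on the unit circle.\<close>

lemma class_M_bound:
  fixes h :: "complex ^ 'n \<Rightarrow> complex ^ 'n"
  assumes h: "h \<in> class_M" and z: "norm z \<le> r" and r: "r < 1"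
  shows "norm (h z) \<le> 8 / (1 - r)\<^sup>2"
proof (cases "h z = 0")
  case False
  \<comment> \<open>\<open>s\<close> is half of \<open>1 - r\<close>. The disc
    \<open>z + \<zeta> b\<close> then stays in the ball of radius \<open>r + s < 1\<close>, where
    \<open>1 - norm w \<ge> s\<close>. Taking \<open>b\<close> of length \<open>s\<close> along
    \<open>h z\<close> makes \<open>\<langle>h z, b\<rangle>\<close> equal to \<open>s\<close> times
    the norm of \<open>h z\<close>.\<close>
  define s where "s = (1 - r) / 2"
  have s: "s > 0" "r + s < 1" using r by (simp_all add: s_def field_simps)
  define b where "b = complex_of_real (s / norm (h z)) *s h z"
  have b: "norm b = s" using False s by (simp add: b_def norm_vector_scalar_mult norm_divide)
  have nw: "norm (z + \<zeta> *s b) \<le> r + s" if "norm \<zeta> \<le> 1" for \<zeta>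
  proof -
    have "norm (z + \<zeta> *s b) \<le> norm z + norm \<zeta> * norm b"
      using norm_triangle_ineq[of z "\<zeta> *s b"] by (simp add: norm_vector_scalar_mult)
    also have "\<dots> \<le> r + 1 * s" using z that b s by (intro add_mono mult_mono) auto
    finally show ?thesis by simp
  qed
  define q where "q = (\<lambda>\<zeta>. \<zeta> * hermitian (h (z + \<zeta> *s b)) z + hermitian (h (z + \<zeta> *s b)) b)"
  have q: "q holomorphic_on cball 0 1" unfolding q_def
    by (intro holomorphic_intros slice_holomorphic[OF class_MD(1)[OF h]]) (use nw s in force)+
  \<comment> \<open>Cauchy's inequality for the derivative of order 0 serves as the maximum
    principle.\<close>
  have "norm ((deriv ^^ 0) q 0) \<le> fact 0 * (4 / (1 - r)) / 1 ^ 0"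
  proof (rule Cauchy_inequality)
    show "q holomorphic_on ball 0 1" using q holomorphic_on_subset ball_subset_cball by blast
    show "continuous_on (cball 0 1) q" using q holomorphic_on_imp_continuous_on by blast
    fix \<zeta> :: complex assume "norm (0 - \<zeta>) = 1"
    then have \<zeta>: "norm \<zeta> = 1" by simp
    define w where "w = z + \<zeta> *s b"
    have w: "norm w \<le> r + s" using nw \<zeta> by (simp add: w_def)
    have "\<zeta> * hermitian (h w) w = \<zeta> * hermitian (h w) z + (\<zeta> * cnj \<zeta>) * hermitian (h w) b"
      by (simp add: w_def hermitian_linear algebra_simps)
    also have "\<zeta> * cnj \<zeta> = 1" using \<zeta> complex_norm_square[of \<zeta>] by simp
    finally have "norm (q \<zeta>) = norm (hermitian (h w) w)"
      using \<zeta> by (metis q_def w_def mult_1 norm_mult)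
    also have "\<dots> \<le> 4 / (1 - r)"
    proof -
      have w1: "norm w < 1" using w s by linarith
      have "norm (hermitian (h w) w) * s \<le> norm (hermitian (h w) w) * (1 - norm w)"
        using w s by (intro mult_left_mono) (auto simp: s_def field_simps)
      also have "\<dots> \<le> (norm w)\<^sup>2 * (1 + norm w)" by (rule class_M_hermitian_bounds(1)[OF h w1])
      also have "\<dots> \<le> 1 * 2" using w1 by (intro mult_mono) (auto simp: power_le_one)
      finally show ?thesis using s r by (simp add: s_def field_simps)
    qed
    finally show "norm (q \<zeta>) \<le> 4 / (1 - r)" .
  qed simp
  then have "norm (hermitian (h z) b) \<le> 4 / (1 - r)" by (simp add: q_def)
  moreover have "hermitian (h z) b = of_real (s * norm (h z))"
    using False by (simp add: b_def hermitian_linear hermitian_self power2_eq_square)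
  ultimately have "s * norm (h z) \<le> 4 / (1 - r)" using s by (simp add: norm_mult)
  moreover have rs: "1 - r = 2 * s" by (simp add: s_def)
  ultimately have "norm (h z) * (2 * s)\<^sup>2 \<le> 8" using s by (simp add: field_simps power2_eq_square)
  then show ?thesis unfolding rs using s by (simp add: pos_le_divide_eq)
qed (use r in simp)

text \<open>The constant depends on \<open>r\<close> but not on the map, which makes every estimate
  for a field uniform in time. All four bounds follow from the sup bound on a slightly larger ball
  by Cauchy estimates.\<close>

lemma class_M_uniform_bounds:
  assumes r: "0 \<le> r" "r < 1"
  obtains K where "0 < K"
    "\<And>(h :: complex ^ 'n \<Rightarrow> complex ^ 'n) z. h \<in> class_M \<Longrightarrow> z \<in> cball 0 r \<Longrightarrow> norm (h z) \<le> K"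
    "\<And>(h :: complex ^ 'n \<Rightarrow> complex ^ 'n) z w. h \<in> class_M \<Longrightarrow> z \<in> cball 0 r \<Longrightarrow> w \<in> cball 0 r \<Longrightarrow>
       norm (h z - h w) \<le> K * norm (z - w)"
    "\<And>(h :: complex ^ 'n \<Rightarrow> complex ^ 'n) z v. h \<in> class_M \<Longrightarrow> z \<in> cball 0 r \<Longrightarrow>
       norm (cjacobian h z *v v) \<le> K * norm v"
    "\<And>(h :: complex ^ 'n \<Rightarrow> complex ^ 'n) z w. h \<in> class_M \<Longrightarrow> z \<in> cball 0 r \<Longrightarrow> w \<in> cball 0 r \<Longrightarrow>
       norm (h w - h z - cjacobian h z *v (w - z)) \<le> K * (norm (w - z))\<^sup>2"
proof -
  define r' where "r' = (1 + r) / 2"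
  have r': "r < r'" "r' < 1" using r by (simp_all add: r'_def)
  define M where "M = 8 / (1 - r')\<^sup>2"
  have M: "norm (h x) \<le> M" if "h \<in> class_M" "x \<in> cball 0 r'" for h :: "complex ^ 'n \<Rightarrow> complex ^ 'n" and x
    unfolding M_def by (rule class_M_bound) (use that r' in auto)
  have M0: "M > 0" using r' by (simp add: M_def)
  define K where "K = M + M / (r' - r) + 4 * M / (r' - r)\<^sup>2"
  have K: "M \<le> K" "M / (r' - r) \<le> K" "4 * M / (r' - r)\<^sup>2 \<le> K" "0 < K"
    using M0 r' by (simp_all add: K_def add_pos_nonneg)
  show thesis
  proof (rule that[OF K(4)])
    fix h :: "complex ^ 'n \<Rightarrow> complex ^ 'n" and z w v :: "complex ^ 'n" assume h: "h \<in> class_M" and z: "z \<in> cball 0 r"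
    note hol = class_MD(1)[OF h]
    show "norm (h z) \<le> K" using M[OF h, of z] z r' K by force
    show "norm (cjacobian h z *v v) \<le> K * norm v"
      using order_trans[OF cjacobian_bound[OF hol r' M[OF h] z] mult_right_mono[OF K(2)]] by simp
    assume w: "w \<in> cball 0 r"
    show "norm (h z - h w) \<le> K * norm (z - w)"
      using order_trans[OF cauchy_estimate_lipschitz[OF hol r' M[OF h] z w] mult_right_mono[OF K(2)]] by simp
    show "norm (h w - h z - cjacobian h z *v (w - z)) \<le> K * (norm (w - z))\<^sup>2"
      using order_trans[OF cauchy_estimate_second_order[OF hol r' M[OF h] z w] mult_right_mono[OF K(3)]] by simp
  qed
qed

text \<open>Supplies a filler for the times at which a Herglotz field is not in the class.\<close>

lemma neg_id_class_M: "on_ball (\<lambda>z. - z) \<in> class_M"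
proof -
  have d: "((\<lambda>z. - z) has_derivative (\<lambda>v. (- mat 1 :: complex ^ 'n ^ 'n) *v v)) (at z)" for z
    by (rule has_derivative_eq_rhs[OF has_derivative_minus[OF has_derivative_ident]])
       (simp add: fun_eq_iff matrix_vector_mult_minus)
  have hol: "holo_on (ball 0 1) (\<lambda>z :: complex ^ 'n. - z)" by (rule holo_onI) (use d in blast)
  have J: "cjacobian (on_ball (\<lambda>z :: complex ^ 'n. - z)) 0 = - mat 1"
  proof -
    have "cjacobian (on_ball (\<lambda>z :: complex ^ 'n. - z)) 0 = cjacobian (\<lambda>z. - z) 0"
      by (rule holo_on_transform(2)[OF hol open_ball]) (simp_all add: on_ball_def)
    then show ?thesis using cjacobian_eq[OF d[of 0]] by simp
  qed
  show ?thesis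
    unfolding class_M_def Re_hermitian using on_ball_hol[OF hol] J by (auto simp: on_ball_def)
qed

section \<open>The flow of a Herglotz vector field\<close>

lemma AE_lebesgue_on_iff_negligible:
  fixes S :: "'a::euclidean_space set"
  assumes "S \<in> sets lebesgue"
  shows "(AE t in lebesgue_on S. P t) \<longleftrightarrow> (\<exists>N. negligible N \<and> (\<forall>t\<in>S - N. P t))"
proof -
  have "(AE t in lebesgue_on S. P t) \<longleftrightarrow> (AE t in lebesgue. t \<in> S \<longrightarrow> P t)"
    using assms by (intro AE_restrict_space_iff) auto
  also have "\<dots> \<longleftrightarrow> (\<exists>N\<in>null_sets lebesgue. {t \<in> space lebesgue. \<not> (t \<in> S \<longrightarrow> P t)} \<subseteq> N)"
    by (rule eventually_ae_filter)
  also have "\<dots> \<longleftrightarrow> (\<exists>N. negligible N \<and> (\<forall>t\<in>S - N. P t))"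
    by (auto simp: negligible_iff_null_sets)
  finally show ?thesis .
qed

text \<open>A normalised Herglotz field: the conditions hold at every real time, negative ones
  included. No null set has to be carried along, and time shifts stay within the notion.\<close>

definition class_M_field :: "(complex ^ 'n \<Rightarrow> real \<Rightarrow> complex ^ 'n) \<Rightarrow> bool" where
  "class_M_field G \<longleftrightarrow> (\<forall>z \<in> ball 0 1. G z \<in> borel_measurable lebesgue) \<and>
     (\<forall>t. on_ball (\<lambda>z. G z t) \<in> class_M)"

text \<open>One null set serves all points of the ball, so the two fields can be exchanged along any
  trajectory.\<close>

definition AE_equal_fields :: "(complex ^ 'n \<Rightarrow> real \<Rightarrow> complex ^ 'n) \<Rightarrow> (complex ^ 'n \<Rightarrow> real \<Rightarrow> complex ^ 'n) \<Rightarrow> bool" where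
  "AE_equal_fields G H \<longleftrightarrow> (\<exists>N. negligible N \<and> (\<forall>t>0. t \<notin> N \<longrightarrow> (\<forall>z\<in>ball 0 1. G z t = H z t)))"

lemma on_ball_eq: "z \<in> ball 0 1 \<Longrightarrow> on_ball f z = f z"
  by (simp add: on_ball_def)

lemma on_ball_cong: "(\<And>z. z \<in> ball 0 1 \<Longrightarrow> f z = g z) \<Longrightarrow> on_ball f = on_ball g"
  by (auto simp: on_ball_def)

lemma class_M_field_herglotz:
  assumes "class_M_field G"
  shows "herglotz_field G"
  using assms unfolding class_M_field_def herglotz_field_def
  by (auto intro: measurable_restrict_space1)

lemma herglotz_field_normalize:
  assumes "herglotz_field G"
  obtains H where "class_M_field H" "AE_equal_fields G H"
proof -
  have "AE t in lebesgue_on {0<..}. on_ball (\<lambda>z. G z t) \<in> class_M"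
    using assms unfolding herglotz_field_def by blast
  then have "\<exists>N. negligible N \<and> (\<forall>t\<in>{0<..} - N. on_ball (\<lambda>z. G z t) \<in> class_M)"
    by (subst (asm) AE_lebesgue_on_iff_negligible) simp_all
  then obtain N where N: "negligible N" "\<And>t. t \<in> {0<..} - N \<Longrightarrow> on_ball (\<lambda>z. G z t) \<in> class_M"
    by blast
  define P where "P = {0<..} - N"
  have P: "P \<in> sets lebesgue" using negligible_imp_sets[OF N(1)] unfolding P_def by (intro sets.Diff) simp_all
  define H where "H = (\<lambda>z t. if t \<in> P then G z t else - z)"
  show thesis
  proof (rule that)
    show "AE_equal_fields G H" unfolding AE_equal_fields_def
      by (rule exI[of _ N]) (use N(1) in \<open>auto simp: H_def P_def\<close>)
    have "H z \<in> borel_measurable lebesgue" if "z \<in> ball 0 1" for z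
    proof -
      have "(\<lambda>t. if t \<in> {0<..} then G z t else 0) \<in> borel_measurable lebesgue"
        using assms that unfolding herglotz_field_def by (subst borel_measurable_if) auto
      then have "(\<lambda>t. if t \<in> P then (if t \<in> {0<..} then G z t else 0) else - z) \<in> borel_measurable lebesgue"
        by (rule measurable_If_set) (use P in auto)
      moreover have "H z = (\<lambda>t. if t \<in> P then (if t \<in> {0<..} then G z t else 0) else - z)"
        by (rule ext) (simp add: H_def P_def)
      ultimately show ?thesis by simp
    qed
    moreover have "on_ball (\<lambda>z. H z t) \<in> class_M" for t
    proof (cases "t \<in> P")
      case True then show ?thesis using N(2)[of t] by (simp add: H_def P_def)
    next
      case False then show ?thesis using neg_id_class_M by (simp add: H_def)
    qed
    ultimately show "class_M_field H" unfolding class_M_field_def by blast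
  qed
qed

lemma class_M_field_bounds:
  assumes r: "0 \<le> r" "r < 1"
  obtains K where "0 < K"
    "\<And>(G :: complex ^ 'n \<Rightarrow> real \<Rightarrow> complex ^ 'n) t z. class_M_field G \<Longrightarrow> z \<in> cball 0 r \<Longrightarrow> norm (G z t) \<le> K"
    "\<And>(G :: complex ^ 'n \<Rightarrow> real \<Rightarrow> complex ^ 'n) t z w. class_M_field G \<Longrightarrow> z \<in> cball 0 r \<Longrightarrow> w \<in> cball 0 r \<Longrightarrow>
       norm (G z t - G w t) \<le> K * norm (z - w)"
    "\<And>(G :: complex ^ 'n \<Rightarrow> real \<Rightarrow> complex ^ 'n) t z v. class_M_field G \<Longrightarrow> z \<in> cball 0 r \<Longrightarrow>
       norm (cjacobian (on_ball (\<lambda>z. G z t)) z *v v) \<le> K * norm v"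
    "\<And>(G :: complex ^ 'n \<Rightarrow> real \<Rightarrow> complex ^ 'n) t z w. class_M_field G \<Longrightarrow> z \<in> cball 0 r \<Longrightarrow> w \<in> cball 0 r \<Longrightarrow>
       norm (G w t - G z t - cjacobian (on_ball (\<lambda>z. G z t)) z *v (w - z)) \<le> K * (norm (w - z))\<^sup>2"
proof -
  obtain K where K: "0 < K"
    "\<And>(h :: complex ^ 'n \<Rightarrow> complex ^ 'n) z. h \<in> class_M \<Longrightarrow> z \<in> cball 0 r \<Longrightarrow> norm (h z) \<le> K"
    "\<And>(h :: complex ^ 'n \<Rightarrow> complex ^ 'n) z w. h \<in> class_M \<Longrightarrow> z \<in> cball 0 r \<Longrightarrow> w \<in> cball 0 r \<Longrightarrow>
       norm (h z - h w) \<le> K * norm (z - w)"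
    "\<And>(h :: complex ^ 'n \<Rightarrow> complex ^ 'n) z v. h \<in> class_M \<Longrightarrow> z \<in> cball 0 r \<Longrightarrow>
       norm (cjacobian h z *v v) \<le> K * norm v"
    "\<And>(h :: complex ^ 'n \<Rightarrow> complex ^ 'n) z w. h \<in> class_M \<Longrightarrow> z \<in> cball 0 r \<Longrightarrow> w \<in> cball 0 r \<Longrightarrow>
       norm (h w - h z - cjacobian h z *v (w - z)) \<le> K * (norm (w - z))\<^sup>2"
    using class_M_uniform_bounds[OF r, where 'n='n] by blast
  have ob: "on_ball (\<lambda>z. G z t) z = G z t" if "z \<in> cball 0 r" for G :: "complex ^ 'n \<Rightarrow> real \<Rightarrow> complex ^ 'n" and z t
    using that r by (intro on_ball_eq) simp
  show thesis
  proof (rule that[OF K(1)])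
    fix G :: "complex ^ 'n \<Rightarrow> real \<Rightarrow> complex ^ 'n" and t and z w v :: "complex ^ 'n"
    assume G: "class_M_field G" and z: "z \<in> cball 0 r"
    have M: "on_ball (\<lambda>z. G z t) \<in> class_M" using G unfolding class_M_field_def by blast
    show "norm (G z t) \<le> K" using K(2)[OF M z] ob[OF z, of G t] by simp
    show "norm (cjacobian (on_ball (\<lambda>z. G z t)) z *v v) \<le> K * norm v" by (rule K(4)[OF M z])
    assume w: "w \<in> cball 0 r"
    show "norm (G z t - G w t) \<le> K * norm (z - w)" 
      using K(3)[OF M z w] ob[OF z, of G t] ob[OF w, of G t] by simp
    show "norm (G w t - G z t - cjacobian (on_ball (\<lambda>z. G z t)) z *v (w - z)) \<le> K * (norm (w - z))\<^sup>2"
      using K(5)[OF M z w] ob[OF z, of G t] ob[OF w, of G t] by simp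
  qed
qed

lemma class_M_field_inner:
  assumes G: "class_M_field G" and z: "norm z < 1"
  shows "G z t \<bullet> z \<le> 0" and "(G z t \<bullet> z) * (1 + norm z) \<le> - (norm z)\<^sup>2 * (1 - norm z)"
proof -
  have M: "on_ball (\<lambda>z. G z t) \<in> class_M" using G unfolding class_M_field_def by blast
  show "G z t \<bullet> z \<le> 0" using class_MD(4)[OF M, of z] z by (simp add: on_ball_eq)
  show "(G z t \<bullet> z) * (1 + norm z) \<le> - (norm z)\<^sup>2 * (1 - norm z)"
    using class_M_hermitian_bounds(2)[OF M z] z by (simp add: on_ball_eq)
qed

lemma class_M_field_continuous:
  assumes "class_M_field G"
  shows "continuous_on (ball 0 1) (\<lambda>z. G z t)"
proof -
  have "on_ball (\<lambda>z. G z t) \<in> class_M" using assms unfolding class_M_field_def by blast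
  then have "continuous_on (ball 0 1) (on_ball (\<lambda>z. G z t))"
    using class_MD(1) holo_on_continuous by blast
  then show ?thesis by (rule continuous_on_eq) (simp add: on_ball_eq)
qed

lemma class_M_field_along:
  assumes "class_M_field G" "continuous_on UNIV u" "\<And>t. u t \<in> ball 0 1"
  shows "(\<lambda>t. G (u t) t) \<in> borel_measurable lebesgue"
  by (rule borel_measurable_along_continuous[where S="ball 0 1" and X=G and u=u])
     (use assms class_M_field_continuous[OF assms(1)] in \<open>auto simp: class_M_field_def\<close>)

section \<open>Trajectories in the ball: existence, uniqueness and the resulting flow\<close>

lemma closest_point_cball_outside:
  fixes u :: "'a::euclidean_space"
  assumes "0 \<le> r" "r < norm u"
  shows "closest_point (cball 0 r) u = (r / norm u) *\<^sub>R u"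
proof (rule closest_point_unique[symmetric])
  have u: "norm u > 0" using assms by linarith
  show "(r / norm u) *\<^sub>R u \<in> cball 0 r" using assms u by simp
  have "u - (r / norm u) *\<^sub>R u = (1 - r / norm u) *\<^sub>R u" by (simp add: algebra_simps)
  then have "dist u ((r / norm u) *\<^sub>R u) = \<bar>1 - r / norm u\<bar> * norm u"
    by (simp only: dist_norm norm_scaleR)
  also have "\<bar>1 - r / norm u\<bar> = 1 - r / norm u" using assms u by simp
  also have "(1 - r / norm u) * norm u = norm u - r" using u by (simp add: left_diff_distrib)
  finally have d: "dist u ((r / norm u) *\<^sub>R u) = norm u - r" .
  show "\<forall>z\<in>cball 0 r. dist u ((r / norm u) *\<^sub>R u) \<le> dist u z"
  proof
    fix z :: 'a assume "z \<in> cball 0 r"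
    then show "dist u ((r / norm u) *\<^sub>R u) \<le> dist u z"
      unfolding d using norm_triangle_ineq2[of u z] by (simp add: dist_norm)
  qed
qed auto

text \<open>The field frozen outside \<open>cball 0 r\<close> is globally Lipschitz, and its solutions starting in
  \<open>cball 0 r\<close> never leave this ball, so they solve the original equation.\<close>

lemma truncated_field_lipschitz:
  fixes G :: "complex ^ 'n \<Rightarrow> real \<Rightarrow> complex ^ 'n"
  assumes r: "0 \<le> r" "r < 1"
  obtains K where "0 < K" "\<And>G :: complex ^ 'n \<Rightarrow> real \<Rightarrow> complex ^ 'n.
    class_M_field G \<Longrightarrow> lipschitz_field K 0 (\<lambda>z t. G (closest_point (cball 0 r) z) t)"
proof -
  obtain K where K: "0 < K"
    "\<And>(G :: complex ^ 'n \<Rightarrow> real \<Rightarrow> complex ^ 'n) t z w. class_M_field G \<Longrightarrow> z \<in> cball 0 r \<Longrightarrow> w \<in> cball 0 r \<Longrightarrow>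
       norm (G z t - G w t) \<le> K * norm (z - w)"
    using class_M_field_bounds[OF r, where 'n='n] by metis
  have cp: "closest_point (cball 0 r) z \<in> cball 0 r" for z :: "complex ^ 'n"
    by (rule closest_point_in_set) (use r in auto)
  have cpb: "closest_point (cball 0 r) z \<in> ball 0 1" for z :: "complex ^ 'n"
    using cp[of z] r by simp
  show thesis
  proof (rule that[OF K(1)])
    fix G :: "complex ^ 'n \<Rightarrow> real \<Rightarrow> complex ^ 'n" assume G: "class_M_field G"
    have "closest_point (cball 0 r) (0 :: complex ^ 'n) = 0"
      by (rule closest_point_self) (use r in simp)
    moreover have "G 0 t = 0" for t
      using class_MD(2)[of "on_ball (\<lambda>z. G z t)"] G by (simp add: class_M_field_def on_ball_def)
    moreover have "norm (G (closest_point (cball 0 r) z) t - G (closest_point (cball 0 r) w) t) \<le> K * norm (z - w)" for z w t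
    proof -
      have "norm (G (closest_point (cball 0 r) z) t - G (closest_point (cball 0 r) w) t)
          \<le> K * norm (closest_point (cball 0 r) z - closest_point (cball 0 r) w)"
        by (rule K(2)[OF G cp cp])
      also have "\<dots> \<le> K * norm (z - w)"
        using closest_point_lipschitz[of "cball 0 r" z w] r K(1) by (intro mult_left_mono) (auto simp: dist_norm)
      finally show ?thesis .
    qed
    ultimately show "lipschitz_field K 0 (\<lambda>z t. G (closest_point (cball 0 r) z) t)"
      unfolding lipschitz_field_def using K(1) cpb G by (auto simp: class_M_field_def)
  qed
qed

lemma AE_solution_cong:
  assumes "AE_solution X u" "negligible N" "\<And>t. 0 < t \<Longrightarrow> t \<notin> N \<Longrightarrow> X (u t) t = Y (u t) t"
  shows "AE_solution Y u"
proof -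
  obtain M where "negligible M" "\<And>t. 0 < t \<Longrightarrow> t \<notin> M \<Longrightarrow> (u has_vector_derivative X (u t) t) (at t)"
    using assms(1) unfolding AE_solution_def by blast
  note M = this
  have "negligible (M \<union> N)" using M(1) assms(2) by simp
  moreover have "(u has_vector_derivative Y (u t) t) (at t)" if "0 < t" "t \<notin> M \<union> N" for t
    using M(2)[of t] assms(3)[of t] that by auto
  ultimately show ?thesis using assms(1) unfolding AE_solution_def by blast
qed

lemma AE_solution_norm_le:
  assumes u: "AE_solution X u" and st: "0 \<le> s" "s \<le> t"
    and neg: "\<And>\<tau>. s < \<tau> \<Longrightarrow> u \<tau> \<bullet> X (u \<tau>) \<tau> \<le> 0"
  shows "norm (u t) \<le> norm (u s)"
proof -
  obtain L where L: "L-lipschitz_on {0..t} u" using u unfolding AE_solution_def by blast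
  have lip: "L-lipschitz_on {s..t} u" by (rule lipschitz_on_subset[OF L]) (use st in auto)
  obtain N where N: "negligible N" "\<And>t. 0 < t \<Longrightarrow> t \<notin> N \<Longrightarrow> (u has_vector_derivative X (u t) t) (at t)"
    using AE_solution_derivativeE[OF u] by blast
  have "(norm (u t))\<^sup>2 \<le> exp (0 * (t - s)) * ((norm (u s))\<^sup>2 + 0 * (t - s))"
  proof (rule AE_gronwall_norm[OF lip st(2) N(1)])
    fix \<tau> assume "\<tau> \<in> {s<..<t} - N"
    then show "\<exists>D. (u has_vector_derivative D) (at \<tau>) \<and> 2 * (u \<tau> \<bullet> D) \<le> 0 * (norm (u \<tau>))\<^sup>2 + 0"
      using N(2)[of \<tau>] neg[of \<tau>] st by (intro exI[of _ "X (u \<tau>) \<tau>"]) auto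
  qed simp
  then have "(norm (u t))\<^sup>2 \<le> (norm (u s))\<^sup>2" by simp
  then show ?thesis by (rule power2_le_imp_le) simp
qed

lemma class_M_field_solution_exists:
  assumes G: "class_M_field G" and z: "norm z < 1"
  obtains u where "u 0 = z" "AE_solution G u" "\<And>t. 0 \<le> t \<Longrightarrow> norm (u t) \<le> norm z"
proof -
  define r where "r = norm z"
  have r: "0 \<le> r" "r < 1" using z by (simp_all add: r_def)
  let ?X = "\<lambda>z t. G (closest_point (cball 0 r) z) t"
  obtain K where "lipschitz_field K 0 ?X" using truncated_field_lipschitz[OF r] G by metis
  then obtain u where u: "u 0 = z" "AE_solution ?X u" using lipschitz_field_solution by blast
  \<comment> \<open>Outside \<open>cball 0 r\<close> the nearest point is
    \<open>c *\<^sub>R u \<tau>\<close>. For \<open>c > 0\<close> the product of the field there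
    with \<open>u \<tau>\<close> has the sign of its product with
    \<open>c *\<^sub>R u \<tau>\<close>, which the class makes nonpositive; for \<open>r = 0\<close>
    the field vanishes there.\<close>
  have "u \<tau> \<bullet> ?X (u \<tau>) \<tau> \<le> 0" for \<tau>
  proof (cases "norm (u \<tau>) \<le> r")
    case True
    then have "closest_point (cball 0 r) (u \<tau>) = u \<tau>" by (intro closest_point_self) simp
    then show ?thesis using class_M_field_inner(1)[OF G, of "u \<tau>" \<tau>] True r by (simp add: inner_commute)
  next
    case False
    define c where "c = r / norm (u \<tau>)"
    have cp: "closest_point (cball 0 r) (u \<tau>) = c *\<^sub>R u \<tau>"
      unfolding c_def using False r by (intro closest_point_cball_outside) auto
    show ?thesis
    proof (cases "r = 0")
      case True
      then have "G (c *\<^sub>R u \<tau>) \<tau> = 0"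
        using class_MD(2)[of "on_ball (\<lambda>z. G z \<tau>)"] G by (simp add: class_M_field_def on_ball_def c_def)
      then show ?thesis unfolding cp by simp
    next
      case False
      then have c: "c > 0" using r \<open>\<not> norm (u \<tau>) \<le> r\<close> unfolding c_def by (intro divide_pos_pos) linarith+
      have "norm (c *\<^sub>R u \<tau>) < 1" using r \<open>\<not> norm (u \<tau>) \<le> r\<close> by (simp add: c_def)
      from class_M_field_inner(1)[OF G this, of \<tau>]
      have "c * (G (c *\<^sub>R u \<tau>) \<tau> \<bullet> u \<tau>) \<le> 0" by simp
      then show ?thesis unfolding cp using c by (simp add: mult_le_0_iff inner_commute)
    qed
  qed
  then have bd: "norm (u t) \<le> norm z" if "0 \<le> t" for t
    using AE_solution_norm_le[OF u(2) order_refl that] u(1) by simp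
  have "AE_solution G u"
    by (rule AE_solution_cong[OF u(2) negligible_empty])
       (use bd r_def in \<open>simp add: closest_point_self\<close>)
  then show thesis using that u(1) bd by blast
qed

lemma class_M_field_solution_norm_le:
  assumes G: "class_M_field G" and u: "AE_solution G u" "\<And>t. 0 \<le> t \<Longrightarrow> norm (u t) < 1" and st: "0 \<le> s" "s \<le> t"
  shows "norm (u t) \<le> norm (u s)"
  by (rule AE_solution_norm_le[OF u(1) st]) (use class_M_field_inner(1)[OF G] u(2) st in \<open>auto simp: inner_commute\<close>)

text \<open>The norm does not increase along a solution, so both curves remain in the ball given by
  the initial norm. There they solve the truncated, globally Lipschitz equation, whose solutions are
  unique.\<close>

lemma class_M_field_solution_unique:
  assumes G: "class_M_field G" and u: "AE_solution G u" "\<And>t. 0 \<le> t \<Longrightarrow> norm (u t) < 1"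
    and v: "AE_solution G v" "\<And>t. 0 \<le> t \<Longrightarrow> norm (v t) < 1" and eq: "u 0 = v 0" and t: "0 \<le> t"
  shows "u t = v t"
proof -
  define r where "r = norm (u 0)"
  have r: "0 \<le> r" "r < 1" using u(2)[of 0] by (simp_all add: r_def)
  let ?X = "\<lambda>z t. G (closest_point (cball 0 r) z) t"
  obtain K where K: "lipschitz_field K 0 ?X" using truncated_field_lipschitz[OF r] G by metis
  have 1: "AE_solution ?X u"
    by (rule AE_solution_cong[OF u(1) negligible_empty])
       (use class_M_field_solution_norm_le[OF G u order_refl] r_def in \<open>simp add: closest_point_self\<close>)
  have 2: "AE_solution ?X v"
    by (rule AE_solution_cong[OF v(1) negligible_empty])
       (use class_M_field_solution_norm_le[OF G v order_refl] r_def eq in \<open>simp add: closest_point_self\<close>)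
  show ?thesis by (rule AE_solution_unique[OF K 1 2 eq t])
qed

lemma abs_cont_on_interval_continuous:
  assumes "abs_cont_on_interval a b u"
  shows "continuous_on {a..b} u"
  unfolding continuous_on_iff
proof (intro ballI allI impI)
  fix s and e :: real assume s: "s \<in> {a..b}" and e: "0 < e"
  obtain \<delta> where \<delta>: "\<delta> > 0" "\<And>D. finite D \<Longrightarrow> (\<forall>(c, d)\<in>D. a \<le> c \<and> c \<le> d \<and> d \<le> b) \<Longrightarrow>
        disjoint_family_on (\<lambda>(a, b). {a<..<b}) D \<Longrightarrow> (\<Sum>(a, b)\<in>D. b - a) < \<delta> \<Longrightarrow>
        (\<Sum>(a, b)\<in>D. norm (u b - u a)) < e"
    using assms e unfolding abs_cont_on_interval_def by meson
  have *: "norm (u d - u c) < e" if "a \<le> c" "c \<le> d" "d \<le> b" "d - c < \<delta>" for c d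
    using \<delta>(2)[of "{(c, d)}"] that by (simp add: disjoint_family_on_def)
  show "\<exists>d>0. \<forall>x'\<in>{a..b}. dist x' s < d \<longrightarrow> dist (u x') (u s) < e"
  proof (intro exI[of _ \<delta>] conjI ballI impI \<delta>(1))
    fix t assume t: "t \<in> {a..b}" "dist t s < \<delta>"
    show "dist (u t) (u s) < e"
    proof (cases "s \<le> t")
      case True then show ?thesis using *[of s t] s t by (simp add: dist_norm)
    next
      case False then show ?thesis using *[of t s] s t by (simp add: dist_norm norm_minus_commute)
    qed
  qed
qed

text \<open>On \<open>{0..T}\<close> a trajectory is continuous and hence stays in a ball of radius
  less than 1, where \<open>H\<close> is bounded uniformly in time. Integrating the velocity then
  improves absolute continuity to a Lipschitz bound.\<close>

lemma trajectory_imp_AE_solution: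
  assumes H: "class_M_field H" and eq: "AE_equal_fields G H" and traj: "trajectory G z u"
  shows "AE_solution H u" and "u 0 = z" and "\<And>t. 0 \<le> t \<Longrightarrow> norm (u t) < 1"
proof -
  show ub: "norm (u t) < 1" if "0 \<le> t" for t
    using traj that unfolding trajectory_def by auto
  show "u 0 = z" using traj unfolding trajectory_def by blast
  obtain N1 where N1: "negligible N1" "\<And>t. 0 < t \<Longrightarrow> t \<notin> N1 \<Longrightarrow> (\<forall>z\<in>ball 0 1. G z t = H z t)"
    using eq unfolding AE_equal_fields_def by blast
  have "AE t in lebesgue_on {0..}. (u has_vector_derivative G (u t) t) (at t within {0..})"
    using traj unfolding trajectory_def by blast
  then have "\<exists>N. negligible N \<and> (\<forall>t\<in>{0..} - N. (u has_vector_derivative G (u t) t) (at t within {0..}))"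
    by (subst (asm) AE_lebesgue_on_iff_negligible) simp_all
  then obtain N2 where N2: "negligible N2"
    "\<And>t. t \<in> {0..} - N2 \<Longrightarrow> (u has_vector_derivative G (u t) t) (at t within {0..})"
    by blast
  define N where "N = N1 \<union> N2"
  have N: "negligible N" using N1 N2 by (simp add: N_def)
  have der: "(u has_vector_derivative H (u t) t) (at t)" if "0 < t" "t \<notin> N" for t
  proof -
    have "(u has_vector_derivative G (u t) t) (at t within {0..})" using N2(2)[of t] that by (simp add: N_def)
    moreover have "at t within {0..} = at t" using that by (intro at_within_interior) (simp add: interior_real_atLeast)
    moreover have "G (u t) t = H (u t) t" using N1(2)[of t] ub[of t] that by (simp add: N_def)
    ultimately show ?thesis by simp
  qed
  have "\<exists>L. L-lipschitz_on {0..T} u" for T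
  proof (cases "0 \<le> T")
    case False then show ?thesis by (intro exI[of _ 0]) auto
  next
    case True
    have ac: "abs_cont_on_interval 0 T u" using traj True unfolding trajectory_def by blast
    have cont: "continuous_on {0..T} u" by (rule abs_cont_on_interval_continuous[OF ac])
    then have "continuous_on {0..T} (\<lambda>t. norm (u t))" by (intro continuous_intros)
    then obtain t0 where t0: "t0 \<in> {0..T}" "\<And>t. t \<in> {0..T} \<Longrightarrow> norm (u t) \<le> norm (u t0)"
      using continuous_attains_sup[of "{0..T}" "\<lambda>t. norm (u t)"] True by auto
    have r: "0 \<le> norm (u t0)" "norm (u t0) < 1" using ub[of t0] t0(1) by auto
    obtain K where K: "0 < K" "\<And>t z. z \<in> cball 0 (norm (u t0)) \<Longrightarrow> norm (H z t) \<le> K"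
      using class_M_field_bounds[OF r, where 'n='a] H by metis
    have *: "norm (u q - u p) \<le> K * (q - p)" if pq: "0 \<le> p" "p \<le> q" "q \<le> T" for p q
    proof -
      have "((\<lambda>t. H (u t) t) has_integral u q - u p) {p..q}"
      proof (rule fundamental_theorem_of_calculus_abs_cont[OF _ pq(2) N])
        show "abs_cont_on_interval p q u" by (rule abs_cont_on_interval_subset[OF ac pq(1,3)])
        show "(u has_vector_derivative H (u t) t) (at t)" if "t \<in> {p<..<q} - N" for t
          using der[of t] that pq by auto
      qed
      then have "norm (u q - u p) \<le> K * measure lborel (cbox p q)"
        by (intro has_integral_bound) (use K t0 pq in \<open>auto intro!: K(2)\<close>)
      then show ?thesis using pq by simp
    qed
    have "K-lipschitz_on {0..T} u" by (rule lipschitz_on_intervalI) (use K * in auto)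
    then show ?thesis by blast
  qed
  with N der show "AE_solution H u" unfolding AE_solution_def by blast
qed

lemma AE_solution_imp_trajectory:
  assumes eq: "AE_equal_fields G H" and u: "AE_solution H u" "\<And>t. 0 \<le> t \<Longrightarrow> norm (u t) < 1"
  shows "trajectory G (u 0) u"
  unfolding trajectory_def
proof (intro conjI allI impI refl)
  show "u t \<in> ball 0 1" if "0 \<le> t" for t using u(2)[OF that] by simp
  show "abs_cont_on_interval 0 T u" for T
    using u(1) lipschitz_imp_abs_cont unfolding AE_solution_def by blast
  obtain N1 where N1: "negligible N1" "\<And>t. 0 < t \<Longrightarrow> t \<notin> N1 \<Longrightarrow> (\<forall>z\<in>ball 0 1. G z t = H z t)"
    using eq unfolding AE_equal_fields_def by blast
  obtain N2 where N2: "negligible N2" "\<And>t. 0 < t \<Longrightarrow> t \<notin> N2 \<Longrightarrow> (u has_vector_derivative H (u t) t) (at t)"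
    using AE_solution_derivativeE[OF u(1)] by blast
  show "AE t in lebesgue_on {0..}. (u has_vector_derivative G (u t) t) (at t within {0..})"
  proof (subst AE_lebesgue_on_iff_negligible, simp, intro exI[of _ "N1 \<union> N2 \<union> {0}"] conjI ballI)
    show "negligible (N1 \<union> N2 \<union> {0})" using N1 N2 by simp
    fix t assume t: "t \<in> {0..} - (N1 \<union> N2 \<union> {0})"
    then have "(u has_vector_derivative H (u t) t) (at t)" using N2(2)[of t] by auto
    moreover have "G (u t) t = H (u t) t" using N1(2)[of t] u(2)[of t] t by auto
    ultimately show "(u has_vector_derivative G (u t) t) (at t within {0..})"
      by (simp add: has_vector_derivative_at_within)
  qed
qed

text \<open>Evaluates the definite description: each trajectory of \<open>G\<close> is a solution
  for the normalised field \<open>H\<close>, and such solutions are unique.\<close>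

lemma flow_eqI:
  assumes H: "class_M_field H" and eq: "AE_equal_fields G H"
    and u: "AE_solution H u" "\<And>t. 0 \<le> t \<Longrightarrow> norm (u t) < 1" and t: "0 \<le> t"
  shows "flow G t (u 0) = u t"
  unfolding flow_def
proof (rule the_equality)
  show "\<exists>v. trajectory G (u 0) v \<and> v t = u t" using AE_solution_imp_trajectory[OF eq u] by blast
  fix w assume "\<exists>v. trajectory G (u 0) v \<and> v t = w"
  then obtain v where v: "trajectory G (u 0) v" "v t = w" by blast
  show "w = u t"
    using class_M_field_solution_unique[OF H trajectory_imp_AE_solution(1,3)[OF H eq v(1)] u _ t]
      trajectory_imp_AE_solution(2)[OF H eq v(1)] v(2) by simp
qed

lemma AE_equal_fields_refl: "AE_equal_fields G G"
  unfolding AE_equal_fields_def by (rule exI[of _ "{}"]) simp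

lemma flow_solution:
  assumes H: "class_M_field H" and z: "norm z < 1"
  shows "AE_solution H (\<lambda>t. flow H t z)" and "flow H 0 z = z" and "0 \<le> t \<Longrightarrow> norm (flow H t z) \<le> norm z"
proof -
  obtain u where u: "u 0 = z" "AE_solution H u" "\<And>t. 0 \<le> t \<Longrightarrow> norm (u t) \<le> norm z"
    using class_M_field_solution_exists[OF H z] by blast
  have u1: "norm (u t) < 1" if "0 \<le> t" for t using u(3)[OF that] z by linarith
  have fl: "flow H t z = u t" if "0 \<le> t" for t
    using flow_eqI[OF H AE_equal_fields_refl u(2) u1 that] u(1) by simp
  show "flow H 0 z = z" "0 \<le> t \<Longrightarrow> norm (flow H t z) \<le> norm z" using fl u by auto
  obtain N where N: "negligible N" "\<And>t. 0 < t \<Longrightarrow> t \<notin> N \<Longrightarrow> (u has_vector_derivative H (u t) t) (at t)"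
    using AE_solution_derivativeE[OF u(2)] by blast
  have "((\<lambda>t. flow H t z) has_vector_derivative H (flow H t z) t) (at t)" if t: "0 < t" "t \<notin> N" for t
  proof -
    have "((\<lambda>t. flow H t z) has_vector_derivative H (u t) t) (at t)"
      by (rule has_vector_derivative_transform_within_open[OF N(2)[OF t], of "{0<..}"]) (use t fl in auto)
    then show ?thesis using fl t by simp
  qed
  moreover have "\<exists>L. L-lipschitz_on {0..T} (\<lambda>t. flow H t z)" for T
  proof -
    obtain L where "L-lipschitz_on {0..T} u" using u(2) unfolding AE_solution_def by blast
    then have "L-lipschitz_on {0..T} (\<lambda>t. flow H t z)"
      by (rule lipschitz_on_transform) (simp add: fl)
    then show ?thesis by blast
  qed
  ultimately show "AE_solution H (\<lambda>t. flow H t z)" unfolding AE_solution_def using N(1) by blast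
qed

lemma flow_AE_equal:
  assumes H: "class_M_field H" and eq: "AE_equal_fields G H" and z: "norm z < 1" and t: "0 \<le> t"
  shows "flow G t z = flow H t z"
proof -
  have "norm (flow H t z) < 1" if "0 \<le> t" for t using flow_solution(3)[OF H z that] z by linarith
  from flow_eqI[OF H eq flow_solution(1)[OF H z] this t] show ?thesis
    by (simp add: flow_solution(2)[OF H z])
qed

lemma negligible_shift:
  fixes s :: real
  assumes "negligible N"
  shows "negligible {t. s + t \<in> N}"
proof -
  have "{t. s + t \<in> N} = (+) (- s) ` N"
    by (force simp: image_iff)
  then show ?thesis using negligible_translation[OF assms] by metis
qed

lemma class_M_field_shift:
  assumes "class_M_field G"
  shows "class_M_field (\<lambda>z t. G z (s + t))"
proof -
  have T: "(\<lambda>t. s + t) \<in> lebesgue \<rightarrow>\<^sub>M lebesgue" for s :: real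
    using lebesgue_affine_measurable[of "\<lambda>_. 1" s] by simp
  have "(\<lambda>t. G z (s + t)) \<in> borel_measurable lebesgue" if "z \<in> ball 0 1" for z
    using assms that measurable_compose[OF T] unfolding class_M_field_def by blast
  with assms show ?thesis unfolding class_M_field_def by blast
qed

lemma flow_norm_less_1:
  assumes "class_M_field G" "norm z < 1" "0 \<le> t"
  shows "norm (flow G t z) < 1"
  using flow_solution(3)[OF assms] assms(2) by linarith

text \<open>Restarting the flow at time \<open>s\<close> solves the shifted equation with initial
  value \<open>flow G s z\<close>, and uniqueness identifies the two sides.\<close>

lemma flow_shift:
  assumes G: "class_M_field G" and z: "norm z < 1" and st: "0 \<le> s" "0 \<le> t"
  shows "flow G (s + t) z = flow (\<lambda>z t. G z (s + t)) t (flow G s z)"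
proof -
  let ?H = "\<lambda>z t. G z (s + t)"
  let ?u = "\<lambda>t. flow G (s + t) z"
  note sol = flow_solution(1)[OF G z]
  obtain N where N: "negligible N"
    "\<And>t. 0 < t \<Longrightarrow> t \<notin> N \<Longrightarrow> ((\<lambda>t. flow G t z) has_vector_derivative G (flow G t z) t) (at t)"
    using AE_solution_derivativeE[OF sol] by blast
  have "AE_solution ?H ?u"
    unfolding AE_solution_def
  proof (intro conjI allI)
    fix T
    obtain L where L: "L-lipschitz_on {0..s + T} (\<lambda>t. flow G t z)" using sol unfolding AE_solution_def by blast
    have "L-lipschitz_on {0..T} ?u"
    proof (rule lipschitz_onI)
      fix p q assume "p \<in> {0..T}" "q \<in> {0..T}"
      then show "dist (?u p) (?u q) \<le> L * dist p q"
        using lipschitz_onD[OF L, of "s + p" "s + q"] st by (simp add: dist_real_def)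
    qed (use L lipschitz_on_nonneg in blast)
    then show "\<exists>L. L-lipschitz_on {0..T} ?u" by blast
  next
    show "\<exists>N. negligible N \<and> (\<forall>t. 0 < t \<and> t \<notin> N \<longrightarrow> (?u has_vector_derivative ?H (?u t) t) (at t))"
    proof (intro exI[of _ "{t. s + t \<in> N}"] conjI allI impI negligible_shift N(1))
      fix t assume t: "0 < t \<and> t \<notin> {t. s + t \<in> N}"
      have "((\<lambda>t. s + t) has_vector_derivative 1) (at t)" by (auto intro!: derivative_eq_intros)
      from vector_diff_chain_at[OF this N(2)[of "s + t"]] t st
      show "(?u has_vector_derivative ?H (?u t) t) (at t)" by (simp add: o_def)
    qed
  qed
  then have "flow ?H t (?u 0) = ?u t"
    by (rule flow_eqI[OF class_M_field_shift[OF G] AE_equal_fields_refl])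
       (use flow_norm_less_1[OF G z] st in auto)
  then show ?thesis by simp
qed

text \<open>The fields may differ after \<open>T\<close>, so uniqueness for a single field does not
  apply; a comparison on \<open>{0..t}\<close> only sees times at which they agree. This provides
  the common position at the start of a spike.\<close>

lemma flow_cong_upto:
  assumes G: "class_M_field G" and H: "class_M_field H" and z: "norm z < 1"
    and eq: "\<And>t z. 0 < t \<Longrightarrow> t \<le> T \<Longrightarrow> norm z < 1 \<Longrightarrow> G z t = H z t" and t: "0 \<le> t" "t \<le> T"
  shows "flow G t z = flow H t z"
proof -
  have r: "0 \<le> norm z" by simp
  obtain K where K: "0 < K" "\<And>t w v. w \<in> cball 0 (norm z) \<Longrightarrow> v \<in> cball 0 (norm z) \<Longrightarrow>
      norm (G w t - G v t) \<le> K * norm (w - v)"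
    using class_M_field_bounds[OF r z, where 'n='a] G by metis
  let ?u = "\<lambda>t. flow G t z" and ?v = "\<lambda>t. flow H t z"
  obtain L1 L2 where L: "L1-lipschitz_on {0..t} ?u" "L2-lipschitz_on {0..t} ?v"
    using flow_solution(1)[OF G z] flow_solution(1)[OF H z] unfolding AE_solution_def by blast
  obtain N1 where N1: "negligible N1" "\<And>t. 0 < t \<Longrightarrow> t \<notin> N1 \<Longrightarrow> (?u has_vector_derivative G (?u t) t) (at t)"
    using AE_solution_derivativeE[OF flow_solution(1)[OF G z]] by blast
  obtain N2 where N2: "negligible N2" "\<And>t. 0 < t \<Longrightarrow> t \<notin> N2 \<Longrightarrow> (?v has_vector_derivative H (?v t) t) (at t)"
    using AE_solution_derivativeE[OF flow_solution(1)[OF H z]] by blast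
  have "norm (?u t - ?v t) \<le> exp (K * t) * norm (?u 0 - ?v 0)"
  proof (rule AE_compare(1)[OF L t(1)])
    show "negligible (N1 \<union> N2)" using N1 N2 by simp
    fix \<tau> assume \<tau>: "\<tau> \<in> {0<..<t} - (N1 \<union> N2)"
    have "norm (G (?u \<tau>) \<tau> - H (?v \<tau>) \<tau>) = norm (G (?u \<tau>) \<tau> - G (?v \<tau>) \<tau>)"
      using eq[of \<tau> "?v \<tau>"] \<tau> t flow_norm_less_1[OF H z, of \<tau>] by simp
    also have "\<dots> \<le> K * norm (?u \<tau> - ?v \<tau>)"
      using flow_solution(3)[OF G z, of \<tau>] flow_solution(3)[OF H z, of \<tau>] \<tau> by (intro K(2)) auto
    finally show "\<exists>D E. (?u has_vector_derivative D) (at \<tau>) \<and> (?v has_vector_derivative E) (at \<tau>) \<and>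
        norm (D - E) \<le> K * norm (?u \<tau> - ?v \<tau>)"
      using N1(2)[of \<tau>] N2(2)[of \<tau>] \<tau> by (intro exI conjI) auto
  qed (use K in simp)
  then show ?thesis by (simp add: flow_solution(2)[OF G z] flow_solution(2)[OF H z])
qed

section \<open>Differentiability of the flow in the initial value\<close>

lemma has_vector_derivative_difference_quotient:
  fixes f :: "real \<Rightarrow> 'a::real_normed_vector"
  assumes "(f has_vector_derivative D) (at 0)"
  shows "((\<lambda>h. (1 / h) *\<^sub>R (f h - f 0)) \<longlongrightarrow> D) (at 0)"
proof -
  have "((\<lambda>h. norm (f (0 + h) - f 0 - h *\<^sub>R D) / norm h) \<longlongrightarrow> 0) (at 0)"
    using assms unfolding has_vector_derivative_def has_derivative_at by blast
  moreover have "\<forall>\<^sub>F h in at 0. norm (f (0 + h) - f 0 - h *\<^sub>R D) / norm h = norm ((1 / h) *\<^sub>R (f h - f 0) - D)"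
  proof (rule eventually_at_filter[THEN iffD2], rule always_eventually, intro allI impI)
    fix h :: real assume "h \<noteq> 0"
    then have "(1 / h) *\<^sub>R (f h - f 0) - D = (1 / h) *\<^sub>R (f (0 + h) - f 0 - h *\<^sub>R D)"
      by (simp add: scaleR_diff_right)
    then show "norm (f (0 + h) - f 0 - h *\<^sub>R D) / norm h = norm ((1 / h) *\<^sub>R (f h - f 0) - D)"
      by (simp only: norm_scaleR) (simp add: divide_inverse)
  qed
  ultimately have "((\<lambda>h. norm ((1 / h) *\<^sub>R (f h - f 0) - D)) \<longlongrightarrow> 0) (at 0)"
    by (rule Lim_transform_eventually)
  from LIM_zero_cancel[OF tendsto_norm_zero_cancel[OF this]] show ?thesis .
qed

lemma AE_solution_add:
  assumes u: "AE_solution X u" and v: "AE_solution Y v"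
    and eq: "\<And>t. Z (u t + v t) t = X (u t) t + Y (v t) t"
  shows "AE_solution Z (\<lambda>t. u t + v t)"
  unfolding AE_solution_def
proof (intro conjI allI)
  fix T
  obtain L1 L2 where "L1-lipschitz_on {0..T} u" "L2-lipschitz_on {0..T} v"
    using u v unfolding AE_solution_def by blast
  then have "(L1 + L2)-lipschitz_on {0..T} (\<lambda>t. u t + v t)" by (rule lipschitz_on_add)
  then show "\<exists>L. L-lipschitz_on {0..T} (\<lambda>t. u t + v t)" by blast
next
  obtain M where M: "negligible M" "\<And>t. 0 < t \<Longrightarrow> t \<notin> M \<Longrightarrow> (u has_vector_derivative X (u t) t) (at t)"
    using AE_solution_derivativeE[OF u] by blast
  obtain N where N: "negligible N" "\<And>t. 0 < t \<Longrightarrow> t \<notin> N \<Longrightarrow> (v has_vector_derivative Y (v t) t) (at t)"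
    using AE_solution_derivativeE[OF v] by blast
  have "((\<lambda>t. u t + v t) has_vector_derivative Z (u t + v t) t) (at t)" if "0 < t" "t \<notin> M \<union> N" for t
    unfolding eq using that by (intro has_vector_derivative_add M N) auto
  then show "\<exists>N. negligible N \<and> (\<forall>t. 0 < t \<and> t \<notin> N \<longrightarrow>
      ((\<lambda>t. u t + v t) has_vector_derivative Z (u t + v t) t) (at t))"
    using M(1) N(1) by (intro exI[of _ "M \<union> N"]) simp
qed

lemma AE_solution_bounded_linear:
  assumes u: "AE_solution X u" and T: "bounded_linear T" and eq: "\<And>t. Z (T (u t)) t = T (X (u t) t)"
  shows "AE_solution Z (\<lambda>t. T (u t))"
  unfolding AE_solution_def
proof (intro conjI allI)
  fix b
  obtain L where L: "L-lipschitz_on {0..b} u" using u unfolding AE_solution_def by blast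
  obtain K where K: "0 < K" "\<And>x. norm (T x) \<le> norm x * K" using bounded_linear.pos_bounded[OF T] by blast
  have "(K * L)-lipschitz_on {0..b} (\<lambda>t. T (u t))"
  proof (rule lipschitz_onI)
    show "0 \<le> K * L" using K(1) lipschitz_on_nonneg[OF L] by simp
    fix p q assume pq: "p \<in> {0..b}" "q \<in> {0..b}"
    have "dist (T (u p)) (T (u q)) = norm (T (u p - u q))"
      by (simp add: dist_norm linear_diff bounded_linear.linear[OF T])
    also have "\<dots> \<le> norm (u p - u q) * K" by (rule K)
    also have "\<dots> \<le> L * dist p q * K" using lipschitz_onD[OF L pq] K by (simp add: dist_norm)
    finally show "dist (T (u p)) (T (u q)) \<le> K * L * dist p q" by (simp add: mult_ac)
  qed
  then show "\<exists>L. L-lipschitz_on {0..b} (\<lambda>t. T (u t))" by blast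
next
  obtain M where M: "negligible M" "\<And>t. 0 < t \<Longrightarrow> t \<notin> M \<Longrightarrow> (u has_vector_derivative X (u t) t) (at t)"
    using AE_solution_derivativeE[OF u] by blast
  have "((\<lambda>t. T (u t)) has_vector_derivative Z (T (u t)) t) (at t)" if "0 < t" "t \<notin> M" for t
    unfolding eq by (rule bounded_linear.has_vector_derivative[OF T M(2)]) (use that in auto)
  then show "\<exists>N. negligible N \<and> (\<forall>t. 0 < t \<and> t \<notin> N \<longrightarrow>
      ((\<lambda>t. T (u t)) has_vector_derivative Z (T (u t)) t) (at t))"
    using M(1) by blast
qed

lemma bounded_linear_scale_right: "bounded_linear (\<lambda>x :: complex ^ 'n. c *s x)"
  by (rule bounded_linear_intro[where K="norm c"])
     (simp_all add: vec_eq_iff algebra_simps norm_vector_scalar_mult)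

text \<open>The derivative of the flow in the initial value solves the linearised equation
  \<open>v' = d(G(\<cdot>, t)) v\<close> along the trajectory.\<close>

lemma variational_equation_field:
  assumes G: "class_M_field G" and u: "continuous_on UNIV u" "\<And>t. norm (u t) \<le> r" and r: "0 \<le> r" "r < 1"
    and K: "0 < K" "\<And>t z v. z \<in> cball 0 r \<Longrightarrow> norm (cjacobian (on_ball (\<lambda>z. G z t)) z *v v) \<le> K * norm v"
  shows "lipschitz_field K 0 (\<lambda>v t. cjacobian (on_ball (\<lambda>z. G z t)) (u t) *v v)"
  unfolding lipschitz_field_def
proof (intro conjI allI)
  let ?J = "\<lambda>t. cjacobian (on_ball (\<lambda>z. G z t)) (u t)"
  show "norm (?J t *v z - ?J t *v w) \<le> K * norm (z - w)" for t z w
    using K(2)[of "u t" t "z - w"] u(2)[of t] by (simp add: matrix_vector_mult_diff_distrib)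
  \<comment> \<open>The Jacobian along the trajectory is a pointwise limit of difference quotients
    of \<open>G\<close>, each measurable by substitution of continuous curves. The bound
    \<open>d\<close> on the increments keeps the displaced curve in the unit ball.\<close>
  show "(\<lambda>t. ?J t *v v) \<in> borel_measurable lebesgue" for v
  proof -
    define d where "d = (1 - r) / (norm v + 1)"
    have nv: "norm v + 1 > 0" by (simp add: add_nonneg_pos)
    have d: "d > 0" using r nv by (simp add: d_def)
    have dv: "d * norm v < 1 - r" using r nv by (simp add: d_def field_simps)
    define s where "s = (\<lambda>n::nat. d / real (Suc n))"
    have s: "0 < s n" "s n \<le> d" for n using d by (simp_all add: s_def field_simps)
    have inb: "u t + s n *\<^sub>R v \<in> ball 0 1" for t n
    proof -
      have "norm (u t + s n *\<^sub>R v) \<le> norm (u t) + s n * norm v"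
        using norm_triangle_ineq[of "u t" "s n *\<^sub>R v"] s(1)[of n] by simp
      also have "\<dots> \<le> r + d * norm v" using u(2) s(2) by (intro add_mono mult_right_mono) auto
      finally show ?thesis using dv by simp
    qed
    have uin: "u t \<in> ball 0 1" for t using le_less_trans[OF u(2) r(2), of t] by simp
    have slim: "s \<longlonglongrightarrow> 0" unfolding s_def
      using tendsto_mult[OF tendsto_const LIMSEQ_inverse_real_of_nat, of d] by (simp add: divide_inverse)
    show ?thesis
    proof (rule borel_measurable_LIMSEQ_metric)
      show "(\<lambda>t. (1 / s n) *\<^sub>R (G (u t + s n *\<^sub>R v) t - G (u t) t)) \<in> borel_measurable lebesgue" for n
      proof -
        have "(\<lambda>t. G (u t + s n *\<^sub>R v) t) \<in> borel_measurable lebesgue"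
          by (rule class_M_field_along[OF G _ inb]) (intro continuous_intros u)
        moreover have "(\<lambda>t. G (u t) t) \<in> borel_measurable lebesgue"
          by (rule class_M_field_along[OF G u(1) uin])
        ultimately show ?thesis by (intro borel_measurable_scaleR borel_measurable_diff) simp_all
      qed
      fix t
      have M: "on_ball (\<lambda>z. G z t) \<in> class_M" using G unfolding class_M_field_def by blast
      have der: "(on_ball (\<lambda>z. G z t) has_derivative (\<lambda>v. ?J t *v v)) (at (u t))"
        by (rule holo_onD[OF class_MD(1)[OF M] uin])
      have "((\<lambda>x. u t + x *\<^sub>R v) has_vector_derivative v) (at 0)" by (auto intro!: derivative_eq_intros)
      then have "((\<lambda>x. u t + x *\<^sub>R v) has_derivative (\<lambda>x. x *\<^sub>R v)) (at 0)" by (simp add: has_vector_derivative_def)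
      from diff_chain_at[OF this, of "on_ball (\<lambda>z. G z t)" "\<lambda>v. ?J t *v v"] der
      have "((\<lambda>x. on_ball (\<lambda>z. G z t) (u t + x *\<^sub>R v)) has_derivative (\<lambda>x. ?J t *v (x *\<^sub>R v))) (at 0)"
        by (simp add: o_def)
      moreover have "?J t *v (x *\<^sub>R v) = x *\<^sub>R (?J t *v v)" for x
        by (rule linear_scale[OF matrix_vector_mul_linear])
      ultimately have "((\<lambda>x. on_ball (\<lambda>z. G z t) (u t + x *\<^sub>R v)) has_vector_derivative ?J t *v v) (at 0)"
        by (simp add: has_vector_derivative_def)
      then have lim: "((\<lambda>x. (1 / x) *\<^sub>R (on_ball (\<lambda>z. G z t) (u t + x *\<^sub>R v) - on_ball (\<lambda>z. G z t) (u t))) \<longlongrightarrow> ?J t *v v) (at 0)"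
        using has_vector_derivative_difference_quotient[of "\<lambda>x. on_ball (\<lambda>z. G z t) (u t + x *\<^sub>R v)"] by simp
      have "filterlim s (at 0) sequentially"
        unfolding filterlim_at using slim s(1) by (auto simp: less_imp_neq[symmetric])
      from filterlim_compose[OF lim this]
      show "(\<lambda>n. (1 / s n) *\<^sub>R (G (u t + s n *\<^sub>R v) t - G (u t) t)) \<longlonglongrightarrow> ?J t *v v"
        using inb uin by (simp add: on_ball_eq)
    qed
  qed
qed (use K in auto)

text \<open>The remainder \<open>D\<close> has velocity \<open>R\<close> plus the Jacobian applied
  to \<open>D\<close>, where \<open>R\<close> is the Taylor remainder of the field and has norm at
  most \<open>b\<close>, of second order in \<open>w\<close>. Gronwall's inequality makes
  \<open>D t\<close> of second order as well. Linearity of \<open>V\<close> in the initial value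
  holds by uniqueness, and comparison with the zero solution from below makes it injective, hence
  invertible.\<close>

theorem flow_has_derivative:
  fixes G :: "complex ^ 'n \<Rightarrow> real \<Rightarrow> complex ^ 'n"
  assumes G: "class_M_field G" and z: "norm z < 1" and t: "0 \<le> t"
  obtains A where "(flow G t has_derivative (\<lambda>v. A *v v)) (at z)" "invertible A"
proof -
  define r where "r = (norm z + 1) / 2"
  have r: "0 \<le> r" "r < 1" "norm z < r" using z by (simp_all add: r_def)
  obtain K where K: "0 < K"
    "\<And>t z w. z \<in> cball 0 r \<Longrightarrow> w \<in> cball 0 r \<Longrightarrow> norm (G z t - G w t) \<le> K * norm (z - w)"
    "\<And>t z v. z \<in> cball 0 r \<Longrightarrow> norm (cjacobian (on_ball (\<lambda>z. G z t)) z *v v) \<le> K * norm v"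
    "\<And>t z w. z \<in> cball 0 r \<Longrightarrow> w \<in> cball 0 r \<Longrightarrow>
       norm (G w t - G z t - cjacobian (on_ball (\<lambda>z. G z t)) z *v (w - z)) \<le> K * (norm (w - z))\<^sup>2"
    using class_M_field_bounds[OF r(1,2), where 'n='n] G by metis
  define u where "u = (\<lambda>t. flow G (max 0 t) z)"
  have ueq: "u \<tau> = flow G \<tau> z" if "0 \<le> \<tau>" for \<tau> using that by (simp add: u_def)
  have ule: "norm (u \<tau>) \<le> r" for \<tau>
    using flow_solution(3)[OF G z, of "max 0 \<tau>"] r unfolding u_def by simp
  have ucont: "continuous_on UNIV u"
    unfolding u_def
  proof (rule continuous_on_max_0)
    fix T
    obtain L where "L-lipschitz_on {0..T} (\<lambda>t. flow G t z)"
      using AE_solution_lipschitzE[OF flow_solution(1)[OF G z]] .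
    then show "continuous_on {0..T} (\<lambda>t. flow G t z)" by (rule lipschitz_on_continuous_on)
  qed
  let ?J = "\<lambda>t. cjacobian (on_ball (\<lambda>z. G z t)) (u t)"
  let ?X = "\<lambda>v t. ?J t *v v"
  have X: "lipschitz_field K 0 ?X" by (rule variational_equation_field[OF G ucont ule r(1,2) K(1,3)])
  define V where "V = (\<lambda>w. SOME v. v 0 = w \<and> AE_solution ?X v)"
  have V: "V w 0 = w" "AE_solution ?X (V w)" for w
  proof -
    have "\<exists>v. v 0 = w \<and> AE_solution ?X v" by (rule lipschitz_field_solution[OF X, of w]) blast
    from someI_ex[OF this] show "V w 0 = w" "AE_solution ?X (V w)" by (simp_all add: V_def)
  qed
  have sol0: "AE_solution ?X (\<lambda>_. 0)"
    unfolding AE_solution_def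
  proof (intro conjI allI exI[of _ "{}"] impI)
    show "\<exists>L. L-lipschitz_on {0..T} (\<lambda>_. 0 :: complex ^ 'n)" for T
      by (rule exI[of _ 0], rule lipschitz_onI) simp_all
  qed simp_all
  have Vlo: "exp (- (K * t)) * norm w \<le> norm (V w t)" for w
    using AE_solution_compare(2)[OF X V(2) sol0 t, of w] V(1) by simp
  have Vadd: "V (w1 + w2) t = V w1 t + V w2 t" for w1 w2
  proof (rule AE_solution_unique[OF X V(2) _ _ t])
    show "AE_solution ?X (\<lambda>t. V w1 t + V w2 t)"
      by (rule AE_solution_add[OF V(2) V(2)]) (simp add: matrix_vector_right_distrib)
  qed (simp add: V)
  have Vscale: "V (c *s w) t = c *s V w t" for c w
  proof (rule AE_solution_unique[OF X V(2) _ _ t])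
    show "AE_solution ?X (\<lambda>t. c *s V w t)"
      by (rule AE_solution_bounded_linear[OF V(2) bounded_linear_scale_right]) (simp add: vector_scalar_commute)
  qed (simp add: V)
  define A where "A = matrix (\<lambda>w. V w t)"
  have A: "A *v w = V w t" for w
    unfolding A_def by (rule matrix_works[OF clinearI[OF Vadd Vscale]])
  \<comment> \<open>The Taylor constant \<open>K\<close> times the square of
    \<open>exp (K * t)\<close>, the factor by which neighbouring trajectories may separate.\<close>
  define c where "c = K * exp (2 * K * t)"
  have c: "c \<ge> 0" using K by (simp add: c_def)
  define C where "C = sqrt (exp ((2 * K + 1) * t) * t) * c"
  have rem: "norm (flow G t (z + w) - flow G t z - V w t) \<le> C * (norm w)\<^sup>2" if w: "norm w \<le> r - norm z" for w
  proof -
    define zw where "zw = z + w"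
    have zw: "norm zw \<le> r" "norm zw < 1" using norm_triangle_ineq[of z w] w r by (simp_all add: zw_def)
    let ?uw = "\<lambda>t. flow G t zw"
    have uwle: "norm (?uw \<tau>) \<le> r" if "0 \<le> \<tau>" for \<tau>
      using flow_solution(3)[OF G zw(2) that] zw by linarith
    define D where "D = (\<lambda>\<tau>. ?uw \<tau> - flow G \<tau> z - V w \<tau>)"
    define b where "b = c * (norm w)\<^sup>2"
    have b: "b \<ge> 0" using c by (simp add: b_def)
    obtain L1 L2 L3 where L: "L1-lipschitz_on {0..t} ?uw" "L2-lipschitz_on {0..t} (\<lambda>t. flow G t z)" "L3-lipschitz_on {0..t} (V w)"
      using flow_solution(1)[OF G z] flow_solution(1)[OF G zw(2)] V(2)[of w] unfolding AE_solution_def by blast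
    obtain N1 where N1: "negligible N1" "\<And>t. 0 < t \<Longrightarrow> t \<notin> N1 \<Longrightarrow> (?uw has_vector_derivative G (?uw t) t) (at t)"
      using AE_solution_derivativeE[OF flow_solution(1)[OF G zw(2)]] by blast
    obtain N2 where N2: "negligible N2" "\<And>t. 0 < t \<Longrightarrow> t \<notin> N2 \<Longrightarrow>
        ((\<lambda>t. flow G t z) has_vector_derivative G (flow G t z) t) (at t)"
      using AE_solution_derivativeE[OF flow_solution(1)[OF G z]] by blast
    obtain N3 where N3: "negligible N3" "\<And>t. 0 < t \<Longrightarrow> t \<notin> N3 \<Longrightarrow> (V w has_vector_derivative ?X (V w t) t) (at t)"
      using AE_solution_derivativeE[OF V(2)[of w]] by blast
    have diff: "norm (?uw \<tau> - flow G \<tau> z) \<le> exp (K * \<tau>) * norm w" if \<tau>: "0 \<le> \<tau>" "\<tau> \<le> t" for \<tau>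
    proof -
      have "norm (?uw \<tau> - flow G \<tau> z) \<le> exp (K * \<tau>) * norm (?uw 0 - flow G 0 z)"
      proof (rule AE_compare(1)[OF _ _ \<tau>(1)])
        show "L1-lipschitz_on {0..\<tau>} ?uw" "L2-lipschitz_on {0..\<tau>} (\<lambda>t. flow G t z)"
          by (rule lipschitz_on_subset[OF L(1)] lipschitz_on_subset[OF L(2)], use \<tau> in auto)+
        show "negligible (N1 \<union> N2)" using N1 N2 by simp
        fix x assume x: "x \<in> {0<..<\<tau>} - (N1 \<union> N2)"
        then have "norm (G (?uw x) x - G (flow G x z) x) \<le> K * norm (?uw x - flow G x z)"
          using uwle[of x] ule[of x] ueq[of x] by (intro K(2)) auto
        then show "\<exists>D E. (?uw has_vector_derivative D) (at x) \<and> ((\<lambda>t. flow G t z) has_vector_derivative E) (at x) \<and>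
          norm (D - E) \<le> K * norm (?uw x - flow G x z)"
          using N1(2)[of x] N2(2)[of x] x by (intro exI conjI) auto
      qed (use K in simp)
      then show ?thesis unfolding flow_solution(2)[OF G zw(2)] flow_solution(2)[OF G z] by (simp add: zw_def)
    qed
    have "(norm (D t))\<^sup>2 \<le> exp ((2 * K + 1) * (t - 0)) * ((norm (D 0))\<^sup>2 + b\<^sup>2 * (t - 0))"
    proof (rule AE_gronwall_norm[OF _ t])
      show "(L1 + L2 + L3)-lipschitz_on {0..t} D" unfolding D_def by (intro lipschitz_on_diff L)
      show "negligible (N1 \<union> N2 \<union> N3)" using N1 N2 N3 by simp
      fix \<tau> assume \<tau>: "\<tau> \<in> {0<..<t} - (N1 \<union> N2 \<union> N3)"
      define E where "E = G (?uw \<tau>) \<tau> - G (flow G \<tau> z) \<tau> - ?J \<tau> *v V w \<tau>"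
      have "(D has_vector_derivative E) (at \<tau>)"
        unfolding D_def E_def using \<tau> by (intro has_vector_derivative_diff N1 N2 N3) auto
      moreover have "2 * (D \<tau> \<bullet> E) \<le> (2 * K + 1) * (norm (D \<tau>))\<^sup>2 + b\<^sup>2"
      proof -
        define R where "R = G (?uw \<tau>) \<tau> - G (u \<tau>) \<tau> - ?J \<tau> *v (?uw \<tau> - u \<tau>)"
        have E: "E = R + ?J \<tau> *v D \<tau>"
          using ueq[of \<tau>] \<tau> by (simp add: E_def R_def D_def matrix_vector_mult_diff_distrib)
        have "norm R \<le> K * (norm (?uw \<tau> - u \<tau>))\<^sup>2"
          unfolding R_def using uwle[of \<tau>] ule[of \<tau>] \<tau> by (intro K(4)) auto
        also have "\<dots> \<le> K * (exp (K * t) * norm w)\<^sup>2"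
        proof -
          have "norm (?uw \<tau> - u \<tau>) \<le> exp (K * \<tau>) * norm w" using diff[of \<tau>] ueq[of \<tau>] \<tau> by simp
          also have "\<dots> \<le> exp (K * t) * norm w" using K \<tau> by (intro mult_right_mono) auto
          finally show ?thesis using K by (intro mult_left_mono power_mono) auto
        qed
        also have "\<dots> = b" by (simp add: b_def c_def power_mult_distrib exp_double[symmetric] mult.assoc)
        finally have R: "norm R \<le> b" .
        have "norm (?J \<tau> *v D \<tau>) \<le> K * norm (D \<tau>)" using ule[of \<tau>] by (intro K(3)) simp
        then have "norm E \<le> b + K * norm (D \<tau>)" using norm_triangle_ineq[of R "?J \<tau> *v D \<tau>"] R by (simp add: E)
        moreover have "D \<tau> \<bullet> E \<le> norm (D \<tau>) * norm E" by (rule norm_cauchy_schwarz)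
        ultimately have "D \<tau> \<bullet> E \<le> norm (D \<tau>) * (b + K * norm (D \<tau>))"
          by (meson mult_left_mono norm_ge_zero order_trans)
        \<comment> \<open>This bounds twice the product of \<open>b\<close> and
          \<open>norm (D \<tau>)\<close> by the sum of their squares, which accounts for the 1 in
          \<open>2 * K + 1\<close> and for the term \<open>b\<^sup>2\<close>.\<close>
        moreover have "0 \<le> (norm (D \<tau>) - b)\<^sup>2" by simp
        ultimately show ?thesis by (simp add: power2_eq_square algebra_simps)
      qed
      ultimately show "\<exists>E. (D has_vector_derivative E) (at \<tau>) \<and> 2 * (D \<tau> \<bullet> E) \<le> (2 * K + 1) * (norm (D \<tau>))\<^sup>2 + b\<^sup>2"
        by blast
    qed (use K in simp)
    moreover have "D 0 = 0" unfolding D_def flow_solution(2)[OF G zw(2)] flow_solution(2)[OF G z] by (simp add: V zw_def)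
    ultimately have "(norm (D t))\<^sup>2 \<le> (sqrt (exp ((2 * K + 1) * t) * t) * b)\<^sup>2"
      using t by (simp add: power_mult_distrib mult_ac)
    then have "norm (D t) \<le> sqrt (exp ((2 * K + 1) * t) * t) * b"
      by (rule power2_le_imp_le) (use b t in simp)
    then show ?thesis by (simp add: D_def C_def b_def zw_def mult.assoc)
  qed
  have der: "(flow G t has_derivative (\<lambda>v. A *v v)) (at z)"
    unfolding has_derivative_at_alt
  proof (intro conjI allI impI)
    show "bounded_linear (\<lambda>v. A *v v)" by simp
    fix e :: real assume e: "0 < e"
    have C: "C \<ge> 0" using c t by (simp add: C_def)
    define d where "d = min (r - norm z) (e / (C + 1))"
    have d: "d > 0" using r e C by (simp add: d_def)
    show "\<exists>d>0. \<forall>y. norm (y - z) < d \<longrightarrow> norm (flow G t y - flow G t z - A *v (y - z)) \<le> e * norm (y - z)"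
    proof (intro exI[of _ d] conjI allI impI d)
      fix y assume y: "norm (y - z) < d"
      have "norm (flow G t (z + (y - z)) - flow G t z - V (y - z) t) \<le> C * (norm (y - z))\<^sup>2"
        by (rule rem) (use y in \<open>simp add: d_def\<close>)
      also have "\<dots> = (C * norm (y - z)) * norm (y - z)" by (simp add: power2_eq_square)
      also have "\<dots> \<le> e * norm (y - z)"
      proof (rule mult_right_mono)
        have "C * norm (y - z) \<le> C * (e / (C + 1))" using y C by (intro mult_left_mono) (auto simp: d_def)
        also have "\<dots> \<le> e" using C e by (simp add: field_simps)
        finally show "C * norm (y - z) \<le> e" .
      qed simp
      finally show "norm (flow G t y - flow G t z - A *v (y - z)) \<le> e * norm (y - z)" by (simp add: A)
    qed
  qed
  have "inj ((*v) A)"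
  proof (rule injI)
    fix x y assume "A *v x = A *v y"
    then have "V (x - y) t = 0" using A[of "x - y"] by (simp add: matrix_vector_mult_diff_distrib)
    then have "exp (- (K * t)) * norm (x - y) \<le> 0" using Vlo[of "x - y"] by simp
    then show "x = y" by (simp add: mult_le_0_iff)
  qed
  then have "invertible A"
    using matrix_left_invertible_injective[of A] invertible_left_inverse[of A] by blast
  with der show thesis using that by blast
qed

section \<open>The topology of locally uniform convergence and the limit of the flow\<close>

lemma hol_topology_subbase:
  assumes "compact K" "K \<subseteq> ball 0 1" "open W"
  shows "openin hol_topology {f \<in> hol. f ` K \<subseteq> W}"
  unfolding hol_topology_def by (rule topology_generated_by_Basis) (use assms in blast)

lemma topspace_hol_topology: "topspace hol_topology = (hol :: (complex ^ 'n \<Rightarrow> complex ^ 'n) set)"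
proof
  show "topspace hol_topology \<subseteq> (hol :: (complex ^ 'n \<Rightarrow> complex ^ 'n) set)"
    unfolding hol_topology_def topology_generated_by_topspace by blast
  have "openin hol_topology {f \<in> hol. f ` {} \<subseteq> (UNIV :: (complex ^ 'n) set)}"
    by (rule hol_topology_subbase) auto
  then show "(hol :: (complex ^ 'n \<Rightarrow> complex ^ 'n) set) \<subseteq> topspace hol_topology"
    using openin_subset by fastforce
qed

lemma compact_in_ball_cball:
  fixes K :: "'a::euclidean_space set"
  assumes "compact K" "K \<subseteq> ball 0 1"
  obtains r where "0 \<le> r" "r < 1" "K \<subseteq> cball 0 r"
proof (cases "K = {}")
  case True then show thesis using that[of 0] by simp
next
  case False
  have "continuous_on K norm" by (intro continuous_intros)
  then obtain x where x: "x \<in> K" "\<And>y. y \<in> K \<Longrightarrow> norm y \<le> norm x"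
    using continuous_attains_sup[OF assms(1) False] by blast
  show thesis by (rule that[of "norm x"]) (use x assms(2) in auto)
qed

text \<open>Finite intersections and unions being harmless, only subbasic sets matter. There the
  image of \<open>K\<close> under \<open>f\<close> is compact, so a uniform neighbourhood of it lies
  in \<open>W\<close> and contains the values on \<open>K\<close> of every map that is uniformly
  close to \<open>f\<close>.\<close>

lemma limitin_hol_topologyI:
  fixes f :: "complex ^ 'n \<Rightarrow> complex ^ 'n"
  assumes f: "f \<in> hol" and g: "\<forall>\<^sub>F t in F. g t \<in> hol"
    and lim: "\<And>r. 0 \<le> r \<Longrightarrow> r < 1 \<Longrightarrow> uniform_limit (cball 0 r) g f F"
  shows "limitin hol_topology g f F"
  unfolding limitin_def topspace_hol_topology
proof (intro conjI f allI impI)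
  fix U assume U: "openin hol_topology U \<and> f \<in> U"
  have "generate_topology_on {{f \<in> hol. f ` K \<subseteq> W} | K W. compact K \<and> K \<subseteq> ball (0 :: complex ^ 'n) 1 \<and> open W} U"
    using U unfolding hol_topology_def openin_topology_generated_by_iff by blast
  then have "f \<in> U \<longrightarrow> (\<forall>\<^sub>F t in F. g t \<in> U)"
  proof (induction rule: generate_topology_on.induct)
    case Empty then show ?case by simp
  next
    case (Int a b) then show ?case by (auto intro: eventually_conj)
  next
    case (UN k) 
    show ?case
    proof
      assume "f \<in> \<Union> k"
      then obtain u where u: "u \<in> k" "f \<in> u" by blast
      then have "\<forall>\<^sub>F t in F. g t \<in> u" using UN by blast
      then show "\<forall>\<^sub>F t in F. g t \<in> \<Union> k" by (rule eventually_mono) (use u in blast)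
    qed
  next
    case (Basis s)
    then obtain K W where s: "s = {f \<in> hol. f ` K \<subseteq> W}" and K: "compact K" "K \<subseteq> ball 0 1" and W: "open W" by blast
    show ?case
    proof
      assume "f \<in> s"
      then have fK: "f ` K \<subseteq> W" by (simp add: s)
      have "continuous_on (ball 0 1) f" using f hol_iff holo_on_continuous by blast
      then have "compact (f ` K)" using K by (meson compact_continuous_image continuous_on_subset)
      then obtain e where e: "0 < e" "(\<Union>x\<in>f ` K. ball x e) \<subseteq> W"
        using compact_subset_open_imp_ball_epsilon_subset[OF _ W fK] by blast
      obtain r where r: "0 \<le> r" "r < 1" "K \<subseteq> cball 0 r" using compact_in_ball_cball[OF K] by blast
      have "\<forall>\<^sub>F t in F. \<forall>x\<in>cball 0 r. dist (g t x) (f x) < e"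
        using lim[OF r(1,2)] e(1) unfolding uniform_limit_iff by blast
      with g show "\<forall>\<^sub>F t in F. g t \<in> s"
      proof (rule eventually_elim2)
        fix t assume gt: "g t \<in> hol" and d: "\<forall>x\<in>cball 0 r. dist (g t x) (f x) < e"
        have "g t x \<in> W" if "x \<in> K" for x
        proof -
          have "g t x \<in> ball (f x) e" using d that r(3) by (auto simp: dist_commute)
          then show ?thesis using e(2) that by blast
        qed
        then show "g t \<in> s" unfolding s using gt by blast
      qed
    qed
  qed
  then show "\<forall>\<^sub>F t in F. g t \<in> U" using U by blast
qed

text \<open>Evaluation at \<open>z\<close> is controlled by the subbasic sets with
  \<open>K = {z}\<close>.\<close>

lemma limitin_hol_topology_pointwise:
  assumes "limitin hol_topology g f F" "z \<in> ball 0 1"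
  shows "((\<lambda>t. g t z) \<longlongrightarrow> f z) F"
proof (rule topological_tendstoI)
  fix W assume W: "open W" "f z \<in> W"
  have "openin hol_topology {h \<in> hol. h ` {z} \<subseteq> W}"
    using assms(2) W by (intro hol_topology_subbase) auto
  moreover have "f \<in> {h \<in> hol. h ` {z} \<subseteq> W}"
    using assms(1) W unfolding limitin_def topspace_hol_topology by blast
  ultimately have "\<forall>\<^sub>F t in F. g t \<in> {h \<in> hol. h ` {z} \<subseteq> W}"
    using assms(1) unfolding limitin_def by blast
  then show "\<forall>\<^sub>F t in F. g t z \<in> W" by (rule eventually_mono) blast
qed

lemma limitin_hol_topology_unique:
  fixes f h :: "complex ^ 'n \<Rightarrow> complex ^ 'n"
  assumes f: "limitin hol_topology g f F" and h: "limitin hol_topology g h F" and F: "F \<noteq> bot"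
  shows "f = h"
proof
  fix z :: "complex ^ 'n"
  have hol: "f \<in> hol" "h \<in> hol" using f h unfolding limitin_def topspace_hol_topology by blast+
  show "f z = h z"
  proof (cases "z \<in> ball 0 1")
    case True
    then show ?thesis
      using tendsto_unique[OF F limitin_hol_topology_pointwise[OF f True] limitin_hol_topology_pointwise[OF h True]] by simp
  next
    case False then show ?thesis using hol by (simp add: hol_iff)
  qed
qed

section \<open>Decay of the flow and convergence to the limit map\<close>

text \<open>The guaranteed rate \<open>(1 - norm x) / (1 + norm x)\<close> improves as
  \<open>x\<close> approaches the origin. Norms do not increase along the flow, so the rate
  available at time \<open>s\<close> stays valid afterwards.\<close>

lemma flow_contracts:
  fixes G :: "complex ^ 'n \<Rightarrow> real \<Rightarrow> complex ^ 'n"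
  assumes G: "class_M_field G" and z: "norm z < 1" and st: "0 \<le> s" "s \<le> t"
    and r: "norm (flow G s z) \<le> r" "r < 1"
  shows "(norm (flow G t z))\<^sup>2 \<le> exp (- (2 * ((1 - r) / (1 + r))) * (t - s)) * (norm (flow G s z))\<^sup>2"
proof -
  let ?u = "\<lambda>t. flow G t z"
  define c where "c = (1 - r) / (1 + r)"
  have r0: "0 \<le> r" using r(1) norm_ge_zero order_trans by blast
  note sol = flow_solution(1)[OF G z]
  obtain L where L: "L-lipschitz_on {0..t} ?u" using sol unfolding AE_solution_def by blast
  have lip: "L-lipschitz_on {s..t} ?u" by (rule lipschitz_on_subset[OF L]) (use st in auto)
  obtain N where N: "negligible N" "\<And>t. 0 < t \<Longrightarrow> t \<notin> N \<Longrightarrow> (?u has_vector_derivative G (?u t) t) (at t)"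
    using AE_solution_derivativeE[OF sol] by blast
  have "(norm (?u t))\<^sup>2 \<le> exp (- (2 * c) * (t - s)) * ((norm (?u s))\<^sup>2 + 0 * (t - s))"
  proof (rule AE_gronwall_norm[OF lip st(2) N(1)])
    fix \<tau> assume \<tau>: "\<tau> \<in> {s<..<t} - N"
    define x where "x = ?u \<tau>"
    have u1: "norm (?u t) < 1" if "0 \<le> t" for t using flow_norm_less_1[OF G z that] .
    have "norm x \<le> norm (?u s)"
      unfolding x_def using class_M_field_solution_norm_le[OF G sol u1 st(1), of \<tau>] \<tau> by simp
    then have x: "norm x \<le> r" "norm x < 1" using r by linarith+
    have "(G x \<tau> \<bullet> x) * (1 + norm x) \<le> - (norm x)\<^sup>2 * (1 - norm x)"
      by (rule class_M_field_inner(2)[OF G x(2)])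
    moreover have "c \<le> (1 - norm x) / (1 + norm x)"
      unfolding c_def using x r0 by (intro frac_le) (auto intro: add_pos_nonneg)
    moreover have "0 < 1 + norm x" by (simp add: add_pos_nonneg)
    ultimately have "G x \<tau> \<bullet> x \<le> (- (norm x)\<^sup>2 * (1 - norm x)) / (1 + norm x)"
      by (simp only: pos_le_divide_eq)
    also have "\<dots> = - (norm x)\<^sup>2 * ((1 - norm x) / (1 + norm x))" by simp
    also have "\<dots> \<le> - (norm x)\<^sup>2 * c"
      using mult_left_mono[OF \<open>c \<le> (1 - norm x) / (1 + norm x)\<close>, of "(norm x)\<^sup>2"] by simp
    finally have "G x \<tau> \<bullet> x \<le> - (norm x)\<^sup>2 * c" .
    moreover have "x \<bullet> G x \<tau> = G x \<tau> \<bullet> x" by (rule inner_commute)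
    ultimately have "2 * (x \<bullet> G x \<tau>) \<le> 2 * (- (norm x)\<^sup>2 * c)" by linarith
    also have "\<dots> = - (2 * c) * (norm x)\<^sup>2 + 0" by algebra
    finally have "2 * (x \<bullet> G x \<tau>) \<le> - (2 * c) * (norm x)\<^sup>2 + 0" .
    then show "\<exists>D. (?u has_vector_derivative D) (at \<tau>) \<and> 2 * (?u \<tau> \<bullet> D) \<le> - (2 * c) * (norm (?u \<tau>))\<^sup>2 + 0"
      using N(2)[of \<tau>] \<tau> st unfolding x_def by (intro exI[of _ "G (?u \<tau>) \<tau>"]) auto
  qed simp
  then show ?thesis by (simp add: c_def)
qed

text \<open>The crude decay rate \<open>(1 - r) / (1 + r)\<close> brings the trajectory into \<open>cball 0 (1/5)\<close>, where the
  rate is at least \<open>2/3\<close>; any rate above \<open>1/2\<close> makes \<open>exp t *\<^sub>R flow G t\<close> converge.\<close>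

lemma flow_decay:
  assumes r: "0 \<le> r" "r < 1"
  obtains A where "0 < A" "\<And>(G :: complex ^ 'n \<Rightarrow> real \<Rightarrow> complex ^ 'n) t z.
    class_M_field G \<Longrightarrow> norm z \<le> r \<Longrightarrow> 0 \<le> t \<Longrightarrow> norm (flow G t z) \<le> A * exp (- (2 * t / 3))"
proof -
  define c where "c = (1 - r) / (1 + r)"
  have c: "0 < c" using r by (simp add: c_def)
  \<comment> \<open>By time \<open>T\<close> the crude rate \<open>c\<close> has brought the norm
    down to at most 1/5. The constant \<open>A\<close> is such that the claimed bound is still at
    least 1 at time \<open>T\<close>.\<close>
  define T where "T = ln 5 / c"
  have T: "0 < T" "exp (- (c * T)) = 1 / 5" using c by (simp_all add: T_def exp_minus)
  define A where "A = exp (2 * T / 3)"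
  show thesis
  proof (rule that)
    show "0 < A" by (simp add: A_def)
    fix G :: "complex ^ 'n \<Rightarrow> real \<Rightarrow> complex ^ 'n" and t and z :: "complex ^ 'n"
    assume G: "class_M_field G" and z: "norm z \<le> r" and t: "(0 :: real) \<le> t"
    have z1: "norm z < 1" using z r by linarith
    note ft = flow_solution(3)[OF G z1]
    show "norm (flow G t z) \<le> A * exp (- (2 * t / 3))"
    proof (cases "t \<le> T")
      case True
      then have "1 \<le> exp (2 * T / 3 + - (2 * t / 3))" by simp
      then have "1 \<le> A * exp (- (2 * t / 3))" unfolding A_def exp_add .
      then show ?thesis using ft[OF t] z1 by linarith
    next
      case False
      have "(norm (flow G T z))\<^sup>2 \<le> exp (- (2 * c) * (T - 0)) * (norm (flow G 0 z))\<^sup>2"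
        unfolding c_def by (rule flow_contracts[OF G z1]) (use T r z flow_solution(2)[OF G z1] in auto)
      also have "\<dots> \<le> exp (- (2 * c) * (T - 0)) * 1"
        using flow_solution(2)[OF G z1] z1 by (intro mult_left_mono) (auto simp: power_le_one)
      also have "\<dots> = (1 / 5)\<^sup>2" unfolding T(2)[symmetric] by (simp add: exp_double[symmetric] mult.assoc)
      finally have "norm (flow G T z) \<le> 1 / 5" by (rule power2_le_imp_le) simp
      then have "(norm (flow G t z))\<^sup>2 \<le> exp (- (2 * ((1 - 1/5) / (1 + 1/5))) * (t - T)) * (norm (flow G T z))\<^sup>2"
        using T False by (intro flow_contracts[OF G z1]) auto
      also have "\<dots> \<le> exp (- (2 * ((1 - 1/5) / (1 + 1/5))) * (t - T)) * 1"
        using ft[of T] T z1 by (intro mult_left_mono) (auto simp: power_le_one)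
      also have "\<dots> = (A * exp (- (2 * t / 3)))\<^sup>2"
      proof -
        have "- (2 * ((1 - 1/5) / (1 + 1/5))) * (t - T) = 2 * (2 * T / 3 + - (2 * t / 3))"
          by (simp add: field_simps)
        then show ?thesis unfolding A_def by (simp only: exp_add[symmetric] exp_double[symmetric] mult_1_right)
      qed
      finally show ?thesis by (rule power2_le_imp_le) (simp add: A_def)
    qed
  qed
qed

lemma lipschitz_on_scaleR_bounded:
  fixes f :: "'a::metric_space \<Rightarrow> real" and u :: "'a \<Rightarrow> 'b::real_normed_vector"
  assumes f: "L1-lipschitz_on S f" "\<And>t. t \<in> S \<Longrightarrow> \<bar>f t\<bar> \<le> M1" and u: "L2-lipschitz_on S u" "\<And>t. t \<in> S \<Longrightarrow> norm (u t) \<le> M2"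
    and M: "0 \<le> M1" "0 \<le> M2"
  shows "(L1 * M2 + M1 * L2)-lipschitz_on S (\<lambda>t. f t *\<^sub>R u t)"
proof (rule lipschitz_onI)
  have L: "0 \<le> L1" "0 \<le> L2" using f u lipschitz_on_nonneg by blast+
  then show "0 \<le> L1 * M2 + M1 * L2" using M by simp
  fix p q assume pq: "p \<in> S" "q \<in> S"
  have "f p *\<^sub>R u p - f q *\<^sub>R u q = (f p - f q) *\<^sub>R u p + f q *\<^sub>R (u p - u q)" by (simp add: algebra_simps)
  also have "norm \<dots> \<le> \<bar>f p - f q\<bar> * norm (u p) + \<bar>f q\<bar> * norm (u p - u q)"
    by (rule norm_triangle_le) simp
  also have "\<dots> \<le> (L1 * dist p q) * M2 + M1 * (L2 * dist p q)"
    using lipschitz_onD[OF f(1) pq] lipschitz_onD[OF u(1) pq] f(2) u(2) pq L M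
    by (intro add_mono mult_mono) (auto simp: dist_norm)
  finally show "dist (f p *\<^sub>R u p) (f q *\<^sub>R u q) \<le> (L1 * M2 + M1 * L2) * dist p q"
    by (simp add: dist_norm algebra_simps)
qed

text \<open>A field of the class fixes the origin as a zero with derivative minus the identity, so
  \<open>w + G w \<tau>\<close> is of second order in \<open>w\<close>. The velocity of
  \<open>exp \<tau> *\<^sub>R flow G \<tau> z\<close> is \<open>exp \<tau>\<close> times this
  expression at \<open>w = flow G \<tau> z\<close>; the decay rate 2/3 enters twice, which leaves
  the integrable size \<open>exp (\<tau> - 4 * \<tau> / 3)\<close>.\<close>

lemma scaled_flow_cauchy:
  assumes r: "0 \<le> r" "r < 1"
  obtains C where "0 < C" "\<And>(G :: complex ^ 'n \<Rightarrow> real \<Rightarrow> complex ^ 'n) s t z.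
    class_M_field G \<Longrightarrow> norm z \<le> r \<Longrightarrow> 0 \<le> s \<Longrightarrow> s \<le> t \<Longrightarrow>
    norm (exp t *\<^sub>R flow G t z - exp s *\<^sub>R flow G s z) \<le> C * exp (- (s / 3))"
proof -
  obtain A where A: "0 < A" "\<And>(G :: complex ^ 'n \<Rightarrow> real \<Rightarrow> complex ^ 'n) t z.
    class_M_field G \<Longrightarrow> norm z \<le> r \<Longrightarrow> 0 \<le> t \<Longrightarrow> norm (flow G t z) \<le> A * exp (- (2 * t / 3))"
    using flow_decay[OF r, where 'n='n] by blast
  obtain K where K: "0 < K"
    "\<And>(G :: complex ^ 'n \<Rightarrow> real \<Rightarrow> complex ^ 'n) t z w. class_M_field G \<Longrightarrow> z \<in> cball 0 r \<Longrightarrow> w \<in> cball 0 r \<Longrightarrow>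
       norm (G w t - G z t - cjacobian (on_ball (\<lambda>z. G z t)) z *v (w - z)) \<le> K * (norm (w - z))\<^sup>2"
    using class_M_field_bounds[OF r, where 'n='n] by metis
  have KG: "norm (w + G w t) \<le> K * (norm w)\<^sup>2" if G: "class_M_field G" and w: "norm w \<le> r"
    for G :: "complex ^ 'n \<Rightarrow> real \<Rightarrow> complex ^ 'n" and t w
  proof -
    have M: "on_ball (\<lambda>z. G z t) \<in> class_M" using G unfolding class_M_field_def by blast
    have "G 0 t = 0" using class_MD(2)[OF M] by (simp add: on_ball_def)
    then show ?thesis using K(2)[OF G, of 0 w t] w r class_MD(3)[OF M]
      by (simp add: matrix_vector_mult_minus add.commute)
  qed
  define B where "B = K * A\<^sup>2"
  have B: "B > 0" using K A by (simp add: B_def)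
  show thesis
  proof (rule that[of "3 * B"])
    show "0 < 3 * B" using B by simp
    fix G :: "complex ^ 'n \<Rightarrow> real \<Rightarrow> complex ^ 'n" and s t :: real and z :: "complex ^ 'n"
    assume G: "class_M_field G" and z: "norm z \<le> r" and st: "0 \<le> s" "s \<le> t"
    have z1: "norm z < 1" using z r by linarith
    let ?u = "\<lambda>t. flow G t z"
    define f where "f = (\<lambda>\<tau>. exp \<tau> *\<^sub>R (?u \<tau> + G (?u \<tau>) \<tau>))"
    note sol = flow_solution(1)[OF G z1]
    obtain L where L: "L-lipschitz_on {0..t} ?u" using sol unfolding AE_solution_def by blast
    have lip: "L-lipschitz_on {s..t} ?u" by (rule lipschitz_on_subset[OF L]) (use st in auto)
    obtain N where N: "negligible N" "\<And>t. 0 < t \<Longrightarrow> t \<notin> N \<Longrightarrow> (?u has_vector_derivative G (?u t) t) (at t)"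
      using AE_solution_derivativeE[OF sol] by blast
    have lipe: "(exp t)-lipschitz_on {s..t} (exp :: real \<Rightarrow> real)"
    proof (rule bounded_derivative_imp_lipschitz)
      show "(exp has_derivative (\<lambda>h. exp x * h)) (at x within {s..t})" for x :: real
        by (auto intro!: derivative_eq_intros)
      show "onorm (\<lambda>h. exp x * h) \<le> exp t" if "x \<in> {s..t}" for x :: real
        by (rule onorm_le) (use that in \<open>simp add: abs_mult mult_right_mono\<close>)
    qed auto
    have u1: "norm (?u \<tau>) \<le> 1" if "\<tau> \<in> {s..t}" for \<tau>
      using flow_norm_less_1[OF G z1, of \<tau>] that st by simp
    have lv: "(exp t * 1 + exp t * L)-lipschitz_on {s..t} (\<lambda>\<tau>. exp \<tau> *\<^sub>R ?u \<tau>)"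
      by (rule lipschitz_on_scaleR_bounded[OF lipe _ lip u1]) auto
    have int: "(f has_integral exp t *\<^sub>R ?u t - exp s *\<^sub>R ?u s) {s..t}"
    proof (rule fundamental_theorem_of_calculus_abs_cont[OF lipschitz_imp_abs_cont[OF lv] st(2) N(1)])
      fix \<tau> assume \<tau>: "\<tau> \<in> {s<..<t} - N"
      have e: "(exp has_real_derivative exp \<tau>) (at \<tau>)" by (auto intro!: derivative_eq_intros)
      show "((\<lambda>\<tau>. exp \<tau> *\<^sub>R ?u \<tau>) has_vector_derivative f \<tau>) (at \<tau>)"
        using has_vector_derivative_scaleR[OF e N(2)[of \<tau>]] \<tau> st by (simp add: f_def algebra_simps)
    qed
    \<comment> \<open>The primitive of \<open>exp (- (\<tau> / 3))\<close> brings in the factor 3 of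
      the final constant.\<close>
    have gint: "((\<lambda>\<tau>. B * exp (- (\<tau> / 3))) has_integral (- 3 * B * exp (- (t / 3))) - (- 3 * B * exp (- (s / 3)))) {s..t}"
      by (rule fundamental_theorem_of_calculus[OF st(2)])
         (auto intro!: derivative_eq_intros simp flip: has_real_derivative_iff_has_vector_derivative)
    have "norm (integral {s..t} f) \<le> integral {s..t} (\<lambda>\<tau>. B * exp (- (\<tau> / 3)))"
    proof (rule Henstock_Kurzweil_Integration.integral_norm_bound_integral)
      show "f integrable_on {s..t}" "(\<lambda>\<tau>. B * exp (- (\<tau> / 3))) integrable_on {s..t}" using int gint by blast+
      fix \<tau> assume \<tau>: "\<tau> \<in> {s..t}"
      have ur: "norm (?u \<tau>) \<le> r" using flow_solution(3)[OF G z1, of \<tau>] \<tau> st z by simp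
      have "norm (f \<tau>) = exp \<tau> * norm (?u \<tau> + G (?u \<tau>) \<tau>)" by (simp add: f_def)
      also have "\<dots> \<le> exp \<tau> * (K * (norm (?u \<tau>))\<^sup>2)" using KG[OF G ur] by (intro mult_left_mono) auto
      also have "\<dots> \<le> exp \<tau> * (K * (A * exp (- (2 * \<tau> / 3)))\<^sup>2)"
        using A(2)[OF G z, of \<tau>] \<tau> st K by (intro mult_left_mono power_mono) auto
      also have "\<dots> = B * (exp \<tau> * (exp (- (2 * \<tau> / 3)))\<^sup>2)" by (simp add: B_def power_mult_distrib)
      also have "exp \<tau> * (exp (- (2 * \<tau> / 3)))\<^sup>2 = exp (- (\<tau> / 3))"
        by (simp add: exp_add[symmetric] exp_double[symmetric])
      finally show "norm (f \<tau>) \<le> B * exp (- (\<tau> / 3))" .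
    qed
    also have "\<dots> \<le> 3 * B * exp (- (s / 3))" using integral_unique[OF gint] B by simp
    finally show "norm (exp t *\<^sub>R ?u t - exp s *\<^sub>R ?u s) \<le> 3 * B * exp (- (s / 3))"
      using integral_unique[OF int] by simp
  qed
qed

lemma flow_holo_on:
  assumes "class_M_field G" "0 \<le> t"
  shows "holo_on (ball 0 1) (flow G t)"
  by (rule holo_onI) (use flow_has_derivative[OF assms(1) _ assms(2)] in \<open>metis mem_ball_0\<close>)

text \<open>The exponential Cauchy estimate is uniform on each \<open>cball 0 r\<close>. Limits
  along integer times therefore exist, the estimate passes to them, and convergence is locally
  uniform in continuous time. Weierstrass' theorem gives holomorphy, and uniqueness of limits
  evaluates the definite description.\<close>

theorem loewner_limit_converges:
  fixes G :: "complex ^ 'n \<Rightarrow> real \<Rightarrow> complex ^ 'n"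
  assumes G: "class_M_field G"
  shows "limitin hol_topology (\<lambda>t. on_ball (\<lambda>z. exp t *\<^sub>R flow G t z)) (loewner_limit G) at_top"
proof -
  define g where "g = (\<lambda>t. on_ball (\<lambda>z. exp t *\<^sub>R flow G t z))"
  have ghol: "g t \<in> hol" if "0 \<le> t" for t
    unfolding g_def using holo_on_scale[OF flow_holo_on[OF G that], of "complex_of_real (exp t)"]
    by (intro on_ball_hol) (simp add: scale_of_real)
  have cau: "\<exists>C>0. \<forall>s t z. norm z \<le> r \<longrightarrow> 0 \<le> s \<longrightarrow> s \<le> t \<longrightarrow> dist (g s z) (g t z) \<le> C * exp (- (s / 3))"
    if r: "0 \<le> r" "r < 1" for r
  proof -
    obtain C where C: "0 < C" "\<And>(G :: complex ^ 'n \<Rightarrow> real \<Rightarrow> complex ^ 'n) s t z.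
      class_M_field G \<Longrightarrow> norm z \<le> r \<Longrightarrow> 0 \<le> s \<Longrightarrow> s \<le> t \<Longrightarrow>
      norm (exp t *\<^sub>R flow G t z - exp s *\<^sub>R flow G s z) \<le> C * exp (- (s / 3))"
      using scaled_flow_cauchy[OF r, where 'n='n] by blast
    show ?thesis
    proof (intro exI[of _ C] conjI C(1) allI impI)
      fix s t :: real and z :: "complex ^ 'n" assume *: "norm z \<le> r" "0 \<le> s" "s \<le> t"
      then show "dist (g s z) (g t z) \<le> C * exp (- (s / 3))"
        using C(2)[OF G *] r by (simp add: g_def on_ball_eq dist_norm norm_minus_commute)
    qed
  qed
  have small: "\<exists>S\<ge>0. \<forall>s\<ge>S. C * exp (- (s / 3)) < e" if "0 < C" "0 < e" for C e :: real
  proof -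
    have "C * exp (- (s / 3)) < e" if "max 0 (- 3 * ln (e / C) + 1) \<le> s" for s
    proof -
      have "- (s / 3) < ln (e / C)" using that by simp
      then have "exp (- (s / 3)) < exp (ln (e / C))" by (simp only: exp_less_mono)
      also have "\<dots> = e / C" using \<open>0 < C\<close> \<open>0 < e\<close> by simp
      finally show ?thesis using \<open>0 < C\<close> by (simp add: field_simps)
    qed
    then show ?thesis by (intro exI[of _ "max 0 (- 3 * ln (e / C) + 1)"]) auto
  qed
  have "\<exists>l. (\<lambda>n. g (real n) z) \<longlonglongrightarrow> l" if z: "norm z < 1" for z
  proof -
    obtain C where C: "C > 0" "\<And>s t. 0 \<le> s \<Longrightarrow> s \<le> t \<Longrightarrow> dist (g s z) (g t z) \<le> C * exp (- (s / 3))"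
      using cau[OF norm_ge_zero z] by blast
    have "Cauchy (\<lambda>n. g (real n) z)"
    proof (rule metric_CauchyI)
      fix e :: real assume "0 < e"
      then obtain S where S: "S \<ge> 0" "\<And>s. s \<ge> S \<Longrightarrow> C * exp (- (s / 3)) < e" using small[OF C(1)] by blast
      obtain M where M: "S \<le> real M" using real_arch_simple by blast
      show "\<exists>M. \<forall>m\<ge>M. \<forall>n\<ge>M. dist (g (real m) z) (g (real n) z) < e"
      proof (intro exI[of _ M] allI impI)
        have *: "dist (g (real m) z) (g (real n) z) < e" if "M \<le> m" "m \<le> n" for m n
          using C(2)[of "real m" "real n"] S(2)[of "real m"] M that by fastforce
        fix m n assume "M \<le> m" "M \<le> n"
        then show "dist (g (real m) z) (g (real n) z) < e"
          using *[of m n] *[of n m] by (cases "m \<le> n") (auto simp: dist_commute)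
      qed
    qed
    then show ?thesis by (meson Cauchy_convergent convergent_def)
  qed
  then obtain f0 where f0: "\<And>z. norm z < 1 \<Longrightarrow> (\<lambda>n. g (real n) z) \<longlonglongrightarrow> f0 z" by metis
  define f where "f = on_ball f0"
  have rate: "\<exists>C>0. \<forall>s z. norm z \<le> r \<longrightarrow> 0 \<le> s \<longrightarrow> dist (g s z) (f z) \<le> C * exp (- (s / 3))"
    if r: "0 \<le> r" "r < 1" for r
  proof -
    obtain C where C: "C > 0" "\<And>s t z. norm z \<le> r \<Longrightarrow> 0 \<le> s \<Longrightarrow> s \<le> t \<Longrightarrow> dist (g s z) (g t z) \<le> C * exp (- (s / 3))"
      using cau[OF r] by blast
    show ?thesis
    proof (intro exI[of _ C] conjI C(1) allI impI)
      fix s :: real and z :: "complex ^ 'n" assume z: "norm z \<le> r" and s: "0 \<le> s"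
      have z1: "norm z < 1" using z r by linarith
      have "(\<lambda>n. dist (g s z) (g (real n) z)) \<longlonglongrightarrow> dist (g s z) (f0 z)" by (intro tendsto_intros f0 z1)
      moreover have "\<forall>\<^sub>F n in sequentially. dist (g s z) (g (real n) z) \<le> C * exp (- (s / 3))"
        using eventually_ge_at_top[of "nat \<lceil>s\<rceil>"] by (rule eventually_mono) (use C(2)[OF z s] in \<open>simp add: nat_ceiling_le_eq\<close>)
      ultimately have "dist (g s z) (f0 z) \<le> C * exp (- (s / 3))"
        by (rule tendsto_upperbound) simp
      then show "dist (g s z) (f z) \<le> C * exp (- (s / 3))" using z1 by (simp add: f_def on_ball_eq)
    qed
  qed
  have ulim: "uniform_limit (cball 0 r) g f at_top" if r: "0 \<le> r" "r < 1" for r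
    unfolding uniform_limit_iff
  proof (intro allI impI)
    fix e :: real assume e: "0 < e"
    obtain C where C: "C > 0" "\<And>s z. norm z \<le> r \<Longrightarrow> 0 \<le> s \<Longrightarrow> dist (g s z) (f z) \<le> C * exp (- (s / 3))"
      using rate[OF r] by blast
    obtain S where S: "S \<ge> 0" "\<And>s. s \<ge> S \<Longrightarrow> C * exp (- (s / 3)) < e" using small[OF C(1) e] by blast
    show "\<forall>\<^sub>F t in at_top. \<forall>z\<in>cball 0 r. dist (g t z) (f z) < e"
      using eventually_ge_at_top[of S]
    proof (rule eventually_mono, intro ballI)
      fix t and z :: "complex ^ 'n" assume "S \<le> t" "z \<in> cball 0 r"
      then show "dist (g t z) (f z) < e" using C(2)[of z t] S(1) S(2)[of t] by simp
    qed
  qed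
  have fhol: "f \<in> hol"
  proof -
    have "holo_on (ball 0 1) f"
    proof (rule holo_on_uniform_limit[where f="\<lambda>n. g (real n)"])
      show "holo_on (ball 0 1) (g (real n))" for n using ghol[of "real n"] unfolding hol_iff by simp
      fix r :: real assume r: "r < 1"
      have "uniform_limit (cball 0 (max r 0)) (\<lambda>n. g (real n)) f sequentially"
        by (rule filterlim_compose[OF ulim filterlim_real_sequentially]) (use r in auto)
      then show "uniform_limit (cball 0 r) (\<lambda>n. g (real n)) f sequentially"
        by (rule uniform_limit_on_subset) auto
    qed
    then show ?thesis unfolding hol_iff by (simp add: f_def on_ball_def)
  qed
  have lim: "limitin hol_topology g f at_top"
  proof (rule limitin_hol_topologyI[OF fhol _ ulim])
    show "\<forall>\<^sub>F t in at_top. g t \<in> hol"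
      using eventually_ge_at_top[of "0::real"] by (rule eventually_mono) (rule ghol)
  qed
  have "loewner_limit G = f"
    unfolding loewner_limit_def
  proof (rule the_equality)
    show "limitin hol_topology (\<lambda>t. on_ball (\<lambda>z. exp t *\<^sub>R flow G t z)) f at_top" using lim by (simp add: g_def)
    fix f' assume "limitin hol_topology (\<lambda>t. on_ball (\<lambda>z. exp t *\<^sub>R flow G t z)) f' at_top"
    then have "limitin hol_topology g f' at_top" by (simp add: g_def)
    then show "f' = f" using limitin_hol_topology_unique[OF _ lim] by (simp add: trivial_limit_at_top_linorder)
  qed
  then show ?thesis using lim by (simp add: g_def)
qed

lemma loewner_limit_hol:
  assumes "class_M_field G"
  shows "loewner_limit G \<in> hol"
  using loewner_limit_converges[OF assms] unfolding limitin_def topspace_hol_topology by blast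

lemma loewner_limit_tendsto:
  assumes "class_M_field G" "norm z < 1"
  shows "((\<lambda>t. exp t *\<^sub>R flow G t z) \<longlongrightarrow> loewner_limit G z) at_top"
  using limitin_hol_topology_pointwise[OF loewner_limit_converges[OF assms(1)], of z] assms(2)
  by (simp add: on_ball_eq)

lemma loewner_limit_AE_equal:
  fixes G :: "complex ^ 'n \<Rightarrow> real \<Rightarrow> complex ^ 'n"
  assumes H: "class_M_field H" and eq: "AE_equal_fields G H"
  shows "loewner_limit G = loewner_limit H"
proof -
  have *: "\<forall>\<^sub>F t in at_top. on_ball (\<lambda>z. exp t *\<^sub>R flow G t z) = on_ball (\<lambda>z. exp t *\<^sub>R flow H t z)"
    using eventually_ge_at_top[of "0::real"]
    by (rule eventually_mono) (intro on_ball_cong, simp add: flow_AE_equal[OF H eq])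
  then have **: "\<forall>\<^sub>F t in at_top. on_ball (\<lambda>z. exp t *\<^sub>R flow H t z) = on_ball (\<lambda>z. exp t *\<^sub>R flow G t z)"
    by (rule eventually_mono) simp
  have "limitin hol_topology (\<lambda>t. on_ball (\<lambda>z. exp t *\<^sub>R flow G t z)) f at_top \<longleftrightarrow>
      limitin hol_topology (\<lambda>t. on_ball (\<lambda>z. exp t *\<^sub>R flow H t z)) f at_top" for f
    using limitin_transform_eventually[OF *] limitin_transform_eventually[OF **] by blast
  then show ?thesis unfolding loewner_limit_def by simp
qed

lemma loewner_limit_shift:
  assumes G: "class_M_field G" and z: "norm z < 1" and s: "0 \<le> s"
  shows "loewner_limit G z = exp s *\<^sub>R loewner_limit (\<lambda>z t. G z (s + t)) (flow G s z)"
proof -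
  let ?H = "\<lambda>z t. G z (s + t)"
  have w: "norm (flow G s z) < 1" by (rule flow_norm_less_1[OF G z s])
  have "((\<lambda>t. exp s *\<^sub>R (exp t *\<^sub>R flow ?H t (flow G s z))) \<longlongrightarrow> exp s *\<^sub>R loewner_limit ?H (flow G s z)) at_top"
    by (intro tendsto_intros loewner_limit_tendsto class_M_field_shift G w)
  moreover have "\<forall>\<^sub>F t in at_top. exp s *\<^sub>R (exp t *\<^sub>R flow ?H t (flow G s z)) = exp (s + t) *\<^sub>R flow G (s + t) z"
    using eventually_ge_at_top[of "0::real"]
    by (rule eventually_mono) (simp add: flow_shift[OF G z s] exp_add)
  ultimately have 1: "((\<lambda>t. exp (s + t) *\<^sub>R flow G (s + t) z) \<longlongrightarrow> exp s *\<^sub>R loewner_limit ?H (flow G s z)) at_top"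
    by (rule Lim_transform_eventually)
  have "filterlim (\<lambda>t. s + t) at_top at_top" by (rule filterlim_tendsto_add_at_top[OF tendsto_const filterlim_ident])
  from filterlim_compose[OF loewner_limit_tendsto[OF G z] this]
  have 2: "((\<lambda>t. exp (s + t) *\<^sub>R flow G (s + t) z) \<longlongrightarrow> loewner_limit G z) at_top" .
  show ?thesis by (rule tendsto_unique[OF _ 2 1]) (simp add: trivial_limit_at_top_linorder)
qed

section \<open>The spike variation\<close>

lemma invertible_matrix_inv:
  fixes A :: "complex ^ 'n ^ 'n"
  assumes "invertible A"
  shows "A *v (matrix_inv A *v v) = v"
proof -
  have "A ** matrix_inv A = mat 1 \<and> matrix_inv A ** A = mat 1"
    unfolding matrix_inv_def by (rule someI_ex) (use assms in \<open>simp add: invertible_def\<close>)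
  then show ?thesis by (simp add: matrix_vector_mul_assoc)
qed

lemma on_ball_hol_eq: "h \<in> hol \<Longrightarrow> on_ball h = h"
  unfolding hol_iff on_ball_def by (rule ext) simp

text \<open>The right-hand side is free of inverse matrices. In this form the argument of
  \<open>transported_functional\<close> is visibly holomorphic and matches the first variation of
  the limit map.\<close>

lemma loewner_limit_cjacobian:
  fixes G :: "complex ^ 'n \<Rightarrow> real \<Rightarrow> complex ^ 'n"
  assumes G: "class_M_field G" and z: "norm z < 1" and s: "0 \<le> s"
  shows "cjacobian (loewner_limit G) z *v (matrix_inv (cjacobian (flow G s) z) *v w) =
    exp s *\<^sub>R (cjacobian (loewner_limit (\<lambda>z t. G z (s + t))) (flow G s z) *v w)"
proof -
  let ?f = "loewner_limit (\<lambda>z t. G z (s + t))"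
  obtain A where A: "(flow G s has_derivative (\<lambda>v. A *v v)) (at z)" "invertible A"
    using flow_has_derivative[OF G z s] by blast
  have f: "holo_on (ball 0 1) ?f" using loewner_limit_hol[OF class_M_field_shift[OF G]] hol_iff by blast
  have F: "holo_on (ball 0 1) (loewner_limit G)" using loewner_limit_hol[OF G] hol_iff by blast
  have w: "flow G s z \<in> ball 0 1" using flow_norm_less_1[OF G z s] by simp
  have zb: "z \<in> ball 0 1" using z by simp
  have "((\<lambda>z. ?f (flow G s z)) has_derivative (\<lambda>v. cjacobian ?f (flow G s z) *v (A *v v))) (at z)"
    using diff_chain_at[OF A(1) holo_onD[OF f w]] by (simp add: o_def)
  then have "((\<lambda>z. exp s *\<^sub>R ?f (flow G s z)) has_derivative (\<lambda>v. exp s *\<^sub>R (cjacobian ?f (flow G s z) *v (A *v v)))) (at z)"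
    by (rule has_derivative_scaleR_right)
  then have "(loewner_limit G has_derivative (\<lambda>v. exp s *\<^sub>R (cjacobian ?f (flow G s z) *v (A *v v)))) (at z)"
    by (rule has_derivative_transform_within_open[OF _ open_ball zb])
       (simp add: loewner_limit_shift[OF G _ s])
  then have "(\<lambda>v. cjacobian (loewner_limit G) z *v v) = (\<lambda>v. exp s *\<^sub>R (cjacobian ?f (flow G s z) *v (A *v v)))"
    by (rule has_derivative_unique[OF holo_onD[OF F zb]])
  then have "cjacobian (loewner_limit G) z *v v = exp s *\<^sub>R (cjacobian ?f (flow G s z) *v (A *v v))" for v
    by meson
  then show ?thesis by (simp add: cjacobian_eq[OF A(1)] invertible_matrix_inv[OF A(2)])
qed

text \<open>The derivative along a holomorphic vector field is the limit of the difference quotients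
  \<open>n (f (w + h w / n) - f w)\<close>.\<close>

lemma holo_on_derivative_along:
  fixes f h :: "complex ^ 'n \<Rightarrow> complex ^ 'n"
  assumes f: "holo_on (ball 0 1) f" and h: "holo_on (ball 0 1) h"
  shows "holo_on (ball 0 1) (\<lambda>w. cjacobian f w *v h w)"
proof -
  have local: "holo_on (ball 0 R) (\<lambda>w. cjacobian f w *v h w)" if R: "0 < R" "R < 1" for R
  proof -
    obtain R1 where R1: "R < R1" "R1 < 1" using R(2) dense by blast
    obtain R2 where R2: "R1 < R2" "R2 < 1" using R1(2) dense by blast
    obtain M where M: "M > 0" "\<And>x. x \<in> cball 0 R \<Longrightarrow> norm (h x) \<le> M" using holo_on_bounded_cball[OF h R(2)] by blast
    obtain M2 where M2: "M2 > 0" "\<And>x. x \<in> cball 0 R2 \<Longrightarrow> norm (f x) \<le> M2" using holo_on_bounded_cball[OF f R2(2)] by blast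
    \<comment> \<open>From \<open>n0\<close> on, the displacement of \<open>w\<close> along
      \<open>h w\<close> has length at most \<open>R1 - R\<close>, so the displaced point remains in
      \<open>cball 0 R1\<close>.\<close>
    obtain n0 where n0: "M / (R1 - R) < real n0" using reals_Archimedean2 by blast
    define N where "N = (\<lambda>k. real (Suc (n0 + k)))"
    have N: "N k > 0" "M / N k \<le> R1 - R" "real k \<le> N k" for k
    proof -
      show 1: "N k > 0" by (simp add: N_def)
      have "M / (R1 - R) < N k" using n0 by (simp add: N_def)
      then show "M / N k \<le> R1 - R" using 1 R1 by (simp add: field_simps)
      show "real k \<le> N k" by (simp add: N_def)
    qed
    define g where "g = (\<lambda>k w. complex_of_real (N k) *s (f (w + complex_of_real (1 / N k) *s h w) - f w))"
    have pt: "w + complex_of_real (1 / N k) *s h w \<in> cball 0 R1" if "w \<in> cball 0 R" for w k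
    proof -
      have "norm (w + complex_of_real (1 / N k) *s h w) \<le> norm w + norm (h w) / N k"
        using norm_triangle_ineq[of w "complex_of_real (1 / N k) *s h w"] N(1)[of k]
        by (simp add: norm_vector_scalar_mult norm_divide)
      also have "norm (h w) / N k \<le> M / N k" using M(2)[OF that] N(1)[of k] by (intro divide_right_mono) auto
      finally show ?thesis using N(2)[of k] that by simp
    qed
    have ghol: "holo_on (ball 0 R) (g k)" for k
      unfolding g_def
    proof (intro holo_on_scale holo_on_diff)
      show fR: "holo_on (ball 0 R) f" by (rule holo_on_subset[OF f]) (use R in auto)
      show "holo_on (ball 0 R) (\<lambda>w. f (w + complex_of_real (1 / N k) *s h w))"
      proof (rule holo_on_compose(1)[OF _ f])
        show "holo_on (ball 0 R) (\<lambda>w. w + complex_of_real (1 / N k) *s h w)"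
          by (intro holo_on_add holo_on_id holo_on_scale holo_on_subset[OF h]) (use R in auto)
        show "(\<lambda>w. w + complex_of_real (1 / N k) *s h w) ` ball 0 R \<subseteq> ball 0 1"
        proof
          fix x assume "x \<in> (\<lambda>w. w + complex_of_real (1 / N k) *s h w) ` ball 0 R"
          then obtain w where "w \<in> ball 0 R" "x = w + complex_of_real (1 / N k) *s h w" by blast
          then show "x \<in> ball 0 1" using pt[of w k] R1 by simp
        qed
      qed
    qed
    define C where "C = 4 * M2 / (R2 - R1)\<^sup>2"
    have C: "C \<ge> 0" using M2 R2 by (simp add: C_def)
    have rate: "norm (g k w - cjacobian f w *v h w) \<le> C * M\<^sup>2 / N k" if w: "w \<in> cball 0 R" for k w
    proof -
      let ?d = "complex_of_real (1 / N k) *s h w"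
      have wc: "w \<in> cball 0 R1" using w R1 by simp
      have "norm (f (w + ?d) - f w - cjacobian f w *v (w + ?d - w)) \<le> C * (norm (w + ?d - w))\<^sup>2"
        unfolding C_def by (rule cauchy_estimate_second_order[OF f R2 M2(2) wc pt[OF w]])
      then have *: "norm (f (w + ?d) - f w - cjacobian f w *v ?d) \<le> C * (norm ?d)\<^sup>2" by simp
      have nd: "norm ?d = norm (h w) / N k" using N(1)[of k] by (simp add: norm_vector_scalar_mult norm_divide)
      have "complex_of_real (N k) *s (cjacobian f w *v ?d) = cjacobian f w *v h w"
        using N(1)[of k] by (simp add: vector_scalar_commute vector_smult_assoc flip: of_real_mult)
      then have "g k w - cjacobian f w *v h w = complex_of_real (N k) *s (f (w + ?d) - f w - cjacobian f w *v ?d)"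
        unfolding g_def by (simp only: vector_ssub_ldistrib)
      then have "norm (g k w - cjacobian f w *v h w) = N k * norm (f (w + ?d) - f w - cjacobian f w *v ?d)"
        using N(1)[of k] by (simp only: norm_vector_scalar_mult norm_of_real abs_of_pos)
      also have "\<dots> \<le> N k * (C * (norm (h w) / N k)\<^sup>2)" using * nd N(1)[of k] by (intro mult_left_mono) auto
      also have "\<dots> = C * (norm (h w))\<^sup>2 / N k" using N(1)[of k] by (simp add: power2_eq_square field_simps)
      also have "\<dots> \<le> C * M\<^sup>2 / N k"
        using C M(2)[OF w] N(1)[of k] by (intro divide_right_mono mult_left_mono power_mono) auto
      finally show ?thesis .
    qed
    show ?thesis
    proof (rule holo_on_uniform_limit[OF ghol])
      fix r assume r: "r < R"
      show "uniform_limit (cball 0 r) g (\<lambda>w. cjacobian f w *v h w) sequentially"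
        unfolding uniform_limit_iff
      proof (intro allI impI)
        fix e :: real assume e: "0 < e"
        obtain k0 where k0: "C * M\<^sup>2 / e < real k0" using reals_Archimedean2 by blast
        show "\<forall>\<^sub>F n in sequentially. \<forall>x\<in>cball 0 r. dist (g n x) (cjacobian f x *v h x) < e"
          unfolding eventually_sequentially
        proof (intro exI[of _ k0] allI impI ballI)
          fix k x assume k: "k0 \<le> k" and x: "(x :: complex ^ 'n) \<in> cball 0 r"
          have "C * M\<^sup>2 / e < N k" using k0 k N(3)[of k] by linarith
          then have "C * M\<^sup>2 / N k < e" using e N(1)[of k] by (simp add: field_simps)
          moreover have "x \<in> cball 0 R" using x r by simp
          ultimately show "dist (g k x) (cjacobian f x *v h x) < e" using rate[of x k] by (simp add: dist_norm)
        qed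
      qed
    qed
  qed
  show ?thesis
    unfolding holo_on_def
  proof
    fix z :: "complex ^ 'n" assume "z \<in> ball 0 1"
    then obtain R where R: "norm z < R" "R < 1" using dense by auto
    then have "0 < R" using norm_ge_zero[of z] by linarith
    from holo_onD[OF local[OF this R(2)], of z] R
    show "((\<lambda>w. cjacobian f w *v h w) has_derivative (\<lambda>v. cjacobian (\<lambda>w. cjacobian f w *v h w) z *v v)) (at z)" by simp
  qed
qed

section \<open>Times suited to the variation, and the effect of a spike on the limit map\<close>

text \<open>Weaker than a Lebesgue point: only the indefinite integral has to be differentiable with
  the right value. Points outside the ball are left out because the fields are constrained only
  inside it.\<close>

definition dense_lebesgue_time :: "(complex ^ 'n) set \<Rightarrow> (complex ^ 'n \<Rightarrow> real \<Rightarrow> complex ^ 'n) \<Rightarrow> real \<Rightarrow> bool" where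
  "dense_lebesgue_time D G t \<longleftrightarrow> 0 < t \<and> (\<forall>q\<in>D \<inter> ball 0 1.
     ((\<lambda>\<tau>. integral {0..\<tau>} (G q)) has_vector_derivative G q t) (at t))"

lemma class_M_field_integrable:
  assumes "class_M_field G" "norm z < 1"
  shows "G z integrable_on {a..b}"
proof -
  obtain K where "\<And>t. norm (G z t) \<le> K"
    using class_M_field_bounds[OF norm_ge_zero assms(2), where 'n='a] assms(1)
    by (metis mem_cball_0 order_refl)
  then show ?thesis
    using assms by (intro integrable_bounded_measurable_interval) (auto simp: class_M_field_def)
qed

lemma AE_dense_lebesgue_time:
  assumes G: "class_M_field G" and D: "countable D"
  obtains N where "negligible N" "\<And>t. 0 < t \<Longrightarrow> t \<notin> N \<Longrightarrow> dense_lebesgue_time D G t"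
proof -
  have "\<exists>N. negligible N \<and> (\<forall>t\<in>{0<..<real n} - N. ((\<lambda>\<tau>. integral {0..\<tau>} (G q)) has_vector_derivative G q t) (at t))"
    if "q \<in> D \<inter> ball 0 1" for q n
  proof -
    have "G q integrable_on {0..real n}" using class_M_field_integrable[OF G, of q] that by simp
    from integral_has_vector_derivative_AE[OF this] show ?thesis by metis
  qed
  then obtain N where N: "\<And>q n. q \<in> D \<inter> ball 0 1 \<Longrightarrow> negligible (N q n)"
    "\<And>q n t. q \<in> D \<inter> ball 0 1 \<Longrightarrow> t \<in> {0<..<real n} - N q n \<Longrightarrow>
       ((\<lambda>\<tau>. integral {0..\<tau>} (G q)) has_vector_derivative G q t) (at t)" by metis
  have 1: "negligible (\<Union>n. N q n)" if "q \<in> D \<inter> ball 0 1" for q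
    by (rule negligible_Union_nat) (rule N(1)[OF that])
  have "(\<Union>q\<in>D \<inter> ball 0 1. \<Union>n. N q n) \<in> null_sets lebesgue"
    by (rule null_sets_UN') (use 1 D in \<open>auto simp: negligible_iff_null_sets\<close>)
  then have neg: "negligible (\<Union>q\<in>D \<inter> ball 0 1. \<Union>n. N q n)" by (simp add: negligible_iff_null_sets)
  show thesis
  proof (rule that[OF neg])
    fix t :: real assume t: "0 < t" "t \<notin> (\<Union>q\<in>D \<inter> ball 0 1. \<Union>n. N q n)"
    obtain n where n: "t < real n" using reals_Archimedean2 by blast
    show "dense_lebesgue_time D G t"
      unfolding dense_lebesgue_time_def
    proof (intro conjI ballI t(1))
      fix q assume q: "q \<in> D \<inter> ball 0 1"
      then have "t \<in> {0<..<real n} - N q n" using t n by auto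
      then show "((\<lambda>\<tau>. integral {0..\<tau>} (G q)) has_vector_derivative G q t) (at t)" by (rule N(2)[OF q])
    qed
  qed
qed

text \<open>Finitely many points of \<open>D\<close> form a \<open>\<rho>\<close>-net of
  \<open>cball 0 r\<close> and share one \<open>\<delta>\<close>. The Lipschitz bound, uniform in
  time, carries the estimate from a net point to any \<open>w\<close>: one third of
  \<open>\<eta>\<close> is spent at the net point, and one third on each of the two replacements, in
  the integral and in the value at \<open>t\<close>.\<close>

lemma dense_lebesgue_time_uniform:
  fixes G :: "complex ^ 'n \<Rightarrow> real \<Rightarrow> complex ^ 'n"
  assumes G: "class_M_field G" and D: "\<And>X. open X \<Longrightarrow> X \<noteq> {} \<Longrightarrow> \<exists>d\<in>D. d \<in> X"
    and t: "dense_lebesgue_time D G t" and r: "0 \<le> r" "r < 1" and \<eta>: "0 < \<eta>"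
  obtains \<delta> where "0 < \<delta>" "\<And>\<epsilon> w. 0 < \<epsilon> \<Longrightarrow> \<epsilon> < \<delta> \<Longrightarrow> \<epsilon> \<le> t \<Longrightarrow> norm w \<le> r \<Longrightarrow>
    norm (integral {t - \<epsilon>..t} (G w) - \<epsilon> *\<^sub>R G w t) \<le> \<eta> * \<epsilon>"
proof -
  \<comment> \<open>Net points may lie slightly outside \<open>cball 0 r\<close>, so the Lipschitz
    constant is taken on a larger ball.\<close>
  define r' where "r' = (1 + r) / 2"
  have r': "r < r'" "r' < 1" "0 \<le> r'" using r by (simp_all add: r'_def)
  obtain K where K: "0 < K"
    "\<And>t z w. z \<in> cball 0 r' \<Longrightarrow> w \<in> cball 0 r' \<Longrightarrow> norm (G z t - G w t) \<le> K * norm (z - w)"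
    using class_M_field_bounds[OF r'(3,2), where 'n='n] G by metis
  define \<rho> where "\<rho> = min (r' - r) (\<eta> / (3 * K))"
  have \<rho>: "\<rho> > 0" "\<rho> \<le> r' - r" "K * \<rho> \<le> \<eta> / 3"
  proof -
    show "\<rho> > 0" "\<rho> \<le> r' - r" using r' \<eta> K by (simp_all add: \<rho>_def)
    have "K * \<rho> \<le> K * (\<eta> / (3 * K))" using K by (intro mult_left_mono) (auto simp: \<rho>_def)
    then show "K * \<rho> \<le> \<eta> / 3" using K by simp
  qed
  define Q where "Q = D \<inter> ball 0 r'"
  have "cball 0 r \<subseteq> (\<Union>q\<in>Q. ball q \<rho>)"
  proof
    fix w :: "complex ^ 'n" assume w: "w \<in> cball 0 r"
    have "ball w \<rho> \<noteq> {}" using \<rho> by simp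
    from D[OF open_ball this] obtain q where q: "q \<in> D" "q \<in> ball w \<rho>" by blast
    have "norm q \<le> norm w + norm (q - w)" using norm_triangle_ineq[of w "q - w"] by simp
    also have "\<dots> < r + \<rho>" using q w by (simp add: dist_norm norm_minus_commute)
    finally have "q \<in> Q" using q \<rho> by (simp add: Q_def)
    then show "w \<in> (\<Union>q\<in>Q. ball q \<rho>)" using q by (auto simp: dist_commute)
  qed
  then obtain P where P: "P \<subseteq> Q" "finite P" "cball 0 r \<subseteq> (\<Union>q\<in>P. ball q \<rho>)"
    using compactE_image[OF compact_cball, of Q "\<lambda>q. ball q \<rho>" "0 :: complex ^ 'n" r] by (metis open_ball)
  have "\<exists>d>0. \<forall>y. \<bar>y - t\<bar> < d \<longrightarrow>
      norm (integral {0..y} (G q) - integral {0..t} (G q) - (y - t) *\<^sub>R G q t) \<le> (\<eta> / 3) * \<bar>y - t\<bar>" if "q \<in> Q" for q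
  proof -
    have "((\<lambda>\<tau>. integral {0..\<tau>} (G q)) has_vector_derivative G q t) (at t)"
      using t that r' unfolding dense_lebesgue_time_def Q_def by auto
    from has_vector_derivative_atD[OF this, of "\<eta> / 3"] \<eta> show ?thesis by (metis divide_pos_pos zero_less_numeral)
  qed
  then obtain d where d: "\<And>q. q \<in> Q \<Longrightarrow> d q > 0"
    "\<And>q y. q \<in> Q \<Longrightarrow> \<bar>y - t\<bar> < d q \<Longrightarrow>
      norm (integral {0..y} (G q) - integral {0..t} (G q) - (y - t) *\<^sub>R G q t) \<le> (\<eta> / 3) * \<bar>y - t\<bar>" by metis
  define \<delta> where "\<delta> = Min (insert 1 (d ` P))"
  have \<delta>: "\<delta> > 0" "\<And>q. q \<in> P \<Longrightarrow> \<delta> \<le> d q"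
    using P d(1) by (auto simp: \<delta>_def)
  show thesis
  proof (rule that[OF \<delta>(1)])
    fix \<epsilon> and w :: "complex ^ 'n" assume \<epsilon>: "0 < \<epsilon>" "\<epsilon> < \<delta>" "\<epsilon> \<le> t" and w: "norm w \<le> r"
    obtain q where q: "q \<in> P" "w \<in> ball q \<rho>" using P(3) w by auto
    have qQ: "q \<in> Q" using q P by blast
    then have q1: "norm q < 1" "norm w < 1" "q \<in> cball 0 r'" "w \<in> cball 0 r'" using r' w by (auto simp: Q_def)
    have wq: "norm (w - q) \<le> \<rho>" using q by (simp add: dist_norm norm_minus_commute)
    have Gwq: "norm (G w \<tau> - G q \<tau>) \<le> \<eta> / 3" for \<tau>
    proof -
      have "norm (G w \<tau> - G q \<tau>) \<le> K * norm (w - q)" by (rule K(2)[OF q1(4,3)])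
      also have "\<dots> \<le> K * \<rho>" using wq K by (intro mult_left_mono) auto
      finally show ?thesis using \<rho>(3) by linarith
    qed
    have int: "G x integrable_on {a..b}" if "norm x < 1" for x a b by (rule class_M_field_integrable[OF G that])
    have "integral {0..t} (G q) = integral {0..t - \<epsilon>} (G q) + integral {t - \<epsilon>..t} (G q)"
      using Henstock_Kurzweil_Integration.integral_combine[of 0 "t - \<epsilon>" t "G q"] int[OF q1(1)] \<epsilon> by simp
    moreover have "norm (integral {0..t - \<epsilon>} (G q) - integral {0..t} (G q) - ((t - \<epsilon>) - t) *\<^sub>R G q t) \<le> (\<eta> / 3) * \<bar>(t - \<epsilon>) - t\<bar>"
      by (rule d(2)[OF qQ]) (use \<epsilon> \<delta>(2)[OF q(1)] in simp)
    ultimately have 1: "norm (integral {t - \<epsilon>..t} (G q) - \<epsilon> *\<^sub>R G q t) \<le> \<eta> / 3 * \<epsilon>"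
      using \<epsilon> norm_minus_commute[of "integral {t - \<epsilon>..t} (G q)" "\<epsilon> *\<^sub>R G q t"] by simp
    have "norm (integral {t - \<epsilon>..t} (\<lambda>\<tau>. G w \<tau> - G q \<tau>)) \<le> integral {t - \<epsilon>..t} (\<lambda>_. \<eta> / 3)"
      by (rule Henstock_Kurzweil_Integration.integral_norm_bound_integral)
         (use Gwq int q1 in \<open>auto intro!: integrable_diff\<close>)
    then have 2: "norm (integral {t - \<epsilon>..t} (G w) - integral {t - \<epsilon>..t} (G q)) \<le> \<eta> / 3 * \<epsilon>"
      using \<epsilon> by (simp add: Henstock_Kurzweil_Integration.integral_diff[OF int int] q1 mult.commute)
    have 3: "norm (\<epsilon> *\<^sub>R G q t - \<epsilon> *\<^sub>R G w t) \<le> \<eta> / 3 * \<epsilon>"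
    proof -
      have "norm (\<epsilon> *\<^sub>R G q t - \<epsilon> *\<^sub>R G w t) = \<epsilon> * norm (G w t - G q t)"
        using \<epsilon> by (simp add: scaleR_diff_right[symmetric] norm_minus_commute)
      also have "\<dots> \<le> \<epsilon> * (\<eta> / 3)" using Gwq \<epsilon> by (intro mult_left_mono) auto
      finally show ?thesis by (simp add: mult.commute)
    qed
    have "integral {t - \<epsilon>..t} (G w) - \<epsilon> *\<^sub>R G w t =
        (integral {t - \<epsilon>..t} (G w) - integral {t - \<epsilon>..t} (G q)) + (integral {t - \<epsilon>..t} (G q) - \<epsilon> *\<^sub>R G q t)
         + (\<epsilon> *\<^sub>R G q t - \<epsilon> *\<^sub>R G w t)" by simp
    also have "norm \<dots> \<le> \<eta> / 3 * \<epsilon> + \<eta> / 3 * \<epsilon> + \<eta> / 3 * \<epsilon>"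
      by (intro norm_triangle_le add_mono 1 2 3)
    finally show "norm (integral {t - \<epsilon>..t} (G w) - \<epsilon> *\<^sub>R G w t) \<le> \<eta> * \<epsilon>" by (simp add: mult.commute)
  qed
qed

text \<open>With these endpoints the field agrees with \<open>G\<close> on the initial times up to
  and including \<open>t - \<epsilon>\<close>, as \<open>flow_cong_upto\<close> demands, and after a
  shift by \<open>t\<close> at all positive times.\<close>

definition spike_field :: "real \<Rightarrow> real \<Rightarrow> (complex ^ 'n \<Rightarrow> complex ^ 'n) \<Rightarrow>
    (complex ^ 'n \<Rightarrow> real \<Rightarrow> complex ^ 'n) \<Rightarrow> complex ^ 'n \<Rightarrow> real \<Rightarrow> complex ^ 'n" where
  "spike_field t \<epsilon> h G z \<tau> = (if \<tau> \<in> {t - \<epsilon><..t} then h z else G z \<tau>)"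

lemma class_M_field_spike:
  assumes G: "class_M_field G" and h: "h \<in> class_M"
  shows "class_M_field (spike_field t \<epsilon> h G)"
  unfolding class_M_field_def
proof (intro conjI ballI allI)
  fix z :: "complex ^ 'a" assume "z \<in> ball 0 1"
  then have "G z \<in> borel_measurable lebesgue" using G unfolding class_M_field_def by blast
  then have "(\<lambda>\<tau>. if \<tau> \<in> {t - \<epsilon><..t} then h z else G z \<tau>) \<in> borel_measurable lebesgue"
    by (intro measurable_If_set) auto
  then show "spike_field t \<epsilon> h G z \<in> borel_measurable lebesgue"
    by (rule measurable_cong[THEN iffD1, rotated]) (simp add: spike_field_def)
next
  fix \<tau>
  show "on_ball (\<lambda>z. spike_field t \<epsilon> h G z \<tau>) \<in> class_M"
  proof (cases "\<tau> \<in> {t - \<epsilon><..t}")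
    case True
    then have "(\<lambda>z. spike_field t \<epsilon> h G z \<tau>) = h" by (auto simp: spike_field_def)
    then show ?thesis using h on_ball_hol_eq[OF class_MD(5)[OF h]] by simp
  next
    case False
    then have "(\<lambda>z. spike_field t \<epsilon> h G z \<tau>) = (\<lambda>z. G z \<tau>)" by (auto simp: spike_field_def)
    then show ?thesis using G unfolding class_M_field_def by simp
  qed
qed

lemma spike_loewner_limit:
  assumes G: "class_M_field G" and h: "h \<in> class_M" and z: "norm z < 1" and t: "0 \<le> t"
  shows "loewner_limit (spike_field t \<epsilon> h G) z =
    exp t *\<^sub>R loewner_limit (\<lambda>z \<tau>. G z (t + \<tau>)) (flow (spike_field t \<epsilon> h G) t z)"
proof -
  have "AE_equal_fields (\<lambda>z \<tau>. spike_field t \<epsilon> h G z (t + \<tau>)) (\<lambda>z \<tau>. G z (t + \<tau>))"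
    unfolding AE_equal_fields_def by (rule exI[of _ "{}"]) (simp add: spike_field_def)
  from loewner_limit_AE_equal[OF class_M_field_shift[OF G] this]
  show ?thesis using loewner_limit_shift[OF class_M_field_spike[OF G h] z t] by metis
qed

lemma flow_increment:
  fixes G :: "complex ^ 'n \<Rightarrow> real \<Rightarrow> complex ^ 'n"
  assumes G: "class_M_field G" and z: "norm z < 1" and st: "0 \<le> s" "s \<le> t"
  shows "((\<lambda>\<tau>. G (flow G \<tau> z) \<tau>) has_integral flow G t z - flow G s z) {s..t}"
proof -
  note sol = flow_solution(1)[OF G z]
  obtain L where L: "L-lipschitz_on {0..t} (\<lambda>t. flow G t z)" using sol unfolding AE_solution_def by blast
  have lip: "L-lipschitz_on {s..t} (\<lambda>t. flow G t z)" by (rule lipschitz_on_subset[OF L]) (use st in auto)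
  obtain N where N: "negligible N" "\<And>t. 0 < t \<Longrightarrow> t \<notin> N \<Longrightarrow>
      ((\<lambda>t. flow G t z) has_vector_derivative G (flow G t z) t) (at t)"
    using AE_solution_derivativeE[OF sol] by blast
  show ?thesis
    by (rule fundamental_theorem_of_calculus_abs_cont[OF lipschitz_imp_abs_cont[OF lip] st(2) N(1)])
       (use N(2) st in auto)
qed

lemma flow_increment_bound:
  assumes G: "class_M_field G" and z: "norm z < 1" and st: "0 \<le> s" "s \<le> t"
    and K: "\<And>w \<tau>. norm w \<le> norm z \<Longrightarrow> norm (G w \<tau>) \<le> K"
  shows "norm (flow G t z - flow G s z) \<le> K * (t - s)"
proof -
  have K0: "0 \<le> K" using K[of z 0] norm_ge_zero order_trans by blast
  have "norm (flow G t z - flow G s z) \<le> K * measure lborel (cbox s t)"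
    by (rule has_integral_bound[OF K0, where f="\<lambda>\<tau>. G (flow G \<tau> z) \<tau>"])
       (use flow_increment[OF G z st] K flow_solution(3)[OF G z] st in auto)
  then show ?thesis using st by simp
qed

text \<open>Let \<open>y\<close> be the common position at time \<open>t - \<epsilon>\<close>, and
  \<open>a\<close> and \<open>w\<close> the positions at time \<open>t\<close> with and without the
  spike. Freezing the points at \<open>w\<close> gives \<open>a - y\<close> as
  \<open>\<epsilon> *\<^sub>R h w\<close> and \<open>w - y\<close> as the integral of
  \<open>G w\<close>, both up to second order in \<open>\<epsilon>\<close>; that integral is
  \<open>\<epsilon> *\<^sub>R G w t\<close> up to a small multiple of \<open>\<epsilon>\<close>. The
  Taylor expansion of \<open>f\<close> at \<open>w\<close> transports the difference
  \<open>a - w\<close>.\<close>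

theorem spike_variation:
  fixes G :: "complex ^ 'n \<Rightarrow> real \<Rightarrow> complex ^ 'n"
  assumes G: "class_M_field G" and h: "h \<in> class_M" and D: "\<And>X. open X \<Longrightarrow> X \<noteq> {} \<Longrightarrow> \<exists>d\<in>D. d \<in> X"
    and t: "dense_lebesgue_time D G t" and r: "0 \<le> r" "r < 1" and \<eta>: "0 < \<eta>"
  defines "f \<equiv> loewner_limit (\<lambda>z \<tau>. G z (t + \<tau>))"
  obtains \<delta> where "0 < \<delta>" "\<And>\<epsilon> z. 0 < \<epsilon> \<Longrightarrow> \<epsilon> < \<delta> \<Longrightarrow> \<epsilon> \<le> t \<Longrightarrow> norm z \<le> r \<Longrightarrow>
    norm (loewner_limit (spike_field t \<epsilon> h G) z - loewner_limit G z -
      \<epsilon> *\<^sub>R exp t *\<^sub>R (cjacobian f (flow G t z) *v (h (flow G t z) - G (flow G t z) t))) \<le> \<eta> * \<epsilon>"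
proof -
  have t0: "0 < t" using t unfolding dense_lebesgue_time_def by blast
  have f: "holo_on (ball 0 1) f"
    unfolding f_def using loewner_limit_hol[OF class_M_field_shift[OF G]] hol_iff by blast
  obtain K where K: "0 < K"
    "\<And>(G :: complex ^ 'n \<Rightarrow> real \<Rightarrow> complex ^ 'n) t z. class_M_field G \<Longrightarrow> z \<in> cball 0 r \<Longrightarrow> norm (G z t) \<le> K"
    "\<And>(G :: complex ^ 'n \<Rightarrow> real \<Rightarrow> complex ^ 'n) t z w. class_M_field G \<Longrightarrow> z \<in> cball 0 r \<Longrightarrow> w \<in> cball 0 r \<Longrightarrow>
       norm (G z t - G w t) \<le> K * norm (z - w)"
    using class_M_field_bounds[OF r, where 'n='n] by metis
  have hfield: "class_M_field (\<lambda>z \<tau>. h z)"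
    using h on_ball_hol_eq[OF class_MD(5)[OF h]] unfolding class_M_field_def by simp
  define r' where "r' = (1 + r) / 2"
  have r': "r < r'" "r' < 1" using r by (simp_all add: r'_def)
  obtain M where M: "M > 0" "\<And>x. x \<in> cball 0 r' \<Longrightarrow> norm (f x) \<le> M" using holo_on_bounded_cball[OF f r'(2)] by blast
  define C1 where "C1 = M / (r' - r)"
  define C2 where "C2 = 4 * M / (r' - r)\<^sup>2"
  have C: "C1 > 0" "C2 > 0" using M r' by (simp_all add: C1_def C2_def)
  \<comment> \<open>Half of the tolerance goes to the error in differentiating the integral:
    multiplied by \<open>C1\<close> and \<open>exp t\<close> it becomes
    \<open>\<eta> * \<epsilon> / 2\<close>. The other half is for the terms of second order in
    \<open>\<epsilon>\<close>, whose coefficients are collected in \<open>B\<close>.\<close>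
  define \<eta>1 where "\<eta>1 = exp (- t) * \<eta> / (2 * C1)"
  have \<eta>1: "\<eta>1 > 0" using \<eta> C by (simp add: \<eta>1_def)
  obtain \<delta>1 where \<delta>1: "0 < \<delta>1" "\<And>\<epsilon> w. 0 < \<epsilon> \<Longrightarrow> \<epsilon> < \<delta>1 \<Longrightarrow> \<epsilon> \<le> t \<Longrightarrow> norm w \<le> r \<Longrightarrow>
    norm (integral {t - \<epsilon>..t} (G w) - \<epsilon> *\<^sub>R G w t) \<le> \<eta>1 * \<epsilon>"
    using dense_lebesgue_time_uniform[OF G D t r \<eta>1] by blast
  define B where "B = C1 * (4 * K\<^sup>2) + C2 * (2 * K)\<^sup>2"
  have B: "B > 0" using C K by (simp add: B_def add_pos_pos)
  define \<delta> where "\<delta> = min \<delta>1 (exp (- t) * \<eta> / (2 * B))"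
  have \<delta>: "\<delta> > 0" using \<delta>1 B \<eta> by (simp add: \<delta>_def)
  show thesis
  proof (rule that[OF \<delta>])
    fix \<epsilon> :: real and z :: "complex ^ 'n" assume \<epsilon>: "0 < \<epsilon>" "\<epsilon> < \<delta>" "\<epsilon> \<le> t" and zr: "norm z \<le> r"
    let ?H = "spike_field t \<epsilon> h G"
    have H: "class_M_field ?H" by (rule class_M_field_spike[OF G h])
    have z: "norm z < 1" using zr r by linarith
    define y where "y = flow G (t - \<epsilon>) z"
    define w where "w = flow G t z"
    define a where "a = flow ?H t z"
    have yH: "flow ?H (t - \<epsilon>) z = y"
      unfolding y_def by (rule flow_cong_upto[OF H G z, of "t - \<epsilon>"]) (use \<epsilon> in \<open>auto simp: spike_field_def\<close>)
    have flr: "norm (flow G \<tau> z) \<le> r" "norm (flow ?H \<tau> z) \<le> r" if "0 \<le> \<tau>" for \<tau>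
      using flow_solution(3)[OF G z that] flow_solution(3)[OF H z that] zr by linarith+
    have wr: "norm w \<le> r" "norm a \<le> r" "norm w < 1" using flr[of t] t0 r by (auto simp: w_def a_def intro: order.strict_trans1)
    have incG: "norm (flow G \<tau> z - y) \<le> K * \<epsilon>" if "\<tau> \<in> {t - \<epsilon>..t}" for \<tau>
    proof -
      have "norm (flow G \<tau> z - y) \<le> K * (\<tau> - (t - \<epsilon>))"
        unfolding y_def by (rule flow_increment_bound[OF G z]) (use that \<epsilon> K(2)[OF G] zr in auto)
      also have "\<dots> \<le> K * \<epsilon>" using that K by (intro mult_left_mono) auto
      finally show ?thesis .
    qed
    have incH: "norm (flow ?H \<tau> z - y) \<le> K * \<epsilon>" if "\<tau> \<in> {t - \<epsilon>..t}" for \<tau>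
    proof -
      have "norm (flow ?H \<tau> z - flow ?H (t - \<epsilon>) z) \<le> K * (\<tau> - (t - \<epsilon>))"
        by (rule flow_increment_bound[OF H z]) (use that \<epsilon> K(2)[OF H] zr in auto)
      also have "\<dots> \<le> K * \<epsilon>" using that K by (intro mult_left_mono) auto
      finally show ?thesis unfolding yH .
    qed
    have wy: "norm (w - y) \<le> K * \<epsilon>" "norm (a - y) \<le> K * \<epsilon>"
      unfolding w_def a_def using incG[of t] incH[of t] \<epsilon> by auto
    \<comment> \<open>The point is frozen at the unperturbed end position \<open>w\<close>, where
      the first variation is evaluated. Positions during the spike are within
      \<open>2 * K * \<epsilon>\<close> of \<open>w\<close>, since they and \<open>w\<close> are
      within \<open>K * \<epsilon>\<close> of \<open>y\<close>.\<close>
    have 1: "norm ((a - y) - \<epsilon> *\<^sub>R h w) \<le> (K * (2 * K * \<epsilon>)) * \<epsilon>"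
    proof -
      have "((\<lambda>\<tau>. ?H (flow ?H \<tau> z) \<tau>) has_integral a - y) {t - \<epsilon>..t}"
        using flow_increment[OF H z, of "t - \<epsilon>" t] \<epsilon> unfolding a_def yH by simp
      then have "((\<lambda>\<tau>. h (flow ?H \<tau> z)) has_integral a - y) {t - \<epsilon>..t}"
        by (rule has_integral_spike[OF negligible_sing[of "t - \<epsilon>"], rotated]) (simp add: spike_field_def)
      moreover have "((\<lambda>\<tau>. h w) has_integral \<epsilon> *\<^sub>R h w) {t - \<epsilon>..t}"
        using has_integral_const_real[of "h w" "t - \<epsilon>" t] \<epsilon> by simp
      ultimately have "((\<lambda>\<tau>. h (flow ?H \<tau> z) - h w) has_integral (a - y) - \<epsilon> *\<^sub>R h w) {t - \<epsilon>..t}"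
        by (rule has_integral_diff)
      then have "norm ((a - y) - \<epsilon> *\<^sub>R h w) \<le> (K * (2 * K * \<epsilon>)) * measure lborel (cbox (t - \<epsilon>) t)"
      proof (intro has_integral_bound)
        show "0 \<le> K * (2 * K * \<epsilon>)" using K \<epsilon> by simp
        fix \<tau> assume \<tau>: "\<tau> \<in> cbox (t - \<epsilon>) t"
        have "norm (h (flow ?H \<tau> z) - h w) \<le> K * norm (flow ?H \<tau> z - w)"
          by (rule K(3)[OF hfield]) (use flr(2)[of \<tau>] \<tau> \<epsilon> wr in auto)
        also have "norm (flow ?H \<tau> z - w) \<le> norm (flow ?H \<tau> z - y) + norm (w - y)"
          using norm_triangle_ineq4[of "flow ?H \<tau> z - y" "w - y"] by simp
        also have "\<dots> \<le> 2 * K * \<epsilon>" using incH[of \<tau>] wy \<tau> by simp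
        finally show "norm (h (flow ?H \<tau> z) - h w) \<le> K * (2 * K * \<epsilon>)" using K by (simp add: mult_left_mono)
      qed simp
      then show ?thesis using \<epsilon> by simp
    qed
    have 2: "norm ((w - y) - integral {t - \<epsilon>..t} (G w)) \<le> (K * (2 * K * \<epsilon>)) * \<epsilon>"
    proof -
      have "((\<lambda>\<tau>. G (flow G \<tau> z) \<tau>) has_integral w - y) {t - \<epsilon>..t}"
        using flow_increment[OF G z, of "t - \<epsilon>" t] \<epsilon> unfolding w_def y_def by simp
      moreover have "((\<lambda>\<tau>. G w \<tau>) has_integral integral {t - \<epsilon>..t} (G w)) {t - \<epsilon>..t}"
        using integrable_integral[OF class_M_field_integrable[OF G wr(3)]] by blast
      ultimately have "((\<lambda>\<tau>. G (flow G \<tau> z) \<tau> - G w \<tau>) has_integral (w - y) - integral {t - \<epsilon>..t} (G w)) {t - \<epsilon>..t}"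
        by (rule has_integral_diff)
      then have "norm ((w - y) - integral {t - \<epsilon>..t} (G w)) \<le> (K * (2 * K * \<epsilon>)) * measure lborel (cbox (t - \<epsilon>) t)"
      proof (intro has_integral_bound)
        show "0 \<le> K * (2 * K * \<epsilon>)" using K \<epsilon> by simp
        fix \<tau> assume \<tau>: "\<tau> \<in> cbox (t - \<epsilon>) t"
        have "norm (G (flow G \<tau> z) \<tau> - G w \<tau>) \<le> K * norm (flow G \<tau> z - w)"
          by (rule K(3)[OF G]) (use flr(1)[of \<tau>] \<tau> \<epsilon> wr in auto)
        also have "norm (flow G \<tau> z - w) \<le> norm (flow G \<tau> z - y) + norm (w - y)"
          using norm_triangle_ineq4[of "flow G \<tau> z - y" "w - y"] by simp
        also have "\<dots> \<le> 2 * K * \<epsilon>" using incG[of \<tau>] wy \<tau> by simp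
        finally show "norm (G (flow G \<tau> z) \<tau> - G w \<tau>) \<le> K * (2 * K * \<epsilon>)" using K by (simp add: mult_left_mono)
      qed simp
      then show ?thesis using \<epsilon> by simp
    qed
    have 3: "norm (integral {t - \<epsilon>..t} (G w) - \<epsilon> *\<^sub>R G w t) \<le> \<eta>1 * \<epsilon>"
      by (rule \<delta>1(2)) (use \<epsilon> wr in \<open>simp_all add: \<delta>_def\<close>)
    define v where "v = h w - G w t"
    have "(a - w) - \<epsilon> *\<^sub>R v = ((a - y) - \<epsilon> *\<^sub>R h w) - (((w - y) - integral {t - \<epsilon>..t} (G w)) + (integral {t - \<epsilon>..t} (G w) - \<epsilon> *\<^sub>R G w t))"
      by (simp add: v_def algebra_simps)
    also have "norm \<dots> \<le> norm ((a - y) - \<epsilon> *\<^sub>R h w) +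
        norm (((w - y) - integral {t - \<epsilon>..t} (G w)) + (integral {t - \<epsilon>..t} (G w) - \<epsilon> *\<^sub>R G w t))"
      by (rule norm_triangle_ineq4)
    also have "\<dots> \<le> norm ((a - y) - \<epsilon> *\<^sub>R h w) +
        (norm ((w - y) - integral {t - \<epsilon>..t} (G w)) + norm (integral {t - \<epsilon>..t} (G w) - \<epsilon> *\<^sub>R G w t))"
      by (intro add_left_mono norm_triangle_ineq)
    also have "\<dots> \<le> (K * (2 * K * \<epsilon>)) * \<epsilon> + ((K * (2 * K * \<epsilon>)) * \<epsilon> + \<eta>1 * \<epsilon>)"
      by (intro add_mono 1 2 3)
    also have "\<dots> = 4 * K\<^sup>2 * \<epsilon>\<^sup>2 + \<eta>1 * \<epsilon>" by (simp add: power2_eq_square)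
    finally have 4: "norm ((a - w) - \<epsilon> *\<^sub>R v) \<le> 4 * K\<^sup>2 * \<epsilon>\<^sup>2 + \<eta>1 * \<epsilon>" .
    have aw: "norm (a - w) \<le> 2 * K * \<epsilon>"
      using norm_triangle_ineq4[of "a - y" "w - y"] wy by simp
    have wc: "w \<in> cball 0 r" "a \<in> cball 0 r" using wr by auto
    have "norm (f a - f w - cjacobian f w *v (a - w)) \<le> C2 * (norm (a - w))\<^sup>2"
      unfolding C2_def by (rule cauchy_estimate_second_order[OF f r' M(2) wc])
    also have "\<dots> \<le> C2 * (2 * K * \<epsilon>)\<^sup>2" using aw C by (intro mult_left_mono power_mono) auto
    finally have 5: "norm (f a - f w - cjacobian f w *v (a - w)) \<le> C2 * (2 * K)\<^sup>2 * \<epsilon>\<^sup>2"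
      by (simp add: power_mult_distrib)
    have "norm (cjacobian f w *v ((a - w) - \<epsilon> *\<^sub>R v)) \<le> C1 * norm ((a - w) - \<epsilon> *\<^sub>R v)"
      unfolding C1_def by (rule cjacobian_bound[OF f r' M(2) wc(1)])
    also have "\<dots> \<le> C1 * (4 * K\<^sup>2 * \<epsilon>\<^sup>2 + \<eta>1 * \<epsilon>)" using 4 C by (intro mult_left_mono) auto
    finally have 6: "norm (cjacobian f w *v ((a - w) - \<epsilon> *\<^sub>R v)) \<le> C1 * (4 * K\<^sup>2 * \<epsilon>\<^sup>2 + \<eta>1 * \<epsilon>)" .
    have lin: "cjacobian f w *v (\<epsilon> *\<^sub>R v) = \<epsilon> *\<^sub>R (cjacobian f w *v v)"
      by (rule linear_scale[OF matrix_vector_mul_linear])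
    have "f a - f w - \<epsilon> *\<^sub>R (cjacobian f w *v v) =
        (f a - f w - cjacobian f w *v (a - w)) + cjacobian f w *v ((a - w) - \<epsilon> *\<^sub>R v)"
      unfolding matrix_vector_mult_diff_distrib[of _ "a - w"] lin by simp
    also have "norm \<dots> \<le> C2 * (2 * K)\<^sup>2 * \<epsilon>\<^sup>2 + C1 * (4 * K\<^sup>2 * \<epsilon>\<^sup>2 + \<eta>1 * \<epsilon>)"
      by (intro norm_triangle_le add_mono 5 6)
    also have "\<dots> = B * \<epsilon> * \<epsilon> + C1 * \<eta>1 * \<epsilon>" by (simp add: B_def power2_eq_square algebra_simps)
    also have "\<dots> \<le> exp (- t) * \<eta> / 2 * \<epsilon> + exp (- t) * \<eta> / 2 * \<epsilon>"
    proof (intro add_mono mult_right_mono)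
      have "B * \<epsilon> \<le> B * (exp (- t) * \<eta> / (2 * B))" using \<epsilon> B by (intro mult_left_mono) (auto simp: \<delta>_def)
      then show "B * \<epsilon> \<le> exp (- t) * \<eta> / 2" using B by simp
      show "C1 * \<eta>1 \<le> exp (- t) * \<eta> / 2" using C by (simp add: \<eta>1_def)
    qed (use \<epsilon> in auto)
    finally have 7: "norm (f a - f w - \<epsilon> *\<^sub>R (cjacobian f w *v v)) \<le> exp (- t) * (\<eta> * \<epsilon>)" by (simp add: mult_ac)
    have "loewner_limit ?H z - loewner_limit G z - \<epsilon> *\<^sub>R exp t *\<^sub>R (cjacobian f w *v v) =
        exp t *\<^sub>R (f a - f w - \<epsilon> *\<^sub>R (cjacobian f w *v v))"
      using spike_loewner_limit[OF G h z, of t \<epsilon>] loewner_limit_shift[OF G z, of t] t0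
      by (simp add: f_def a_def w_def algebra_simps)
    then have "norm (loewner_limit ?H z - loewner_limit G z - \<epsilon> *\<^sub>R exp t *\<^sub>R (cjacobian f w *v v))
        \<le> exp t * (exp (- t) * (\<eta> * \<epsilon>))" using 7 by (simp add: mult_left_mono)
    also have "\<dots> = \<eta> * \<epsilon>" by (simp add: mult.assoc[symmetric] exp_add[symmetric])
    finally show "norm (loewner_limit ?H z - loewner_limit G z -
      \<epsilon> *\<^sub>R exp t *\<^sub>R (cjacobian f (flow G t z) *v (h (flow G t z) - G (flow G t z) t))) \<le> \<eta> * \<epsilon>"
      unfolding v_def w_def .
  qed
qed

section \<open>Extremal functions\<close>

lemma hol_add_scale:
  assumes "f \<in> hol" "h \<in> hol"
  shows "(\<lambda>z. f z + c *s h z) \<in> hol"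
  using assms holo_on_add[OF _ holo_on_scale, of _ f h c] unfolding hol_iff by simp

text \<open>Restricting the complex limit to real increments makes \<open>Re \<Phi>\<close>
  differentiable along a real segment, as the mean value theorem requires.\<close>

lemma has_directional_derivative_real:
  fixes f h :: "complex ^ 'n \<Rightarrow> complex ^ 'n"
  assumes "has_directional_derivative \<Phi> (\<lambda>z. f z + complex_of_real s *s h z) h l"
  shows "((\<lambda>s. Re (\<Phi> (\<lambda>z. f z + complex_of_real s *s h z))) has_real_derivative Re l) (at s)"
proof -
  define \<psi> where "\<psi> = (\<lambda>s. \<Phi> (\<lambda>z. f z + complex_of_real s *s h z))"
  have "((\<lambda>\<delta>. (\<Phi> (\<lambda>z. (f z + complex_of_real s *s h z) + \<delta> *s h z) - \<psi> s) / \<delta>) \<longlongrightarrow> l) (at 0)"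
    using assms unfolding has_directional_derivative_def \<psi>_def .
  moreover have "filterlim complex_of_real (at 0) (at 0)"
    unfolding filterlim_at by (auto intro!: tendsto_eq_intros eventually_at_filter[THEN iffD2])
  ultimately have "((\<lambda>x. (\<Phi> (\<lambda>z. (f z + complex_of_real s *s h z) + complex_of_real x *s h z) - \<psi> s) / complex_of_real x) \<longlongrightarrow> l) (at 0)"
    by (rule filterlim_compose)
  moreover have "(\<lambda>z. (f z + complex_of_real s *s h z) + complex_of_real x *s h z) = (\<lambda>z. f z + complex_of_real (s + x) *s h z)" for x
    by (simp add: vector_sadd_rdistrib add.assoc)
  ultimately have "((\<lambda>x. (\<psi> (s + x) - \<psi> s) / complex_of_real x) \<longlongrightarrow> l) (at 0)"
    unfolding \<psi>_def by simp
  from tendsto_Re[OF this] show ?thesis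
    unfolding DERIV_def \<psi>_def by simp
qed

text \<open>By the mean value theorem the difference quotient is \<open>Re (\<Lambda> q H)\<close> with \<open>q\<close> between the two
  points, and \<open>\<Lambda>\<close> is jointly continuous.\<close>

lemma real_difference_quotient_tendsto:
  fixes F H :: "complex ^ 'n \<Rightarrow> complex ^ 'n" and p h :: "nat \<Rightarrow> complex ^ 'n \<Rightarrow> complex ^ 'n"
  assumes V: "openin hol_topology V" "F \<in> V"
    and dd: "\<And>f h. f \<in> V \<Longrightarrow> h \<in> hol \<Longrightarrow> has_directional_derivative \<Phi> f h (\<Lambda> f h)"
    and cont: "continuous_map (prod_topology (subtopology hol_topology V) hol_topology) euclidean (\<lambda>(f, h). \<Lambda> f h)"
    and hol: "\<And>k. p k \<in> hol" "\<And>k. h k \<in> hol" "H \<in> hol"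
    and p: "\<And>r. 0 \<le> r \<Longrightarrow> r < 1 \<Longrightarrow> uniform_limit (cball 0 r) p F sequentially"
    and h: "\<And>r. 0 \<le> r \<Longrightarrow> r < 1 \<Longrightarrow> uniform_limit (cball 0 r) h H sequentially"
    and \<delta>: "\<And>k. 0 < \<delta> k" "\<delta> \<longlonglongrightarrow> 0"
  shows "(\<lambda>k. (Re (\<Phi> (\<lambda>z. p k z + complex_of_real (\<delta> k) *s h k z)) - Re (\<Phi> (p k))) / \<delta> k) \<longlonglongrightarrow> Re (\<Lambda> F H)"
proof -
  define q where "q = (\<lambda>k s z. p k z + complex_of_real s *s h k z)"
  have qhol: "q k s \<in> hol" for k s unfolding q_def by (intro hol_add_scale hol)
  have Fhol: "F \<in> hol" using openin_subset[OF V(1)] V(2) topspace_hol_topology by blast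
  have qlim: "limitin hol_topology (\<lambda>k. q k (\<xi> k)) F sequentially" if \<xi>: "\<And>k. 0 \<le> \<xi> k" "\<And>k. \<xi> k \<le> \<delta> k" for \<xi>
  proof (rule limitin_hol_topologyI[OF Fhol])
    show "\<forall>\<^sub>F k in sequentially. q k (\<xi> k) \<in> hol" using qhol by simp
    fix r :: real assume r: "0 \<le> r" "r < 1"
    have "holo_on (ball 0 1) H" using hol(3) unfolding hol_iff by blast
    then obtain M where M: "M > 0" "\<And>x. x \<in> cball 0 r \<Longrightarrow> norm (H x) \<le> M" using holo_on_bounded_cball r(2) by blast
    show "uniform_limit (cball 0 r) (\<lambda>k. q k (\<xi> k)) F sequentially"
      unfolding uniform_limit_iff
    proof (intro allI impI)
      fix e :: real assume e: "0 < e"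
      have "\<forall>\<^sub>F k in sequentially. \<forall>x\<in>cball 0 r. dist (p k x) (F x) < e / 2"
        using p[OF r] e unfolding uniform_limit_iff by (meson half_gt_zero)
      moreover have "\<forall>\<^sub>F k in sequentially. \<forall>x\<in>cball 0 r. dist (h k x) (H x) < 1"
        using h[OF r] unfolding uniform_limit_iff by (meson zero_less_one)
      moreover have "\<forall>\<^sub>F k in sequentially. \<delta> k < e / (2 * (M + 1))"
        using \<delta>(2) e M by (intro order_tendstoD(2)) auto
      ultimately show "\<forall>\<^sub>F k in sequentially. \<forall>x\<in>cball 0 r. dist (q k (\<xi> k) x) (F x) < e"
      proof eventually_elim
        case (elim k)
        show ?case
        proof
          fix x :: "complex ^ 'n" assume x: "x \<in> cball 0 r"
          have "dist (h k x) (H x) < 1" "norm (H x) \<le> M" using elim(2) M(2) x by blast+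
          then have hk: "norm (h k x) \<le> M + 1"
            using norm_triangle_ineq[of "h k x - H x" "H x"] by (simp add: dist_norm)
          have "norm (complex_of_real (\<xi> k) *s h k x) = \<xi> k * norm (h k x)"
            using \<xi>(1)[of k] by (simp add: norm_vector_scalar_mult)
          also have "\<dots> \<le> \<delta> k * (M + 1)" using \<xi>[of k] \<delta>(1)[of k] hk by (intro mult_mono) auto
          also have "\<dots> < e / 2" using elim(3) M by (simp add: field_simps)
          finally have 1: "norm (complex_of_real (\<xi> k) *s h k x) < e / 2" .
          have 2: "norm (p k x - F x) < e / 2" using elim(1) x by (simp add: dist_norm)
          have "dist (q k (\<xi> k) x) (F x) = norm ((p k x - F x) + complex_of_real (\<xi> k) *s h k x)"
            by (simp add: q_def dist_norm algebra_simps)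
          also have "\<dots> < e" using norm_triangle_ineq[of "p k x - F x" "complex_of_real (\<xi> k) *s h k x"] 1 2 by linarith
          finally show "dist (q k (\<xi> k) x) (F x) < e" .
        qed
      qed
    qed
  qed
  have evV: "\<forall>\<^sub>F k in sequentially. q k (\<xi> k) \<in> V" if "\<And>k. 0 \<le> \<xi> k" "\<And>k. \<xi> k \<le> \<delta> k" for \<xi>
    using qlim[OF that] V unfolding limitin_def by blast
  \<comment> \<open>The whole segment must lie in \<open>V\<close> for large \<open>k\<close>, while
    convergence is known only for one parameter per \<open>k\<close>. So \<open>b\<close> is taken
    to be a parameter at which the segment leaves \<open>V\<close>, if there is one. The maps at
    these parameters still converge to \<open>F\<close> and hence lie in \<open>V\<close>
    eventually; from then on no parameter leaves \<open>V\<close>.\<close>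
  have "\<exists>b. 0 \<le> b \<and> b \<le> \<delta> k \<and> (q k b \<in> V \<longrightarrow> (\<forall>s. 0 \<le> s \<and> s \<le> \<delta> k \<longrightarrow> q k s \<in> V))" for k
  proof (cases "\<forall>s. 0 \<le> s \<and> s \<le> \<delta> k \<longrightarrow> q k s \<in> V")
    case True then show ?thesis using less_imp_le[OF \<delta>(1)[of k]] by (intro exI[of _ 0]) simp
  next
    case False then show ?thesis by blast
  qed
  then obtain bad where bad: "\<And>k. 0 \<le> bad k" "\<And>k. bad k \<le> \<delta> k"
    "\<And>k. q k (bad k) \<in> V \<Longrightarrow> \<forall>s. 0 \<le> s \<and> s \<le> \<delta> k \<longrightarrow> q k s \<in> V" by metis
  have "\<forall>\<^sub>F k in sequentially. q k (bad k) \<in> V" by (rule evV[OF bad(1,2)])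
  then have good: "\<forall>\<^sub>F k in sequentially. \<forall>s. 0 \<le> s \<and> s \<le> \<delta> k \<longrightarrow> q k s \<in> V"
    by (rule eventually_mono) (rule bad(3))
  \<comment> \<open>The value 0 in the remaining case only makes \<open>\<xi>\<close> defined for
    every \<open>k\<close>.\<close>
  have mvt: "\<exists>s. 0 \<le> s \<and> s \<le> \<delta> k \<and> ((\<forall>s. 0 \<le> s \<and> s \<le> \<delta> k \<longrightarrow> q k s \<in> V) \<longrightarrow>
      Re (\<Phi> (q k (\<delta> k))) - Re (\<Phi> (q k 0)) = \<delta> k * Re (\<Lambda> (q k s) (h k)))" for k
  proof (cases "\<forall>s. 0 \<le> s \<and> s \<le> \<delta> k \<longrightarrow> q k s \<in> V")
    case True
    have "((\<lambda>s. Re (\<Phi> (q k s))) has_real_derivative Re (\<Lambda> (q k s) (h k))) (at s)" if "0 \<le> s" "s \<le> \<delta> k" for s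
      using has_directional_derivative_real[of \<Phi> "p k" s "h k"] dd[of "q k s" "h k"] True that hol
      unfolding q_def by blast
    from MVT2[OF \<delta>(1) this] obtain s where "0 < s" "s < \<delta> k"
      "Re (\<Phi> (q k (\<delta> k))) - Re (\<Phi> (q k 0)) = (\<delta> k - 0) * Re (\<Lambda> (q k s) (h k))" by blast
    then show ?thesis by (intro exI[of _ s]) simp
  next
    case False
    then show ?thesis using \<delta>(1)[of k] by (intro exI[of _ 0]) (auto simp: less_imp_le)
  qed
  then obtain \<xi> where \<xi>: "\<And>k. 0 \<le> \<xi> k" "\<And>k. \<xi> k \<le> \<delta> k"
    "\<And>k. \<forall>s. 0 \<le> s \<and> s \<le> \<delta> k \<longrightarrow> q k s \<in> V \<Longrightarrow>
      Re (\<Phi> (q k (\<delta> k))) - Re (\<Phi> (q k 0)) = \<delta> k * Re (\<Lambda> (q k (\<xi> k)) (h k))" by metis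
  have lim1: "limitin (subtopology hol_topology V) (\<lambda>k. q k (\<xi> k)) F sequentially"
    unfolding limitin_subtopology using V(2) evV[OF \<xi>(1,2)] qlim[OF \<xi>(1,2)] by blast
  have lim2: "limitin hol_topology h H sequentially"
    by (rule limitin_hol_topologyI[OF hol(3) _ h]) (use hol in simp)
  have "limitin (prod_topology (subtopology hol_topology V) hol_topology) (\<lambda>k. (q k (\<xi> k), h k)) (F, H) sequentially"
    unfolding limitin_pairwise using lim1 lim2 by (simp add: o_def)
  from continuous_map_limit[OF cont this]
  have "(\<lambda>k. \<Lambda> (q k (\<xi> k)) (h k)) \<longlonglongrightarrow> \<Lambda> F H" by (simp add: o_def)
  then have "(\<lambda>k. Re (\<Lambda> (q k (\<xi> k)) (h k))) \<longlonglongrightarrow> Re (\<Lambda> F H)" by (rule tendsto_Re)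
  moreover have "\<forall>\<^sub>F k in sequentially. Re (\<Lambda> (q k (\<xi> k)) (h k)) = (Re (\<Phi> (q k (\<delta> k))) - Re (\<Phi> (q k 0))) / \<delta> k"
    using good
  proof (rule eventually_mono)
    fix k assume "\<forall>s. 0 \<le> s \<and> s \<le> \<delta> k \<longrightarrow> q k s \<in> V"
    from \<xi>(3)[OF this] show "Re (\<Lambda> (q k (\<xi> k)) (h k)) = (Re (\<Phi> (q k (\<delta> k))) - Re (\<Phi> (q k 0))) / \<delta> k"
      using \<delta>(1)[of k] by simp
  qed
  ultimately have "(\<lambda>k. (Re (\<Phi> (q k (\<delta> k))) - Re (\<Phi> (q k 0))) / \<delta> k) \<longlonglongrightarrow> Re (\<Lambda> F H)"
    by (rule Lim_transform_eventually)
  moreover have "q k 0 = p k" for k by (simp add: q_def)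
  ultimately show ?thesis by (simp add: q_def)
qed

text \<open>Moving from \<open>F + \<delta> B\<close> to \<open>F + \<delta> A\<close> is a step in
  direction \<open>A - B\<close> from a base point that tends to \<open>F\<close>. The quotient for
  this step is the difference of the quotients for \<open>A\<close> and for \<open>B\<close> at
  \<open>F\<close>, and all three converge. This is why the preceding limit admits varying base
  points.\<close>

lemma Re_complex_derivative_diff:
  fixes F A B :: "complex ^ 'n \<Rightarrow> complex ^ 'n"
  assumes V: "openin hol_topology V" "F \<in> V"
    and dd: "\<And>f h. f \<in> V \<Longrightarrow> h \<in> hol \<Longrightarrow> has_directional_derivative \<Phi> f h (\<Lambda> f h)"
    and cont: "continuous_map (prod_topology (subtopology hol_topology V) hol_topology) euclidean (\<lambda>(f, h). \<Lambda> f h)"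
    and hol: "A \<in> hol" "B \<in> hol"
  shows "Re (\<Lambda> F (\<lambda>z. A z - B z)) = Re (\<Lambda> F A) - Re (\<Lambda> F B)"
proof -
  define \<delta> where "\<delta> = (\<lambda>k. inverse (real (Suc k)))"
  have \<delta>: "0 < \<delta> k" "\<delta> \<longlonglongrightarrow> 0" for k
    unfolding \<delta>_def by (simp, rule LIMSEQ_inverse_real_of_nat)
  have Fhol: "F \<in> hol" using openin_subset[OF V(1)] V(2) topspace_hol_topology by blast
  have ABhol: "(\<lambda>z. A z - B z) \<in> hol"
    using hol_add_scale[OF hol, of "- 1"] by (simp add: vector_sneg_minus1[symmetric])
  have const: "uniform_limit S (\<lambda>k. f) f sequentially" for S and f :: "complex ^ 'n \<Rightarrow> complex ^ 'n"
    unfolding uniform_limit_iff by simp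
  define p where "p = (\<lambda>k z. F z + complex_of_real (\<delta> k) *s B z)"
  have phol: "p k \<in> hol" for k unfolding p_def by (intro hol_add_scale Fhol hol)
  have plim: "uniform_limit (cball 0 r) p F sequentially" if r: "0 \<le> r" "r < 1" for r
    unfolding uniform_limit_iff
  proof (intro allI impI)
    have "holo_on (ball 0 1) B" using hol(2) unfolding hol_iff by blast
    then obtain M where M: "M > 0" "\<And>x. x \<in> cball 0 r \<Longrightarrow> norm (B x) \<le> M" using holo_on_bounded_cball r(2) by blast
    fix e :: real assume e: "0 < e"
    have "\<forall>\<^sub>F k in sequentially. \<delta> k < e / M" using \<delta>(2) e M by (intro order_tendstoD(2)) auto
    then show "\<forall>\<^sub>F k in sequentially. \<forall>x\<in>cball 0 r. dist (p k x) (F x) < e"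
    proof (rule eventually_mono, intro ballI)
      fix k x assume k: "\<delta> k < e / M" and x: "(x :: complex ^ 'n) \<in> cball 0 r"
      have "dist (p k x) (F x) = \<delta> k * norm (B x)"
        using \<delta>(1)[of k] by (simp add: p_def dist_norm norm_vector_scalar_mult)
      also have "\<dots> \<le> \<delta> k * M" using M(2)[OF x] \<delta>(1)[of k] by (intro mult_left_mono) auto
      also have "\<dots> < e" using k M by (simp add: field_simps)
      finally show "dist (p k x) (F x) < e" .
    qed
  qed
  have 1: "(\<lambda>k. (Re (\<Phi> (\<lambda>z. p k z + complex_of_real (\<delta> k) *s (A z - B z))) - Re (\<Phi> (p k))) / \<delta> k) \<longlonglongrightarrow> Re (\<Lambda> F (\<lambda>z. A z - B z))"
    by (rule real_difference_quotient_tendsto[OF V dd cont phol ABhol ABhol plim const \<delta>])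
  have 2: "(\<lambda>k. (Re (\<Phi> (\<lambda>z. F z + complex_of_real (\<delta> k) *s A z)) - Re (\<Phi> F)) / \<delta> k) \<longlonglongrightarrow> Re (\<Lambda> F A)"
    by (rule real_difference_quotient_tendsto[OF V dd cont Fhol hol(1) hol(1) const const \<delta>])
  have 3: "(\<lambda>k. (Re (\<Phi> (\<lambda>z. F z + complex_of_real (\<delta> k) *s B z)) - Re (\<Phi> F)) / \<delta> k) \<longlonglongrightarrow> Re (\<Lambda> F B)"
    by (rule real_difference_quotient_tendsto[OF V dd cont Fhol hol(2) hol(2) const const \<delta>])
  have pA: "(\<lambda>z. p k z + complex_of_real (\<delta> k) *s (A z - B z)) = (\<lambda>z. F z + complex_of_real (\<delta> k) *s A z)" for k
    by (simp add: p_def vector_ssub_ldistrib)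
  have "(\<lambda>k. (Re (\<Phi> (\<lambda>z. F z + complex_of_real (\<delta> k) *s A z)) - Re (\<Phi> F)) / \<delta> k -
      (Re (\<Phi> (\<lambda>z. F z + complex_of_real (\<delta> k) *s B z)) - Re (\<Phi> F)) / \<delta> k) \<longlonglongrightarrow> Re (\<Lambda> F A) - Re (\<Lambda> F B)"
    by (rule tendsto_diff[OF 2 3])
  then have "(\<lambda>k. (Re (\<Phi> (\<lambda>z. F z + complex_of_real (\<delta> k) *s A z)) - Re (\<Phi> (p k))) / \<delta> k) \<longlonglongrightarrow> Re (\<Lambda> F A) - Re (\<Lambda> F B)"
    by (simp add: p_def diff_divide_distrib)
  with 1 show ?thesis unfolding pA using LIMSEQ_unique by blast
qed

text \<open>The functional is determined on \<open>hol\<close> only, so the transported map has to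
  be placed there before \<open>\<Lambda>\<close> can replace it.\<close>

lemma transported_map_hol:
  fixes G :: "complex ^ 'n \<Rightarrow> real \<Rightarrow> complex ^ 'n"
  assumes G: "class_M_field G" and t: "0 \<le> t" and h: "h \<in> hol"
  shows "on_ball (\<lambda>z. exp t *\<^sub>R (cjacobian (loewner_limit (\<lambda>z \<tau>. G z (t + \<tau>))) (flow G t z) *v h (flow G t z))) \<in> hol"
proof (rule on_ball_hol)
  let ?f = "loewner_limit (\<lambda>z \<tau>. G z (t + \<tau>))"
  have f: "holo_on (ball 0 1) ?f" using loewner_limit_hol[OF class_M_field_shift[OF G]] unfolding hol_iff by blast
  have h': "holo_on (ball 0 1) h" using h unfolding hol_iff by blast
  have "holo_on (ball 0 1) (\<lambda>z. cjacobian ?f (flow G t z) *v h (flow G t z))"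
    by (rule holo_on_compose(1)[OF flow_holo_on[OF G t] holo_on_derivative_along[OF f h']])
       (use flow_norm_less_1[OF G _ t] in auto)
  from holo_on_scale[OF this, of "complex_of_real (exp t)"]
  show "holo_on (ball 0 1) (\<lambda>z. exp t *\<^sub>R (cjacobian ?f (flow G t z) *v h (flow G t z)))"
    by (simp only: scale_of_real)
qed

text \<open>The limit map of the spiked field is exactly \<open>F\<close> plus
  \<open>\<delta> k\<close> times \<open>p k\<close>, a step whose direction varies with
  \<open>k\<close> and tends to \<open>A\<close> by \<open>spike_variation\<close>. The quotients of
  \<open>Re \<Phi>\<close> along these steps are nonpositive by extremality, and so is their
  limit.\<close>

lemma extremal_inequality:
  fixes G :: "complex ^ 'n \<Rightarrow> real \<Rightarrow> complex ^ 'n"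
  assumes G: "class_M_field G" and h: "h \<in> class_M" and D: "\<And>X. open X \<Longrightarrow> X \<noteq> {} \<Longrightarrow> \<exists>d\<in>D. d \<in> X"
    and t: "dense_lebesgue_time D G t"
    and V: "openin hol_topology V" "loewner_limit G \<in> V"
    and dd: "\<And>f h. f \<in> V \<Longrightarrow> h \<in> hol \<Longrightarrow> has_directional_derivative \<Phi> f h (\<Lambda> f h)"
    and cont: "continuous_map (prod_topology (subtopology hol_topology V) hol_topology) euclidean (\<lambda>(f, h). \<Lambda> f h)"
    and extr: "\<And>f. f \<in> class_S0 \<Longrightarrow> Re (\<Phi> f) \<le> Re (\<Phi> (loewner_limit G))"
  defines "W \<equiv> \<lambda>h. on_ball (\<lambda>z. exp t *\<^sub>R (cjacobian (loewner_limit (\<lambda>z \<tau>. G z (t + \<tau>))) (flow G t z) *v h (flow G t z)))"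
  shows "Re (\<Lambda> (loewner_limit G) (W h)) \<le> Re (\<Lambda> (loewner_limit G) (W (on_ball (\<lambda>z. G z t))))"
proof -
  let ?F = "loewner_limit G"
  let ?f = "loewner_limit (\<lambda>z \<tau>. G z (t + \<tau>))"
  have t0: "0 < t" using t unfolding dense_lebesgue_time_def by blast
  have M: "on_ball (\<lambda>z. G z t) \<in> class_M" using G unfolding class_M_field_def by blast
  have Whol: "W h \<in> hol" "W (on_ball (\<lambda>z. G z t)) \<in> hol"
    unfolding W_def using transported_map_hol[OF G, of t] t0 class_MD(5)[OF h] class_MD(5)[OF M] by simp_all
  define A where "A = (\<lambda>z. W h z - W (on_ball (\<lambda>z. G z t)) z)"
  have Ahol: "A \<in> hol"
    unfolding A_def using hol_add_scale[OF Whol, of "- 1"] by (simp add: vector_sneg_minus1[symmetric])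
  have Aeq: "A z = exp t *\<^sub>R (cjacobian ?f (flow G t z) *v (h (flow G t z) - G (flow G t z) t))" if "norm z < 1" for z
    using that flow_norm_less_1[OF G that, of t] t0
    by (simp add: A_def W_def on_ball_eq matrix_vector_mult_diff_distrib scaleR_diff_right)
  \<comment> \<open>The factor \<open>t\<close> ensures \<open>\<delta> k \<le> t\<close>, so every
    spike lies in positive times.\<close>
  define \<delta> where "\<delta> = (\<lambda>k. t * inverse (real (Suc k)))"
  have \<delta>: "0 < \<delta> k" "\<delta> k \<le> t" for k
    using t0 by (simp_all add: \<delta>_def field_simps)
  have \<delta>lim: "\<delta> \<longlonglongrightarrow> 0"
    unfolding \<delta>_def using tendsto_mult[OF tendsto_const LIMSEQ_inverse_real_of_nat, of t] by simp
  define f where "f = (\<lambda>k. loewner_limit (spike_field t (\<delta> k) h G))"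
  have fhol: "f k \<in> hol" for k unfolding f_def by (rule loewner_limit_hol[OF class_M_field_spike[OF G h]])
  have Fhol: "?F \<in> hol" by (rule loewner_limit_hol[OF G])
  define p where "p = (\<lambda>k z. complex_of_real (1 / \<delta> k) *s (f k z - ?F z))"
  have phol: "p k \<in> hol" for k
    using fhol[of k] Fhol unfolding hol_iff p_def by (auto intro!: holo_on_scale holo_on_diff)
  have plim: "uniform_limit (cball 0 r) p A sequentially" if r: "0 \<le> r" "r < 1" for r
    unfolding uniform_limit_iff
  proof (intro allI impI)
    fix e :: real assume e: "0 < e"
    obtain d where d: "0 < d" "\<And>\<epsilon> z. 0 < \<epsilon> \<Longrightarrow> \<epsilon> < d \<Longrightarrow> \<epsilon> \<le> t \<Longrightarrow> norm z \<le> r \<Longrightarrow>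
      norm (loewner_limit (spike_field t \<epsilon> h G) z - ?F z -
      \<epsilon> *\<^sub>R exp t *\<^sub>R (cjacobian ?f (flow G t z) *v (h (flow G t z) - G (flow G t z) t))) \<le> (e / 2) * \<epsilon>"
      using spike_variation[OF G h D t r half_gt_zero[OF e]] by blast
    have "\<forall>\<^sub>F k in sequentially. \<delta> k < d" using \<delta>lim d(1) by (rule order_tendstoD(2))
    then show "\<forall>\<^sub>F k in sequentially. \<forall>x\<in>cball 0 r. dist (p k x) (A x) < e"
    proof (rule eventually_mono, intro ballI)
      fix k x assume k: "\<delta> k < d" and x: "(x :: complex ^ 'n) \<in> cball 0 r"
      have x1: "norm x \<le> r" "norm x < 1" using x r by auto
      have "norm (f k x - ?F x - \<delta> k *\<^sub>R A x) \<le> (e / 2) * \<delta> k"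
        unfolding f_def Aeq[OF x1(2)] by (rule d(2)[OF \<delta>(1) k \<delta>(2) x1(1)])
      moreover have "p k x - A x = (1 / \<delta> k) *\<^sub>R (f k x - ?F x - \<delta> k *\<^sub>R A x)"
        using \<delta>(1)[of k] unfolding p_def scale_of_real by (simp add: scaleR_diff_right)
      then have "dist (p k x) (A x) = (1 / \<delta> k) * norm (f k x - ?F x - \<delta> k *\<^sub>R A x)"
        using \<delta>(1)[of k] by (simp only: dist_norm norm_scaleR) simp
      ultimately have "dist (p k x) (A x) \<le> (1 / \<delta> k) * ((e / 2) * \<delta> k)"
        using \<delta>(1)[of k] by (simp only: mult_left_mono less_imp_le zero_less_divide_1_iff)
      also have "\<dots> < e" using \<delta>(1)[of k] e by simp
      finally show "dist (p k x) (A x) < e" .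
    qed
  qed
  have const: "uniform_limit S (\<lambda>k. ?F) ?F sequentially" for S
    unfolding uniform_limit_iff by simp
  have "(\<lambda>k. (Re (\<Phi> (\<lambda>z. ?F z + complex_of_real (\<delta> k) *s p k z)) - Re (\<Phi> ?F)) / \<delta> k) \<longlonglongrightarrow> Re (\<Lambda> ?F A)"
    by (rule real_difference_quotient_tendsto[OF V dd cont Fhol phol Ahol const plim \<delta>(1) \<delta>lim])
  moreover have "(\<lambda>z. ?F z + complex_of_real (\<delta> k) *s p k z) = f k" for k
    using \<delta>(1)[of k] by (simp add: p_def vector_smult_assoc flip: of_real_mult)
  ultimately have "(\<lambda>k. (Re (\<Phi> (f k)) - Re (\<Phi> ?F)) / \<delta> k) \<longlonglongrightarrow> Re (\<Lambda> ?F A)" by simp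
  moreover have "(Re (\<Phi> (f k)) - Re (\<Phi> ?F)) / \<delta> k \<le> 0" for k
  proof -
    have "f k \<in> class_S0"
      unfolding class_S0_def f_def using class_M_field_herglotz[OF class_M_field_spike[OF G h]] by blast
    from extr[OF this] show ?thesis using \<delta>(1)[of k] by (simp add: divide_le_0_iff)
  qed
  ultimately have "Re (\<Lambda> ?F A) \<le> 0"
    by (intro LIMSEQ_le_const2) auto
  moreover have "Re (\<Lambda> ?F A) = Re (\<Lambda> ?F (W h)) - Re (\<Lambda> ?F (W (on_ball (\<lambda>z. G z t))))"
    unfolding A_def by (rule Re_complex_derivative_diff[OF V dd cont Whol])
  ultimately show ?thesis by linarith
qed

theorem theorem1p4:
  fixes U :: "(complex ^ 'n \<Rightarrow> complex ^ 'n) set"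
    and \<Phi> L :: "(complex ^ 'n \<Rightarrow> complex ^ 'n) \<Rightarrow> complex"
    and F :: "complex ^ 'n \<Rightarrow> complex ^ 'n"
    and G :: "complex ^ 'n \<Rightarrow> real \<Rightarrow> complex ^ 'n"
  assumes "openin hol_topology U"
    and "class_S0 \<subseteq> U"
    and "continuous_map (subtopology hol_topology U) euclidean \<Phi>"
    and "F \<in> class_S0"
    and "\<forall>f \<in> class_S0. Re (\<Phi> f) \<le> Re (\<Phi> F)"
    and "has_complex_derivative U \<Phi> F L"
    and "herglotz_field G"
    and "F = loewner_limit G"
  shows "AE t in lebesgue_on {0..}. \<forall>h \<in> class_M.
           Re (transported_functional L F G t h)
             \<le> Re (transported_functional L F G t (on_ball (\<lambda>z. G z t)))"
proof -
  \<comment> \<open>The normalised field has the same flow at nonnegative times and the same limit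
    map, and at almost every time it agrees with \<open>G\<close>, so the right-hand side of the
    inequality is unchanged there.\<close>
  obtain H where H: "class_M_field H" and GH: "AE_equal_fields G H"
    using herglotz_field_normalize[OF assms(7)] by blast
  have F: "F = loewner_limit H" using assms(8) loewner_limit_AE_equal[OF H GH] by simp
  obtain V \<Lambda> where V: "openin hol_topology V" "F \<in> V"
    and dd: "\<And>f h. f \<in> V \<Longrightarrow> h \<in> hol \<Longrightarrow> has_directional_derivative \<Phi> f h (\<Lambda> f h)"
    and cont: "continuous_map (prod_topology (subtopology hol_topology V) hol_topology) euclidean (\<lambda>(f, h). \<Lambda> f h)"
    and L: "\<And>h. h \<in> hol \<Longrightarrow> L h = \<Lambda> F h"
    using assms(6) unfolding has_complex_derivative_def by blast
  obtain D :: "(complex ^ 'n) set" where D: "countable D" "\<And>X. open X \<Longrightarrow> X \<noteq> {} \<Longrightarrow> \<exists>d\<in>D. d \<in> X"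
    using countable_dense_setE by blast
  obtain N1 where N1: "negligible N1" "\<And>t. 0 < t \<Longrightarrow> t \<notin> N1 \<Longrightarrow> dense_lebesgue_time D H t"
    using AE_dense_lebesgue_time[OF H D(1)] by blast
  obtain N2 where N2: "negligible N2" "\<And>t. 0 < t \<Longrightarrow> t \<notin> N2 \<Longrightarrow> (\<forall>z\<in>ball 0 1. G z t = H z t)"
    using GH unfolding AE_equal_fields_def by blast
  have main: "Re (transported_functional L F G t h) \<le> Re (transported_functional L F G t (on_ball (\<lambda>z. G z t)))"
    if t: "0 < t" "t \<notin> N1 \<union> N2" and h: "h \<in> class_M" for t h
  proof -
    define W where "W = (\<lambda>h. on_ball (\<lambda>z. exp t *\<^sub>R
      (cjacobian (loewner_limit (\<lambda>z \<tau>. H z (t + \<tau>))) (flow H t z) *v h (flow H t z))))"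
    have t0: "0 \<le> t" using t by simp
    have flow: "flow G t z = flow H t z" if "z \<in> ball 0 1" for z
      using flow_AE_equal[OF H GH, of z t] that t0 by simp
    have W: "transported_functional L F G t h = \<Lambda> F (W h)" if "h \<in> hol" for h
    proof -
      have "on_ball (\<lambda>z. cjacobian F z *v (matrix_inv (cjacobian (flow G t) z) *v h (flow G t z))) = W h"
        unfolding W_def
      proof (rule on_ball_cong)
        fix z :: "complex ^ 'n" assume z: "z \<in> ball 0 1"
        have "cjacobian (flow G t) z = cjacobian (flow H t) z"
          by (rule holo_on_transform(2)[OF flow_holo_on[OF H t0] open_ball flow z])
        then show "cjacobian F z *v (matrix_inv (cjacobian (flow G t) z) *v h (flow G t z)) = exp t *\<^sub>R
            (cjacobian (loewner_limit (\<lambda>z \<tau>. H z (t + \<tau>))) (flow H t z) *v h (flow H t z))"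
          using loewner_limit_cjacobian[OF H, of z t "h (flow H t z)"] z t0 by (simp add: F flow)
      qed
      moreover have "W h \<in> hol" unfolding W_def by (rule transported_map_hol[OF H t0 that])
      ultimately show ?thesis unfolding transported_functional_def using L by simp
    qed
    have GHt: "on_ball (\<lambda>z. G z t) = on_ball (\<lambda>z. H z t)"
      by (rule on_ball_cong) (use N2(2)[of t] t in auto)
    have M: "on_ball (\<lambda>z. H z t) \<in> class_M" using H unfolding class_M_field_def by blast
    have "Re (\<Lambda> F (W h)) \<le> Re (\<Lambda> F (W (on_ball (\<lambda>z. H z t))))"
      unfolding W_def F
    proof (rule extremal_inequality[OF H h D(2) _ V(1) _ dd cont])
      show "dense_lebesgue_time D H t" using N1(2)[of t] t by simp
      show "loewner_limit H \<in> V" using V(2) F by simp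
      show "Re (\<Phi> f) \<le> Re (\<Phi> (loewner_limit H))" if "f \<in> class_S0" for f using assms(5) that F by simp
    qed
    then show ?thesis unfolding GHt W[OF class_MD(5)[OF h]] W[OF class_MD(5)[OF M]] .
  qed
  show ?thesis
  \<comment> \<open>Time 0 is discarded because a spike needs room before \<open>t\<close>.\<close>
  proof (subst AE_lebesgue_on_iff_negligible, simp, intro exI[of _ "N1 \<union> N2 \<union> {0}"] conjI ballI)
    show "negligible (N1 \<union> N2 \<union> {0})" using N1(1) N2(1) by simp
    fix t h assume "t \<in> {0..} - (N1 \<union> N2 \<union> {0})" and h: "h \<in> (class_M :: (complex ^ 'n \<Rightarrow> complex ^ 'n) set)"
    then have "0 < t" "t \<notin> N1 \<union> N2" by auto
    then show "Re (transported_functional L F G t h) \<le> Re (transported_functional L F G t (on_ball (\<lambda>z. G z t)))"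
      by (rule main[OF _ _ h])
  qed
qed

end
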